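(* Let $(Q,L_d,f_d)$ be a forced discrete mechanical system with symmetry group $G$ and $Q$ connected, and let $\xi\in\mathfrak g=\mathrm{Lie}(G)$. If $df_d$ is horizontal, then there is a constant $\mu\in\mathbb R$ (depending on $\xi$) such that the quantities $J^{\pm}_{d,f,\xi}$ evolve according to $$J^+_{d,f,\xi}(q_1,q_2)=J^+_{d,f,\xi}(q_0,q_1)+\mu,\qquad J^-_{d,f,\xi}(q_1,q_2)=J^-_{d,f,\xi}(q_0,q_1)+\mu,$$ whenever $(q_1,q_2)$ is constructed from $(q_0,q_1)$ by the flow of the system, i.e. $(q_0,q_1,q_2)$ is a trajectory of $(Q,L_d,f_d)$.
   Context: Forced discrete mechanical system (FDMS): a triple $(Q,L_d,f_d)$ with $Q$ an $n$-dimensional manifold, $L_d:Q\times Q\to\mathbb R$ smooth, $f_d$ a $1$-form on $Q\times Q$, written $f_d(q_0,q_1)(\delta q_0,\delta q_1)=f_d^-(q_0,q_1)(\delta q_0)+f_d^+(q_0,q_1)(\delta q_1)$ with $f_d^-(q_0,q_1)\in T^*_{q_0}Q$ and $f_d^+(q_0,q_1)\in T^*_{q_1}Q$. $D_1L_d(q_0,q_1)\in T^*_{q_0}Q$, $D_2L_d(q_0,q_1)\in T^*_{q_1}Q$ are the partial differentials of $L_d$. Trajectories: $(q_0,q_1,q_2)$ is a trajectory if it satisfies the forced discrete Euler–Lagrange equation $D_2L_d(q_0,q_1)+D_1L_d(q_1,q_2)+f_d^+(q_0,q_1)+f_d^-(q_1,q_2)=0\in T^*_{q_1}Q$. Symmetry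 group: $G$ is a Lie group acting on $Q$ on the left so that $\pi:Q\to Q/G$ is a principal $G$-bundle; $G$ is a symmetry group of $(Q,L_d,f_d)$ if, for the diagonal action on $Q\times Q$, $L_d$ is $G$-invariant and $f_d:Q\times Q\to T^*(Q\times Q)$ is $G$-equivariant for the cotangent lift of the diagonal action (equivalently $f_d$ is a $G$-invariant $1$-form). For $\xi\in\mathfrak g$, $\xi_Q(q)=\frac{d}{dt}|_{t=0}\,\exp(t\xi)\cdot q$ is the infinitesimal generator. The forced discrete momentum maps are $$J^+_{d,f,\xi}(q_0,q_1):=\langle D_2L_d(q_0,q_1)+f_d^+(q_0,q_1),\xi_Q(q_1)\rangle,$$ $$J^-_{d,f,\xi}(q_0,q_1):=\langle -D_1L_d(q_0,q_1)-f_d^-(q_0,q_1),\xi_Q(q_0)\rangle.$$ A differential form on the total space of a bundle $\phi:M\to B$ is horizontal if it vanishes whenever any of its arguments is in $\ker T\phi$; here $df_d$ is horizontal with respect to the quotient map $Q\times Q\to(Q\times Q)/G$ for the diagonal action. *)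

theory Defs
  imports "HOL-Analysis.Analysis" "HOL-Algebra.Group_Action"
begin

section \<open>Smooth maps between normed spaces\<close>

text \<open>
  Model spaces have class banach and are required to be finite dimensional in smooth_manifold
  below.  A finite-dimensional normed space is complete, so this class is no restriction, whereas
  the class euclidean_space would exclude dimension 0 (discrete groups, or a quotient that is a
  point).

  In finite dimension, Ck_on k S f for open S says that f is k times continuously differentiable:
  all directional derivatives of the derivative are again of class C^(k-1).
\<close>

fun Ck_on :: "nat \<Rightarrow> 'a::real_normed_vector set \<Rightarrow> ('a \<Rightarrow> 'b::real_normed_vector) \<Rightarrow> bool" where
  "Ck_on 0 S f \<longleftrightarrow> continuous_on S f"
| "Ck_on (Suc k) S f \<longleftrightarrow> (\<forall>x\<in>S. f differentiable (at x)) \<and>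
     (\<forall>v. Ck_on k S (\<lambda>x. frechet_derivative f (at x) v))"

definition smooth_on :: "'a::real_normed_vector set \<Rightarrow> ('a \<Rightarrow> 'b::real_normed_vector) \<Rightarrow> bool" where
  "smooth_on S f \<longleftrightarrow> (\<forall>k. Ck_on k S f)"


section \<open>Smooth manifolds\<close>

type_synonym ('a, 'e) chart = "'a set \<times> ('a \<Rightarrow> 'e)"

abbreviation chart_dom :: "('a, 'e) chart \<Rightarrow> 'a set" where
  "chart_dom c \<equiv> fst c"

abbreviation chart_fun :: "('a, 'e) chart \<Rightarrow> 'a \<Rightarrow> 'e" where
  "chart_fun c \<equiv> snd c"

definition chart_inv :: "('a, 'e) chart \<Rightarrow> 'e \<Rightarrow> 'a" where
  "chart_inv c = inv_into (chart_dom c) (chart_fun c)"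

definition is_chart :: "'a topology \<Rightarrow> ('a, 'e::real_normed_vector) chart \<Rightarrow> bool" where
  "is_chart X c \<longleftrightarrow> openin X (chart_dom c) \<and> open (chart_fun c ` chart_dom c) \<and>
     homeomorphic_map (subtopology X (chart_dom c)) (top_of_set (chart_fun c ` chart_dom c)) (chart_fun c)"

text \<open>
  A manifold comes with an atlas and, for every point p, a preferred chart chart_at M p of that
  atlas around p.  The tangent space at p is represented by the model space 'e: a vector of 'e
  stands for the tangent vector having it as its coordinates in the preferred chart at p.  The
  choice of preferred charts is thus only a choice of a basis in every tangent space.
\<close>

record ('a, 'e) manifold =
  mtop :: "'a topology"
  atlas :: "('a, 'e) chart set"
  chart_at :: "'a \<Rightarrow> ('a, 'e) chart"

abbreviation pts :: "('a, 'e) manifold \<Rightarrow> 'a set" where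
  "pts M \<equiv> topspace (mtop M)"

definition smooth_manifold :: "('a, 'e::banach) manifold \<Rightarrow> bool" where
  "smooth_manifold M \<longleftrightarrow>
     Hausdorff_space (mtop M) \<and> second_countable (mtop M) \<and>
     (\<exists>B::'e set. finite B \<and> span B = UNIV) \<and>
     (\<forall>c\<in>atlas M. is_chart (mtop M) c) \<and>
     (\<forall>p\<in>pts M. chart_at M p \<in> atlas M \<and> p \<in> chart_dom (chart_at M p)) \<and>
     (\<forall>c\<in>atlas M. \<forall>d\<in>atlas M.
        smooth_on (chart_fun c ` (chart_dom c \<inter> chart_dom d)) (chart_fun d \<circ> chart_inv c))"

text \<open>Smoothness of a map defined on an open subset U of M.\<close>

definition smooth_map_on ::
    "'a set \<Rightarrow> ('a, 'e::banach) manifold \<Rightarrow> ('b, 'f::banach) manifold \<Rightarrow> ('a \<Rightarrow> 'b) \<Rightarrow> bool" where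
  "smooth_map_on U M N F \<longleftrightarrow>
     openin (mtop M) U \<and> continuous_map (subtopology (mtop M) U) (mtop N) F \<and>
     (\<forall>c\<in>atlas M. \<forall>d\<in>atlas N.
        smooth_on (chart_fun c ` {p \<in> chart_dom c \<inter> U. F p \<in> chart_dom d})
          (chart_fun d \<circ> F \<circ> chart_inv c))"

definition smooth_map ::
    "('a, 'e::banach) manifold \<Rightarrow> ('b, 'f::banach) manifold \<Rightarrow> ('a \<Rightarrow> 'b) \<Rightarrow> bool" where
  "smooth_map M N F \<longleftrightarrow> smooth_map_on (pts M) M N F"

text \<open>The tangent map of F at p, from the tangent space at p to the tangent space at F p.\<close>

definition mderiv ::
    "('a, 'e::banach) manifold \<Rightarrow> ('b, 'f::banach) manifold \<Rightarrow> ('a \<Rightarrow> 'b) \<Rightarrow> 'a \<Rightarrow> 'e \<Rightarrow> 'f" where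
  "mderiv M N F p =
     frechet_derivative (chart_fun (chart_at N (F p)) \<circ> F \<circ> chart_inv (chart_at M p))
       (at (chart_fun (chart_at M p) p))"

definition prod_chart :: "('a, 'e) chart \<Rightarrow> ('b, 'f) chart \<Rightarrow> ('a \<times> 'b, 'e \<times> 'f) chart" where
  "prod_chart c d = (chart_dom c \<times> chart_dom d, map_prod (chart_fun c) (chart_fun d))"

text \<open>
  With these preferred charts, the tangent space of the product at (p,q) is the product of the
  tangent spaces at p and at q.
\<close>

definition prod_manifold ::
    "('a, 'e) manifold \<Rightarrow> ('b, 'f) manifold \<Rightarrow> ('a \<times> 'b, 'e \<times> 'f) manifold" (infixr \<open>\<times>\<^sub>M\<close> 80) where
  "M \<times>\<^sub>M N =
     \<lparr>mtop = prod_topology (mtop M) (mtop N),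
      atlas = {prod_chart c d | c d. c \<in> atlas M \<and> d \<in> atlas N},
      chart_at = (\<lambda>(p, q). prod_chart (chart_at M p) (chart_at N q))\<rparr>"

definition real_line :: "(real, real) manifold" where
  "real_line = \<lparr>mtop = euclidean, atlas = {(UNIV, id)}, chart_at = (\<lambda>_. (UNIV, id))\<rparr>"

text \<open>The velocity of the curve \<gamma> at time 0.\<close>

definition has_velocity0 :: "('a, 'e::banach) manifold \<Rightarrow> (real \<Rightarrow> 'a) \<Rightarrow> 'e \<Rightarrow> bool" where
  "has_velocity0 M \<gamma> v \<longleftrightarrow>
     ((chart_fun (chart_at M (\<gamma> 0)) \<circ> \<gamma>) has_vector_derivative v) (at 0)"

definition velocity0 :: "('a, 'e::banach) manifold \<Rightarrow> (real \<Rightarrow> 'a) \<Rightarrow> 'e" where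
  "velocity0 M \<gamma> = vector_derivative (chart_fun (chart_at M (\<gamma> 0)) \<circ> \<gamma>) (at 0)"


section \<open>Differential forms\<close>

text \<open>The coordinate expression of the 1-form \<alpha> in the chart c, at the coordinate point x.\<close>

definition form_coord ::
    "('a, 'e::banach) manifold \<Rightarrow> ('a \<Rightarrow> 'e \<Rightarrow> real) \<Rightarrow> ('a, 'e) chart \<Rightarrow> 'e \<Rightarrow> 'e \<Rightarrow> real" where
  "form_coord M \<alpha> c x v =
     (let p = chart_inv c x
      in \<alpha> p (frechet_derivative (chart_fun (chart_at M p) \<circ> chart_inv c) (at x) v))"

definition smooth_one_form :: "('a, 'e::banach) manifold \<Rightarrow> ('a \<Rightarrow> 'e \<Rightarrow> real) \<Rightarrow> bool" where
  "smooth_one_form M \<alpha> \<longleftrightarrow>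
     (\<forall>p\<in>pts M. linear (\<alpha> p)) \<and>
     (\<forall>c\<in>atlas M. \<forall>v. smooth_on (chart_fun c ` chart_dom c) (\<lambda>x. form_coord M \<alpha> c x v))"

text \<open>
  The exterior derivative of a 1-form, by the usual formula in coordinates, evaluated at p in the
  preferred chart (the result is the same in any other chart).
\<close>

definition ext_deriv ::
    "('a, 'e::banach) manifold \<Rightarrow> ('a \<Rightarrow> 'e \<Rightarrow> real) \<Rightarrow> 'a \<Rightarrow> 'e \<Rightarrow> 'e \<Rightarrow> real" where
  "ext_deriv M \<alpha> p u v =
     (let c = chart_at M p; x = chart_fun c p
      in frechet_derivative (\<lambda>y. form_coord M \<alpha> c y v) (at x) u
       - frechet_derivative (\<lambda>y. form_coord M \<alpha> c y u) (at x) v)"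

definition horizontal_two_form ::
    "('a, 'e::banach) manifold \<Rightarrow> ('b, 'f::banach) manifold \<Rightarrow> ('a \<Rightarrow> 'b) \<Rightarrow>
     ('a \<Rightarrow> 'e \<Rightarrow> 'e \<Rightarrow> real) \<Rightarrow> bool" where
  "horizontal_two_form M B \<phi> \<omega> \<longleftrightarrow>
     (\<forall>p\<in>pts M. \<forall>u v. mderiv M B \<phi> p u = 0 \<or> mderiv M B \<phi> p v = 0 \<longrightarrow> \<omega> p u v = 0)"


section \<open>Lie groups, exponential map and actions\<close>

definition lie_group :: "'g monoid \<Rightarrow> ('g, 'h::banach) manifold \<Rightarrow> bool" where
  "lie_group G MG \<longleftrightarrow>
     group G \<and> smooth_manifold MG \<and> carrier G = pts MG \<and>
     smooth_map (MG \<times>\<^sub>M MG) MG (\<lambda>(a, b). a \<otimes>\<^bsub>G\<^esub> b) \<and>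
     smooth_map MG MG (\<lambda>a. inv\<^bsub>G\<^esub> a)"

text \<open>
  The Lie algebra of G is the tangent space at the identity, i.e. the model space 'h of MG.
  One-parameter subgroups are the continuous homomorphisms from the real line to G (they are
  automatically smooth), and exp \<xi> is the value at time 1 of the one with initial velocity \<xi>.
\<close>

definition one_param_subgroup :: "'g monoid \<Rightarrow> ('g, 'h::banach) manifold \<Rightarrow> (real \<Rightarrow> 'g) \<Rightarrow> bool" where
  "one_param_subgroup G MG \<gamma> \<longleftrightarrow>
     continuous_map euclidean (mtop MG) \<gamma> \<and> (\<forall>s t. \<gamma> (s + t) = \<gamma> s \<otimes>\<^bsub>G\<^esub> \<gamma> t)"

definition lie_exp :: "'g monoid \<Rightarrow> ('g, 'h::banach) manifold \<Rightarrow> 'h \<Rightarrow> 'g" where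
  "lie_exp G MG \<xi> = (THE \<gamma>. one_param_subgroup G MG \<gamma> \<and> has_velocity0 MG \<gamma> \<xi>) 1"

text \<open>
  The library's group_action only asks, besides the laws of a left action, that each \<Phi> g be
  undefined outside the set acted on.
\<close>

definition smooth_action ::
    "'g monoid \<Rightarrow> ('g, 'h::banach) manifold \<Rightarrow> ('q, 'e::banach) manifold \<Rightarrow>
     ('g \<Rightarrow> 'q \<Rightarrow> 'q) \<Rightarrow> bool" where
  "smooth_action G MG Q \<Phi> \<longleftrightarrow>
     group_action G (pts Q) \<Phi> \<and> smooth_map (MG \<times>\<^sub>M Q) Q (\<lambda>(g, q). \<Phi> g q)"

definition inf_generator ::
    "'g monoid \<Rightarrow> ('g, 'h::banach) manifold \<Rightarrow> ('q, 'e::banach) manifold \<Rightarrow>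
     ('g \<Rightarrow> 'q \<Rightarrow> 'q) \<Rightarrow> 'h \<Rightarrow> 'q \<Rightarrow> 'e" where
  "inf_generator G MG Q \<Phi> \<xi> q = velocity0 Q (\<lambda>t. \<Phi> (lie_exp G MG (t *\<^sub>R \<xi>)) q)"

text \<open>
  The manifold B is the orbit space M/G with a smooth structure such that the projection
  sending q to its orbit is a principal G-bundle: around every point of B there is an equivariant
  local trivialization q \<mapsto> (orbit of q, \<sigma> q), where G acts on itself by left translations.
  There is at most one such smooth structure on the set of orbits.
\<close>

definition principal_bundle ::
    "'g monoid \<Rightarrow> ('g, 'h::banach) manifold \<Rightarrow> ('q, 'e::banach) manifold \<Rightarrow>
     ('g \<Rightarrow> 'q \<Rightarrow> 'q) \<Rightarrow> ('q set, 'b::banach) manifold \<Rightarrow> bool" where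
  "principal_bundle G MG M \<Phi> B \<longleftrightarrow>
     smooth_manifold B \<and> pts B = orbits G (pts M) \<Phi> \<and> smooth_map M B (orbit G \<Phi>) \<and>
     (\<forall>b\<in>pts B. \<exists>U \<sigma>. openin (mtop B) U \<and> b \<in> U \<and>
        (let V = {q \<in> pts M. orbit G \<Phi> q \<in> U}; \<psi> = (\<lambda>q. (orbit G \<Phi> q, \<sigma> q))
         in bij_betw \<psi> V (U \<times> carrier G) \<and>
            smooth_map_on V M (B \<times>\<^sub>M MG) \<psi> \<and>
            smooth_map_on (U \<times> carrier G) (B \<times>\<^sub>M MG) M (inv_into V \<psi>) \<and>
            (\<forall>g\<in>carrier G. \<forall>q\<in>V. \<sigma> (\<Phi> g q) = g \<otimes>\<^bsub>G\<^esub> \<sigma> q)))"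

definition diag_action :: "'q set \<Rightarrow> ('g \<Rightarrow> 'q \<Rightarrow> 'q) \<Rightarrow> 'g \<Rightarrow> 'q \<times> 'q \<Rightarrow> 'q \<times> 'q" where
  "diag_action E \<Phi> g = restrict (\<lambda>(q0, q1). (\<Phi> g q0, \<Phi> g q1)) (E \<times> E)"

text \<open>
  The cotangent lift of \<Phi> g sends a covector \<alpha> at p to the covector at \<Phi> g p obtained by
  precomposing \<alpha> with the tangent map of the inverse of \<Phi> g.
\<close>

definition cotangent_lift ::
    "'g monoid \<Rightarrow> ('q, 'e::banach) manifold \<Rightarrow> ('g \<Rightarrow> 'q \<Rightarrow> 'q) \<Rightarrow> 'g \<Rightarrow> 'q \<Rightarrow>
     ('e \<Rightarrow> real) \<Rightarrow> ('e \<Rightarrow> real)" where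
  "cotangent_lift G M \<Phi> g p \<alpha> = \<alpha> \<circ> mderiv M M (\<Phi> (inv\<^bsub>G\<^esub> g)) (\<Phi> g p)"


section \<open>Forced discrete mechanical systems\<close>

definition fdms ::
    "('q, 'e::banach) manifold \<Rightarrow> ('q \<times> 'q \<Rightarrow> real) \<Rightarrow> ('q \<times> 'q \<Rightarrow> 'e \<times> 'e \<Rightarrow> real) \<Rightarrow> bool" where
  "fdms Q L f \<longleftrightarrow>
     smooth_manifold Q \<and> smooth_map (Q \<times>\<^sub>M Q) real_line L \<and> smooth_one_form (Q \<times>\<^sub>M Q) f"

definition D1 ::
    "('q, 'e::banach) manifold \<Rightarrow> ('q \<times> 'q \<Rightarrow> real) \<Rightarrow> 'q \<Rightarrow> 'q \<Rightarrow> 'e \<Rightarrow> real" where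
  "D1 Q L q0 q1 = mderiv Q real_line (\<lambda>q. L (q, q1)) q0"

definition D2 ::
    "('q, 'e::banach) manifold \<Rightarrow> ('q \<times> 'q \<Rightarrow> real) \<Rightarrow> 'q \<Rightarrow> 'q \<Rightarrow> 'e \<Rightarrow> real" where
  "D2 Q L q0 q1 = mderiv Q real_line (\<lambda>q. L (q0, q)) q1"

definition force_minus ::
    "('q \<times> 'q \<Rightarrow> 'e::banach \<times> 'e \<Rightarrow> real) \<Rightarrow> 'q \<Rightarrow> 'q \<Rightarrow> 'e \<Rightarrow> real" where
  "force_minus f q0 q1 v = f (q0, q1) (v, 0)"

definition force_plus ::
    "('q \<times> 'q \<Rightarrow> 'e::banach \<times> 'e \<Rightarrow> real) \<Rightarrow> 'q \<Rightarrow> 'q \<Rightarrow> 'e \<Rightarrow> real" where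
  "force_plus f q0 q1 v = f (q0, q1) (0, v)"

definition trajectory ::
    "('q, 'e::banach) manifold \<Rightarrow> ('q \<times> 'q \<Rightarrow> real) \<Rightarrow> ('q \<times> 'q \<Rightarrow> 'e \<times> 'e \<Rightarrow> real) \<Rightarrow>
     'q \<Rightarrow> 'q \<Rightarrow> 'q \<Rightarrow> bool" where
  "trajectory Q L f q0 q1 q2 \<longleftrightarrow>
     q0 \<in> pts Q \<and> q1 \<in> pts Q \<and> q2 \<in> pts Q \<and>
     (\<forall>v. D2 Q L q0 q1 v + D1 Q L q1 q2 v + force_plus f q0 q1 v + force_minus f q1 q2 v = 0)"

definition symmetry_group ::
    "'g monoid \<Rightarrow> ('g, 'h::banach) manifold \<Rightarrow> ('q, 'e::banach) manifold \<Rightarrow>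
     ('g \<Rightarrow> 'q \<Rightarrow> 'q) \<Rightarrow> ('q set, 'b::banach) manifold \<Rightarrow>
     ('q \<times> 'q \<Rightarrow> real) \<Rightarrow> ('q \<times> 'q \<Rightarrow> 'e \<times> 'e \<Rightarrow> real) \<Rightarrow> bool" where
  "symmetry_group G MG Q \<Phi> B L f \<longleftrightarrow>
     lie_group G MG \<and> smooth_action G MG Q \<Phi> \<and> principal_bundle G MG Q \<Phi> B \<and>
     (let \<Delta> = diag_action (pts Q) \<Phi>
      in \<forall>g\<in>carrier G. \<forall>p\<in>pts (Q \<times>\<^sub>M Q).
           L (\<Delta> g p) = L p \<and> f (\<Delta> g p) = cotangent_lift G (Q \<times>\<^sub>M Q) \<Delta> g p (f p))"

definition J_plus ::
    "'g monoid \<Rightarrow> ('g, 'h::banach) manifold \<Rightarrow> ('q, 'e::banach) manifold \<Rightarrow>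
     ('g \<Rightarrow> 'q \<Rightarrow> 'q) \<Rightarrow> ('q \<times> 'q \<Rightarrow> real) \<Rightarrow> ('q \<times> 'q \<Rightarrow> 'e \<times> 'e \<Rightarrow> real) \<Rightarrow>
     'h \<Rightarrow> 'q \<Rightarrow> 'q \<Rightarrow> real" where
  "J_plus G MG Q \<Phi> L f \<xi> q0 q1 =
     (let v = inf_generator G MG Q \<Phi> \<xi> q1 in D2 Q L q0 q1 v + force_plus f q0 q1 v)"

definition J_minus ::
    "'g monoid \<Rightarrow> ('g, 'h::banach) manifold \<Rightarrow> ('q, 'e::banach) manifold \<Rightarrow>
     ('g \<Rightarrow> 'q \<Rightarrow> 'q) \<Rightarrow> ('q \<times> 'q \<Rightarrow> real) \<Rightarrow> ('q \<times> 'q \<Rightarrow> 'e \<times> 'e \<Rightarrow> real) \<Rightarrow>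
     'h \<Rightarrow> 'q \<Rightarrow> 'q \<Rightarrow> real" where
  "J_minus G MG Q \<Phi> L f \<xi> q0 q1 =
     (let v = inf_generator G MG Q \<Phi> \<xi> q0 in - D1 Q L q0 q1 v - force_minus f q0 q1 v)"

end

theory Submission
  imports Defs
begin

text \<open>
  Let \<xi>_M be the generator of the diagonal action on M = Q \<times> Q that belongs to \<xi>.  Because L
  is invariant, its differential vanishes on \<xi>_M, and therefore J^+ - J^- = f(\<xi>_M).  The form f
  is invariant as well, so its Lie derivative along \<xi>_M is zero, and Cartan's formula turns this
  into d(f(\<xi>_M)) = - df(\<xi>_M, _).  The right-hand side vanishes: \<xi>_M is tangent to the orbits and
  df is horizontal.  Since M is connected, f(\<xi>_M) is a constant \<mu>.  On the other hand, pairing the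
  forced discrete Euler-Lagrange equation with \<xi>_Q(q1) says that J^-(q1, q2) = J^+(q0, q1) along a
  trajectory.  Adding \<mu> before or after this matching step gives the two evolution laws.

  Two parts of this argument carry the weight.

  The identity d(f(\<xi>_M)) = - df(\<xi>_M, _) is obtained in one chart, in form_generator_derivative.
  The invariance of f under the group elements near the identity is an identity between coordinate
  expressions; it is differentiated in the direction \<xi> at the identity.  The only second-order
  fact involved is that the derivative of the action map in the group direction \<xi> and in a
  direction v of M may be exchanged (mixed_derivatives_commute).

  The generator is defined through lie_exp, which is given by a description operator and means
  something only if there is exactly one one-parameter subgroup with a prescribed initial velocity.
  In the chart at the identity such a subgroup is an integral curve of a left-invariant vector field.
  Uniqueness for that differential equation (ode_unique) yields uniqueness of the subgroup and also
  shows that a local integral curve (picard_lindelof) is a local homomorphism, which extends to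
  the whole real line (extend_local_hom).
\<close>

section \<open>Calculus in finite-dimensional normed spaces\<close>

lemma isCont_tendsto_nhds: "isCont f a \<Longrightarrow> (f \<longlongrightarrow> f a) (nhds a)"
  by (simp add: isCont_def tendsto_at_iff_tendsto_nhds)

lemma has_derivative_eventually_eq:
  assumes "(f has_derivative D) (at x)" "\<forall>\<^sub>F y in nhds x. f y = g y"
  shows "(g has_derivative D) (at x)"
  using assms(1)
proof (rule has_derivative_transform_eventually)
  show "\<forall>\<^sub>F y in at x. f y = g y" using assms(2) by (simp add: eventually_nhds_conv_at)
  show "f x = g x" using assms(2) by (rule eventually_nhds_x_imp_x)
qed simp

text \<open>
  The coordinate functionals of a basis are continuous by compactness: among the coefficient
  families that are bounded by 1 and have the value 1 at a fixed place b0, the norm of the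
  linear combination attains a minimum, which independence makes positive.  Dividing an arbitrary
  vector by its largest coefficient reduces to this case.
\<close>

lemma finite_dim_coordinates:
  fixes B :: "'a::real_normed_vector set"
  assumes "finite B" "span B = UNIV"
  obtains E :: "'a set" and \<phi> :: "'a \<Rightarrow> 'a \<Rightarrow> real"
  where "finite E" "\<And>b. b \<in> E \<Longrightarrow> bounded_linear (\<phi> b)" "\<And>v. (\<Sum>b\<in>E. \<phi> b v *\<^sub>R b) = v"
proof -
  obtain E where E: "E \<subseteq> B" "independent E" "B \<subseteq> span E"
    using maximal_independent_subset by blast
  have fin: "finite E" using E(1) assms(1) finite_subset by blast
  have sp: "span E = UNIV"
    using span_mono[OF E(3)] assms(2) by (simp add: span_span top.extremum_unique)
  define \<phi> where "\<phi> b v = representation E v b" for b v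
  have lin: "linear (\<phi> b)" for b
    by (rule linearI) (simp_all add: \<phi>_def representation_add representation_scale E(2) sp)
  have rep: "(\<Sum>b\<in>E. \<phi> b v *\<^sub>R b) = v" for v
    unfolding \<phi>_def using sum_representation_eq[OF E(2) _ fin subset_refl] sp by auto
  have lower: "\<exists>m>0. \<forall>c. c b0 = 1 \<longrightarrow> (\<forall>b\<in>E. \<bar>c b\<bar> \<le> 1) \<longrightarrow> m \<le> norm (\<Sum>b\<in>E. c b *\<^sub>R b)"
    if b0: "b0 \<in> E" for b0
  proof -
    \<comment> \<open>The constraint outside the basis pins the irrelevant coordinates, so that the box of
      coefficient families is compact in the product topology.\<close>
    define K where "K b = (if b = b0 then {1} else if b \<in> E then {-1..1} else {0::real})" for b
    have "compactin (product_topology (\<lambda>_. euclidean) UNIV) (PiE UNIV K)"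
      unfolding compactin_PiE by (auto simp: K_def)
    then have comp: "compact (PiE UNIV K)"
      by (simp add: euclidean_product_topology)
    have ne: "(\<lambda>b. if b = b0 then 1 else 0) \<in> PiE UNIV K"
      by (auto simp: K_def)
    have "continuous_on (PiE UNIV K) (\<lambda>c. c b)" for b
      by (rule continuous_on_subset[OF continuous_on_product_coordinates]) simp
    then have cont: "continuous_on (PiE UNIV K) (\<lambda>c. norm (\<Sum>b\<in>E. c b *\<^sub>R b))"
      by (intro continuous_on_norm continuous_on_sum continuous_on_scaleR continuous_on_const)
    have "PiE UNIV K \<noteq> {}" using ne by (metis empty_iff)
    from continuous_attains_inf[OF comp this cont] obtain c0 where c0: "c0 \<in> PiE UNIV K"
      and min: "\<forall>c\<in>PiE UNIV K. norm (\<Sum>b\<in>E. c0 b *\<^sub>R b) \<le> norm (\<Sum>b\<in>E. c b *\<^sub>R b)"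
      by (elim bexE)
    have "c0 b0 \<in> K b0" using c0 by auto
    then have "c0 b0 = 1" by (simp add: K_def)
    then have "(\<Sum>b\<in>E. c0 b *\<^sub>R b) \<noteq> 0"
      using independentD[OF E(2) fin subset_refl _ b0, of c0] by auto
    moreover have "norm (\<Sum>b\<in>E. c0 b *\<^sub>R b) \<le> norm (\<Sum>b\<in>E. c b *\<^sub>R b)"
      if "c b0 = 1" "\<forall>b\<in>E. \<bar>c b\<bar> \<le> 1" for c
    proof -
      have "(\<lambda>b. if b \<in> E then c b else 0) \<in> PiE UNIV K"
        using that b0 by (auto simp: K_def abs_le_iff)
      from bspec[OF min this] show ?thesis by (simp cong: sum.cong)
    qed
    ultimately show ?thesis by (intro exI[of _ "norm (\<Sum>b\<in>E. c0 b *\<^sub>R b)"]) auto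
  qed
  then obtain m where m: "\<And>b0. b0 \<in> E \<Longrightarrow> m b0 > 0"
    "\<And>b0 c. b0 \<in> E \<Longrightarrow> c b0 = 1 \<Longrightarrow> (\<forall>b\<in>E. \<bar>c b\<bar> \<le> 1) \<Longrightarrow> m b0 \<le> norm (\<Sum>b\<in>E. c b *\<^sub>R b)"
    by metis
  have bdd: "\<bar>\<phi> b v\<bar> \<le> norm v * (\<Sum>b\<in>E. 1 / m b)" if b: "b \<in> E" for b v
  proof -
    have "\<exists>b0\<in>E. \<forall>b\<in>E. \<bar>\<phi> b v\<bar> \<le> \<bar>\<phi> b0 v\<bar>"
    proof -
      have "Max ((\<lambda>b. \<bar>\<phi> b v\<bar>) ` E) \<in> (\<lambda>b. \<bar>\<phi> b v\<bar>) ` E"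
        using fin b by (intro Max_in) auto
      then obtain b0 where "b0 \<in> E" "Max ((\<lambda>b. \<bar>\<phi> b v\<bar>) ` E) = \<bar>\<phi> b0 v\<bar>" by auto
      moreover have "\<bar>\<phi> b v\<bar> \<le> Max ((\<lambda>b. \<bar>\<phi> b v\<bar>) ` E)" if "b \<in> E" for b
        using fin that by (intro Max_ge) auto
      ultimately show ?thesis by auto
    qed
    then obtain b0 where b0: "b0 \<in> E" "\<And>b. b \<in> E \<Longrightarrow> \<bar>\<phi> b v\<bar> \<le> \<bar>\<phi> b0 v\<bar>" by blast
    have "\<bar>\<phi> b0 v\<bar> \<le> norm v * (1 / m b0)"
    proof (cases "\<phi> b0 v = 0")
      case True
      then show ?thesis using m(1)[OF b0(1)] by simp
    next
      case False
      have "m b0 \<le> norm (\<Sum>b\<in>E. (\<phi> b v / \<phi> b0 v) *\<^sub>R b)"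
        using False b0 by (intro m(2)) (auto simp: divide_le_eq)
      also have "(\<Sum>b\<in>E. (\<phi> b v / \<phi> b0 v) *\<^sub>R b) = (1 / \<phi> b0 v) *\<^sub>R (\<Sum>b\<in>E. \<phi> b v *\<^sub>R b)"
        by (simp add: scaleR_sum_right)
      also have "norm \<dots> = norm v / \<bar>\<phi> b0 v\<bar>" by (simp only: rep) simp
      finally show ?thesis using False m(1)[OF b0(1)] by (simp add: field_simps)
    qed
    also have "\<dots> \<le> norm v * (\<Sum>b\<in>E. 1 / m b)"
      using b0(1) fin m(1) by (intro mult_left_mono member_le_sum) (auto simp: less_imp_le)
    finally show ?thesis using b0(2)[OF b] by linarith
  qed
  have "bounded_linear (\<phi> b)" if "b \<in> E" for b
    using lin[of b] bdd[OF that] unfolding bounded_linear_def bounded_linear_axioms_def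
    by auto
  with fin rep show ?thesis using that by blast
qed

lemma finite_dim_linear_bounded:
  fixes A :: "'a::real_normed_vector \<Rightarrow> 'b::real_normed_vector"
  assumes "finite B" "span B = (UNIV::'a set)" "linear A"
  shows "bounded_linear A"
proof -
  obtain E \<phi> where E: "finite E" "\<And>b::'a. b \<in> E \<Longrightarrow> bounded_linear (\<phi> b)"
      "\<And>v. (\<Sum>b\<in>E. \<phi> b v *\<^sub>R b) = v"
    using finite_dim_coordinates[OF assms(1,2)] by blast
  have "A = (\<lambda>v. \<Sum>b\<in>E. \<phi> b v *\<^sub>R A b)"
  proof
    fix v
    have "A v = A (\<Sum>b\<in>E. \<phi> b v *\<^sub>R b)" by (simp only: E(3))
    also have "\<dots> = (\<Sum>b\<in>E. \<phi> b v *\<^sub>R A b)"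
      by (simp add: linear_sum[OF assms(3)] linear_scale[OF assms(3)])
    finally show "A v = (\<Sum>b\<in>E. \<phi> b v *\<^sub>R A b)" .
  qed
  moreover have "bounded_linear (\<lambda>v. \<Sum>b\<in>E. \<phi> b v *\<^sub>R A b)"
    using E(2) by (intro bounded_linear_sum bounded_linear_scaleR_const)
  ultimately show ?thesis by simp
qed

text \<open>
  A product rule for the pairing of a covector field A with a vector field w, both depending on a
  parameter, when differentiability of A is known only after evaluation at fixed vectors.
  Expanding w in a basis leaves finitely many products of real functions.
\<close>

lemma has_derivative_family_apply:
  fixes A :: "'x::real_normed_vector \<Rightarrow> 'a::real_normed_vector \<Rightarrow> real"
  assumes fd: "finite B" "span B = (UNIV::'a set)"
    and lin: "eventually (\<lambda>x. linear (A x)) (nhds x0)"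
    and diff: "\<And>v. (\<lambda>x. A x v) differentiable (at x0)"
    and w: "(w has_derivative w') (at x0)"
  shows "((\<lambda>x. A x (w x)) has_derivative
      (\<lambda>u. frechet_derivative (\<lambda>x. A x (w x0)) (at x0) u + A x0 (w' u))) (at x0)"
proof -
  obtain E \<phi> where E: "finite E" "\<And>b::'a. b \<in> E \<Longrightarrow> bounded_linear (\<phi> b)"
      "\<And>v. (\<Sum>b\<in>E. \<phi> b v *\<^sub>R b) = v"
    using finite_dim_coordinates[OF fd] by blast
  have expand: "A x v = (\<Sum>b\<in>E. \<phi> b v * A x b)" if "linear (A x)" for x v
  proof -
    have "A x v = A x (\<Sum>b\<in>E. \<phi> b v *\<^sub>R b)" by (simp only: E(3))
    also have "\<dots> = (\<Sum>b\<in>E. \<phi> b v * A x b)"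
      by (simp add: linear_sum[OF that] linear_scale[OF that])
    finally show ?thesis .
  qed
  have lin0: "linear (A x0)" using lin by (rule eventually_nhds_x_imp_x)
  define D where "D v = frechet_derivative (\<lambda>x. A x v) (at x0)" for v
  have D: "((\<lambda>x. A x v) has_derivative D v) (at x0)" for v
    using diff[of v] unfolding D_def frechet_derivative_works .
  have general: "((\<lambda>x. A x (g x)) has_derivative
      (\<lambda>u. (\<Sum>b\<in>E. \<phi> b (g x0) * D b u) + A x0 (g' u))) (at x0)"
    if g: "(g has_derivative g') (at x0)" for g g'
  proof -
    have "((\<lambda>x. \<Sum>b\<in>E. \<phi> b (g x) * A x b) has_derivative
        (\<lambda>u. \<Sum>b\<in>E. \<phi> b (g x0) * D b u + \<phi> b (g' u) * A x0 b)) (at x0)"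
      by (intro has_derivative_sum has_derivative_mult[OF bounded_linear.has_derivative[OF E(2) g] D])
    then have "((\<lambda>x. A x (g x)) has_derivative
        (\<lambda>u. \<Sum>b\<in>E. \<phi> b (g x0) * D b u + \<phi> b (g' u) * A x0 b)) (at x0)"
    proof (rule has_derivative_transform_eventually)
      show "\<forall>\<^sub>F x in at x0. (\<Sum>b\<in>E. \<phi> b (g x) * A x b) = A x (g x)"
        using eventually_nhds_conv_at[THEN iffD1, OF lin]
        by (auto elim!: eventually_mono intro: expand[symmetric])
      show "(\<Sum>b\<in>E. \<phi> b (g x0) * A x0 b) = A x0 (g x0)"
        by (rule expand[OF lin0, symmetric])
    qed simp
    moreover have "(\<lambda>u. \<Sum>b\<in>E. \<phi> b (g x0) * D b u + \<phi> b (g' u) * A x0 b)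
        = (\<lambda>u. (\<Sum>b\<in>E. \<phi> b (g x0) * D b u) + A x0 (g' u))"
      by (simp add: sum.distrib expand[OF lin0, symmetric])
    ultimately show ?thesis by simp
  qed
  have "D (w x0) = (\<lambda>u. \<Sum>b\<in>E. \<phi> b (w x0) * D b u)"
    using has_derivative_unique[OF D general[OF has_derivative_const[of "w x0"]]]
    by (simp add: linear_0[OF lin0])
  with general[OF w] show ?thesis by (simp add: D_def[of "w x0"])
qed

text \<open>
  The mean value theorem in the direction v writes the second difference as s times the increment
  of the derivative D_v f under a displacement by s w.  Differentiability of D_v f at the single point
  x determines this increment up to an error of order o(s).
\<close>

lemma second_difference_limit:
  fixes f :: "'a::real_normed_vector \<Rightarrow> real"
  assumes S: "open S" "x \<in> S" and f: "\<And>y. y \<in> S \<Longrightarrow> f differentiable (at y)"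
    and A': "((\<lambda>y. frechet_derivative f (at y) v) has_derivative A') (at x)"
  shows "((\<lambda>s. (f (x + s *\<^sub>R v + s *\<^sub>R w) - f (x + s *\<^sub>R v) - f (x + s *\<^sub>R w) + f x) / s\<^sup>2)
           \<longlongrightarrow> A' w) (at_right 0)"
proof (rule tendstoI)
  fix e :: real assume e: "e > 0"
  define A where "A y = frechet_derivative f (at y) v" for y
  define N where "N = norm v + norm w + 1"
  have N: "N > 0" by (simp add: N_def add_nonneg_pos)
  interpret A': bounded_linear A' using A' by (rule has_derivative_bounded_linear)
  have "e / (4 * N) > 0" using e N by simp
  then obtain d where d: "d > 0" and dA:
      "\<And>y. norm (y - x) < d \<Longrightarrow> norm (A y - A x - A' (y - x)) \<le> e / (4 * N) * norm (y - x)"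
    using A' unfolding has_derivative_at_alt A_def by blast
  obtain r where r: "r > 0" "ball x r \<subseteq> S" using S open_contains_ball by blast
  define \<delta> where "\<delta> = min d r / N"
  have \<delta>: "\<delta> > 0" using d r N by (simp add: \<delta>_def)
  have small: "norm (\<theta> *\<^sub>R v + \<tau> *\<^sub>R w) \<le> s * N" if "0 \<le> \<theta>" "\<theta> \<le> s" "0 \<le> \<tau>" "\<tau> \<le> s" for \<theta> \<tau> s :: real
  proof -
    have "norm (\<theta> *\<^sub>R v + \<tau> *\<^sub>R w) \<le> \<theta> * norm v + \<tau> * norm w"
      using norm_triangle_ineq[of "\<theta> *\<^sub>R v" "\<tau> *\<^sub>R w"] that by simp
    also have "\<dots> \<le> s * norm v + s * norm w" using that by (intro add_mono mult_right_mono) auto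
    also have "\<dots> \<le> s * N" using that by (simp add: N_def algebra_simps)
    finally show ?thesis .
  qed
  have "dist ((f (x + s *\<^sub>R v + s *\<^sub>R w) - f (x + s *\<^sub>R v) - f (x + s *\<^sub>R w) + f x) / s\<^sup>2) (A' w) < e"
    if s: "0 < s" "s < \<delta>" for s
  proof -
    have sN: "s * N < d" "s * N < r" using s N by (auto simp: \<delta>_def pos_less_divide_eq)
    have inS: "x + (\<theta> *\<^sub>R v + \<tau> *\<^sub>R w) \<in> S" if "0 \<le> \<theta>" "\<theta> \<le> s" "0 \<le> \<tau>" "\<tau> \<le> s" for \<theta> \<tau>
      using small[OF that] sN(2) by (intro subsetD[OF r(2)]) (subst mem_ball, subst dist_commute, simp add: dist_norm)
    define \<phi> where "\<phi> r = f (x + (r *\<^sub>R v + s *\<^sub>R w)) - f (x + (r *\<^sub>R v + 0 *\<^sub>R w))" for r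
    have der: "((\<lambda>r. f (x + (r *\<^sub>R v + \<tau> *\<^sub>R w))) has_derivative (\<lambda>h. h * A (x + (\<theta> *\<^sub>R v + \<tau> *\<^sub>R w)))) (at \<theta>)"
      if "0 \<le> \<theta>" "\<theta> \<le> s" "0 \<le> \<tau>" "\<tau> \<le> s" for \<theta> \<tau>
    proof -
      let ?y = "x + (\<theta> *\<^sub>R v + \<tau> *\<^sub>R w)"
      have *: "(f has_derivative frechet_derivative f (at ?y)) (at ?y)"
        using f[OF inS[OF that]] unfolding frechet_derivative_works .
      have "((\<lambda>r. x + (r *\<^sub>R v + \<tau> *\<^sub>R w)) has_derivative (\<lambda>h. h *\<^sub>R v)) (at \<theta>)"
        by (auto intro!: derivative_eq_intros)
      from has_derivative_compose[OF this *] show ?thesis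
        using linear_scale[OF linear_frechet_derivative[OF f[OF inS[OF that]]]]
        by (simp add: A_def)
    qed
    have "\<exists>\<theta>\<in>{0<..<s}. \<phi> s - \<phi> 0
        = (s - 0) * A (x + (\<theta> *\<^sub>R v + s *\<^sub>R w)) - (s - 0) * A (x + (\<theta> *\<^sub>R v + 0 *\<^sub>R w))"
      unfolding \<phi>_def using s(1)
      by (intro mvt_simple has_derivative_diff has_derivative_at_withinI[OF der]) auto
    then obtain \<theta> where \<theta>: "0 < \<theta>" "\<theta> < s"
      and eq: "\<phi> s - \<phi> 0 = s * (A (x + (\<theta> *\<^sub>R v + s *\<^sub>R w)) - A (x + (\<theta> *\<^sub>R v + 0 *\<^sub>R w)))"
      by (auto simp: algebra_simps)
    have err: "\<bar>A (x + (\<theta> *\<^sub>R v + \<tau> *\<^sub>R w)) - A x - A' (\<theta> *\<^sub>R v + \<tau> *\<^sub>R w)\<bar> \<le> e / (4 * N) * (s * N)"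
      if "0 \<le> \<tau>" "\<tau> \<le> s" for \<tau>
    proof -
      have sm: "norm (\<theta> *\<^sub>R v + \<tau> *\<^sub>R w) \<le> s * N" using small \<theta> that by simp
      then have "\<bar>A (x + (\<theta> *\<^sub>R v + \<tau> *\<^sub>R w)) - A x - A' (\<theta> *\<^sub>R v + \<tau> *\<^sub>R w)\<bar>
          \<le> e / (4 * N) * norm (\<theta> *\<^sub>R v + \<tau> *\<^sub>R w)"
        using dA[of "x + (\<theta> *\<^sub>R v + \<tau> *\<^sub>R w)"] sN by simp
      also have "\<dots> \<le> e / (4 * N) * (s * N)" using sm e N by (intro mult_left_mono) auto
      finally show ?thesis .
    qed
    have eN: "e / (4 * N) * (s * N) = e * s / 4" using N by simp
    have "A' (\<theta> *\<^sub>R v + s *\<^sub>R w) - A' (\<theta> *\<^sub>R v + 0 *\<^sub>R w) = s * A' w"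
      by (simp add: A'.add A'.scaleR)
    with err[of s] err[of 0] s(1)
    have "\<bar>A (x + (\<theta> *\<^sub>R v + s *\<^sub>R w)) - A (x + (\<theta> *\<^sub>R v + 0 *\<^sub>R w)) - s * A' w\<bar> \<le> e * s / 2"
      unfolding eN by linarith
    then have "\<bar>(A (x + (\<theta> *\<^sub>R v + s *\<^sub>R w)) - A (x + (\<theta> *\<^sub>R v + 0 *\<^sub>R w)) - s * A' w) / s\<bar> \<le> e / 2"
      using s(1) by (simp add: abs_divide pos_divide_le_eq)
    moreover have "(\<phi> s - \<phi> 0) / s\<^sup>2 - A' w
        = (A (x + (\<theta> *\<^sub>R v + s *\<^sub>R w)) - A (x + (\<theta> *\<^sub>R v + 0 *\<^sub>R w)) - s * A' w) / s"
      unfolding eq using s(1) by (simp add: field_simps power2_eq_square)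
    moreover have "\<phi> s - \<phi> 0 = f (x + s *\<^sub>R v + s *\<^sub>R w) - f (x + s *\<^sub>R v) - f (x + s *\<^sub>R w) + f x"
      by (simp add: \<phi>_def add.assoc)
    ultimately have "\<bar>(f (x + s *\<^sub>R v + s *\<^sub>R w) - f (x + s *\<^sub>R v) - f (x + s *\<^sub>R w) + f x) / s\<^sup>2
        - A' w\<bar> \<le> e / 2"
      by (simp only:)
    then show ?thesis unfolding dist_real_def using e by linarith
  qed
  then show "\<forall>\<^sub>F s in at_right 0. dist ((f (x + s *\<^sub>R v + s *\<^sub>R w) - f (x + s *\<^sub>R v)
      - f (x + s *\<^sub>R w) + f x) / s\<^sup>2) (A' w) < e"
    using \<delta> unfolding eventually_at_right_field by blast
qed

text \<open>
  The second difference is symmetric in v and w, so both iterated derivatives are limits of the same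
  expression.
\<close>

lemma mixed_derivatives_commute:
  fixes f :: "'a::real_normed_vector \<Rightarrow> real"
  assumes "open S" "x \<in> S" "\<And>y. y \<in> S \<Longrightarrow> f differentiable (at y)"
    and "((\<lambda>y. frechet_derivative f (at y) v) has_derivative Dv) (at x)"
    and "((\<lambda>y. frechet_derivative f (at y) w) has_derivative Dw) (at x)"
  shows "Dv w = Dw v"
proof -
  have "((\<lambda>s. (f (x + s *\<^sub>R v + s *\<^sub>R w) - f (x + s *\<^sub>R v) - f (x + s *\<^sub>R w) + f x) / s\<^sup>2)
           \<longlongrightarrow> Dw v) (at_right 0)"
    using second_difference_limit[OF assms(1-3,5), of v] by (simp add: algebra_simps)
  with second_difference_limit[OF assms(1-4), of w] show ?thesis
    using tendsto_unique trivial_limit_at_right_real by blast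
qed

section \<open>Maps of class C^k\<close>

lemma Ck_on_subset: "Ck_on k S f \<Longrightarrow> T \<subseteq> S \<Longrightarrow> Ck_on k T f"
  by (induction k arbitrary: f) (auto intro: continuous_on_subset)

lemma Ck_on_cong:
  assumes "open S" "\<And>x. x \<in> S \<Longrightarrow> f x = g x" "Ck_on k S f"
  shows "Ck_on k S g"
  using assms(2,3)
proof (induction k arbitrary: f g)
  case 0
  then show ?case by (simp cong: continuous_on_cong)
next
  case (Suc k)
  have der: "(g has_derivative frechet_derivative f (at x)) (at x)" if "x \<in> S" for x
    using Suc.prems that frechet_derivative_works[of f "at x"]
    by (auto intro: has_derivative_transform_within_open[OF _ assms(1)])
  have eq: "frechet_derivative f (at x) = frechet_derivative g (at x)" if "x \<in> S" for x
    using that by (rule frechet_derivative_at[OF der])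
  have "Ck_on k S (\<lambda>x. frechet_derivative g (at x) v)" for v
  proof (rule Suc.IH)
    show "Ck_on k S (\<lambda>x. frechet_derivative f (at x) v)" using Suc.prems(2) by simp
  qed (simp add: eq)
  moreover have "g differentiable (at x)" if "x \<in> S" for x
    using that by (rule differentiableI[OF der])
  ultimately show ?case by simp
qed

text \<open>
  All changes of variables needed below are affine in suitable charts (projections of products and
  inclusions of slices), and for these the derivative of the inner map is constant, so that no
  chain rule of higher order arises.
\<close>

lemma Ck_on_compose_affine:
  assumes "open S" "\<And>x. (A has_derivative A') (at x)" "\<And>x. x \<in> S \<Longrightarrow> A x \<in> T" "Ck_on k T f"
  shows "Ck_on k S (\<lambda>x. f (A x))"
  using assms(4)
proof (induction k arbitrary: f)
  case 0
  have "continuous_on S A"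
    using has_derivative_continuous[OF assms(2)] by (simp add: continuous_at_imp_continuous_on)
  then show ?case using 0 assms(3) by (auto intro: continuous_on_compose2)
next
  case (Suc k)
  have der: "((\<lambda>x. f (A x)) has_derivative (\<lambda>v. frechet_derivative f (at (A x)) (A' v))) (at x)"
    if "x \<in> S" for x
    using Suc.prems that assms(3) frechet_derivative_works[of f "at (A x)"]
    by (intro has_derivative_compose[OF assms(2)]) auto
  have eq: "frechet_derivative f (at (A x)) (A' v) = frechet_derivative (\<lambda>x. f (A x)) (at x) v"
    if "x \<in> S" for x v
    using that by (rule fun_cong[OF frechet_derivative_at[OF der]])
  have "Ck_on k S (\<lambda>x. frechet_derivative (\<lambda>x. f (A x)) (at x) v)" for v
  proof (rule Ck_on_cong[OF assms(1) eq])
    show "Ck_on k S (\<lambda>x. frechet_derivative f (at (A x)) (A' v))"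
      using Suc.prems by (intro Suc.IH[of "\<lambda>y. frechet_derivative f (at y) (A' v)"]) simp
  qed
  moreover have "(\<lambda>x. f (A x)) differentiable (at x)" if "x \<in> S" for x
    using that by (rule differentiableI[OF der])
  ultimately show ?case by simp
qed

lemma Ck_on_Pair:
  assumes "open S" "Ck_on k S f" "Ck_on k S g"
  shows "Ck_on k S (\<lambda>x. (f x, g x))"
  using assms(2,3)
proof (induction k arbitrary: f g)
  case 0
  then show ?case by (auto intro: continuous_on_Pair)
next
  case (Suc k)
  have der: "((\<lambda>x. (f x, g x)) has_derivative
      (\<lambda>v. (frechet_derivative f (at x) v, frechet_derivative g (at x) v))) (at x)"
    if "x \<in> S" for x
    using Suc.prems that frechet_derivative_works[of f "at x"] frechet_derivative_works[of g "at x"]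
    by (intro has_derivative_Pair) auto
  have eq: "(frechet_derivative f (at x) v, frechet_derivative g (at x) v)
      = frechet_derivative (\<lambda>x. (f x, g x)) (at x) v" if "x \<in> S" for x v
    using that by (rule fun_cong[OF frechet_derivative_at[OF der]])
  have "Ck_on k S (\<lambda>x. frechet_derivative (\<lambda>x. (f x, g x)) (at x) v)" for v
  proof (rule Ck_on_cong[OF assms(1) eq])
    show "Ck_on k S (\<lambda>x. (frechet_derivative f (at x) v, frechet_derivative g (at x) v))"
      using Suc.prems by (intro Suc.IH) simp_all
  qed
  moreover have "(\<lambda>x. (f x, g x)) differentiable (at x)" if "x \<in> S" for x
    using that by (rule differentiableI[OF der])
  ultimately show ?case by simp
qed

section \<open>Autonomous ordinary differential equations\<close>

text \<open>
  Class C^1 is expressed by directional derivatives.  The derivatives along the finitely many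
  vectors of a basis are bounded near z, and these bounds control the operator norm of the full
  derivative.
\<close>

lemma C1_locally_lipschitz:
  fixes F :: "'a::real_normed_vector \<Rightarrow> 'b::real_normed_vector"
  assumes fd: "finite B" "span B = (UNIV::'a set)"
    and S: "open S" "z \<in> S" and F: "Ck_on 1 S F"
  obtains r K where "r > 0" "cball z r \<subseteq> S" "K-lipschitz_on (cball z r) F"
proof -
  obtain E \<phi> where E: "finite E" "\<And>b::'a. b \<in> E \<Longrightarrow> bounded_linear (\<phi> b)"
      "\<And>v. (\<Sum>b\<in>E. \<phi> b v *\<^sub>R b) = v"
    using finite_dim_coordinates[OF fd] by blast
  define D where "D x = frechet_derivative F (at x)" for x
  have D: "(F has_derivative D x) (at x)" if "x \<in> S" for x
    using F that frechet_derivative_works[of F "at x"] by (auto simp: D_def)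
  have contD: "continuous_on S (\<lambda>x. D x b)" for b using F by (simp add: D_def)
  define C where "C b = norm (D z b) + 1" for b
  have "\<forall>\<^sub>F x in nhds z. \<forall>b\<in>E. norm (D x b) < C b"
  proof (intro eventually_ball_finite E(1) ballI)
    fix b
    have "isCont (\<lambda>x. D x b) z" using contD S by (simp add: continuous_on_eq_continuous_at)
    then have "((\<lambda>x. norm (D x b)) \<longlongrightarrow> norm (D z b)) (nhds z)"
      unfolding isCont_def tendsto_at_iff_tendsto_nhds[of "\<lambda>x. D x b"] by (rule tendsto_norm)
    then show "\<forall>\<^sub>F x in nhds z. norm (D x b) < C b"
      by (rule order_tendstoD) (simp add: C_def)
  qed
  with eventually_nhds_in_open[OF S] have "\<forall>\<^sub>F x in nhds z. x \<in> S \<and> (\<forall>b\<in>E. norm (D x b) < C b)"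
    by eventually_elim auto
  then obtain r0 where r0: "r0 > 0"
    and near: "\<And>x. dist x z < r0 \<Longrightarrow> x \<in> S \<and> (\<forall>b\<in>E. norm (D x b) < C b)"
    unfolding eventually_nhds_metric by blast
  define r where "r = r0 / 2"
  have r: "r > 0" "\<And>x. x \<in> cball z r \<Longrightarrow> dist x z < r0" using r0 by (auto simp: r_def dist_commute)
  define K where "K = (\<Sum>b\<in>E. onorm (\<phi> b) * C b)"
  have K: "K \<ge> 0" unfolding K_def C_def using E(2)
    by (intro sum_nonneg mult_nonneg_nonneg onorm_pos_le) auto
  have on: "onorm (D x) \<le> K" if x: "x \<in> cball z r" for x
  proof (rule onorm_bound[OF K])
    fix v
    have lin: "linear (D x)" using D[of x] near[OF r(2)[OF x]] has_derivative_linear by blast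
    have "D x v = D x (\<Sum>b\<in>E. \<phi> b v *\<^sub>R b)" by (simp only: E(3))
    also have "\<dots> = (\<Sum>b\<in>E. \<phi> b v *\<^sub>R D x b)"
      by (simp add: linear_sum[OF lin] linear_scale[OF lin])
    also have "norm \<dots> \<le> (\<Sum>b\<in>E. (onorm (\<phi> b) * norm v) * C b)"
    proof (rule sum_norm_le)
      fix b assume b: "b \<in> E"
      have "\<bar>\<phi> b v\<bar> * norm (D x b) \<le> (onorm (\<phi> b) * norm v) * C b"
        using onorm[OF E(2)[OF b], of v] near[OF r(2)[OF x]] b
        by (intro mult_mono) (auto simp: less_imp_le onorm_pos_le[OF E(2)])
      then show "norm (\<phi> b v *\<^sub>R D x b) \<le> (onorm (\<phi> b) * norm v) * C b" by simp
    qed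
    also have "\<dots> = K * norm v" by (simp add: K_def sum_distrib_left mult_ac)
    finally show "norm (D x v) \<le> K * norm v" .
  qed
  have "K-lipschitz_on (cball z r) F"
  proof (rule lipschitz_onI)
    fix x y assume xy: "x \<in> cball z r" "y \<in> cball z r"
    show "dist (F x) (F y) \<le> K * dist x y"
      unfolding dist_norm
      using near r(2) D on xy
      by (intro differentiable_bound[where S = "cball z r" and f' = D])
         (auto intro: has_derivative_at_withinI)
  qed (rule K)
  moreover have "cball z r \<subseteq> S" using near r(2) by blast
  ultimately show ?thesis using that r(1) by blast
qed

lemma vector_derivative_bound:
  assumes "convex S" "\<And>t. t \<in> S \<Longrightarrow> (f has_vector_derivative f' t) (at t within S)"
    and "\<And>t. t \<in> S \<Longrightarrow> norm (f' t) \<le> C" "s \<in> S" "t \<in> S"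
  shows "norm (f s - f t) \<le> C * \<bar>s - t\<bar>"
proof -
  have "norm (f s - f t) \<le> C * norm (s - t)"
  proof (rule differentiable_bound[where S = S and f' = "\<lambda>t h. h *\<^sub>R f' t"])
    show "onorm (\<lambda>h. h *\<^sub>R f' t) \<le> C" if "t \<in> S" for t
      using assms(3)[OF that] by (intro onorm_le) (simp add: mult.commute[of C] mult_left_mono)
  qed (use assms in \<open>auto simp: has_vector_derivative_def\<close>)
  then show ?thesis by simp
qed

text \<open>
  The solution is the fixed point of the integral operator.  Working with curves on the whole real
  line, stopped outside the interval from -d to d, places them in the complete space of bounded
  continuous functions.
\<close>

lemma picard_lindelof:
  fixes F :: "'a::banach \<Rightarrow> 'a"
  assumes r: "r > 0" and lip: "K-lipschitz_on (cball z r) F"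
  obtains d x where "d > 0" "x 0 = z"
    "\<And>t. \<bar>t\<bar> < d \<Longrightarrow> x t \<in> cball z r \<and> (x has_vector_derivative F (x t)) (at t)"
proof -
  have K: "K \<ge> 0" using lip by (rule lipschitz_on_nonneg)
  define M where "M = norm (F z) + K * r + 1"
  have M: "M > 0" using K r by (simp add: M_def add_nonneg_pos)
  have FM: "norm (F y) \<le> M" if "y \<in> cball z r" for y
  proof -
    have "norm (F y - F z) \<le> K * norm (y - z)"
      using lipschitz_onD[OF lip that, of z] r by (simp add: dist_norm)
    also have "\<dots> \<le> K * r" using that K by (intro mult_left_mono) (auto simp: dist_norm norm_minus_commute)
    finally show ?thesis using norm_triangle_sub[of "F y" "F z"] by (simp add: M_def)
  qed
  \<comment> \<open>The first bound keeps the curves in the ball, the second makes the operator a contraction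
    with factor 1/2.\<close>
  define d where "d = min (r / M) (1 / (2 * (K + 1)))"
  have d: "d > 0" "M * d \<le> r" "K * d \<le> 1 / 2"
  proof -
    show "d > 0" using r M K by (simp add: d_def)
    have "d \<le> r / M" by (simp add: d_def)
    then show "M * d \<le> r" using M by (simp add: field_simps)
    have "K * d \<le> K * (1 / (2 * (K + 1)))" using K by (intro mult_left_mono) (simp_all add: d_def)
    also have "\<dots> \<le> 1 / 2" using K by (simp add: field_simps)
    finally show "K * d \<le> 1 / 2" .
  qed
  have contF: "continuous_on (cball z r) F" using lip by (rule lipschitz_on_continuous_on)
  define P where "P \<phi> t = z + (integral {-d..t} (\<lambda>s. F (apply_bcontfun \<phi> s)) - integral {-d..0} (\<lambda>s. F (apply_bcontfun \<phi> s)))" for \<phi> t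
  define X where "X = PiC (UNIV::real set) (\<lambda>_. cball z r)"
  have XD: "apply_bcontfun \<phi> t \<in> cball z r" if "\<phi> \<in> X" for \<phi> t
    using that unfolding X_def mem_PiC_iff by blast
  have P0: "P \<phi> 0 = z" for \<phi> by (simp add: P_def)
  have Pder: "(P \<phi> has_vector_derivative F (apply_bcontfun \<phi> t)) (at t within {-d..d})"
    if "\<phi> \<in> X" "t \<in> {-d..d}" for \<phi> t
  proof -
    have "continuous_on {-d..d} (\<lambda>s. F (apply_bcontfun \<phi> s))"
      by (rule continuous_on_compose2[OF contF]) (use XD[OF that(1)] in auto)
    from integral_has_vector_derivative[OF this that(2)] show ?thesis
      unfolding P_def by (auto intro!: derivative_eq_intros)
  qed
  have Pball: "P \<phi> t \<in> cball z r" if "\<phi> \<in> X" "t \<in> {-d..d}" for \<phi> t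
  proof -
    have "norm (P \<phi> t - P \<phi> 0) \<le> M * \<bar>t - 0\<bar>"
      using that d(1) by (intro vector_derivative_bound[OF _ Pder[OF that(1)]] FM XD) auto
    also have "\<dots> \<le> M * d" using that M by (intro mult_left_mono) auto
    finally show ?thesis using d(2) by (simp add: P0 dist_norm norm_minus_commute)
  qed
  have Plip: "norm (P \<phi> t - P \<psi> t) \<le> 1 / 2 * dist \<phi> \<psi>"
    if "\<phi> \<in> X" "\<psi> \<in> X" "t \<in> {-d..d}" for \<phi> \<psi> t
  proof -
    have "norm ((P \<phi> t - P \<psi> t) - (P \<phi> 0 - P \<psi> 0)) \<le> (K * dist \<phi> \<psi>) * \<bar>t - 0\<bar>"
    proof (rule vector_derivative_bound)
      fix s assume "s \<in> {-d..d}"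
      then show "((\<lambda>t. P \<phi> t - P \<psi> t) has_vector_derivative
          (F (apply_bcontfun \<phi> s) - F (apply_bcontfun \<psi> s))) (at s within {-d..d})"
        using Pder that by (intro has_vector_derivative_diff) auto
      have "norm (F (apply_bcontfun \<phi> s) - F (apply_bcontfun \<psi> s))
          \<le> K * dist (apply_bcontfun \<phi> s) (apply_bcontfun \<psi> s)"
        using lipschitz_onD[OF lip XD XD] that by (simp add: dist_norm)
      also have "\<dots> \<le> K * dist \<phi> \<psi>" using K dist_bounded by (intro mult_left_mono)
      finally show "norm (F (apply_bcontfun \<phi> s) - F (apply_bcontfun \<psi> s)) \<le> K * dist \<phi> \<psi>" .
    qed (use that d(1) in auto)
    also have "\<dots> \<le> (K * dist \<phi> \<psi>) * d" using that K by (intro mult_left_mono) auto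
    also have "\<dots> = (K * d) * dist \<phi> \<psi>" by simp
    also have "\<dots> \<le> 1 / 2 * dist \<phi> \<psi>" using d(3) by (intro mult_right_mono) auto
    finally show ?thesis by (simp add: P0)
  qed
  \<comment> \<open>Time is stopped at the end points of the interval.\<close>
  define cl where "cl t = max (-d) (min d t)" for t :: real
  have cl: "cl t \<in> {-d..d}" for t using d(1) by (auto simp: cl_def)
  have clid: "cl t = t" if "t \<in> {-d..d}" for t using that by (auto simp: cl_def)
  define T where "T \<phi> = Bcontfun (\<lambda>t. P \<phi> (cl t))" for \<phi>
  have T: "apply_bcontfun (T \<phi>) t = P \<phi> (cl t)" if "\<phi> \<in> X" for \<phi> t
  proof -
    have "continuous_on {-d..d} (P \<phi>)"
      unfolding continuous_on_eq_continuous_within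
      using has_vector_derivative_continuous[OF Pder[OF that]] by blast
    moreover have "continuous_on UNIV cl" unfolding cl_def by (intro continuous_intros)
    ultimately have "continuous_on UNIV (\<lambda>t. P \<phi> (cl t))"
      by (rule continuous_on_compose2) (use cl in auto)
    moreover have "bounded (range (\<lambda>t. P \<phi> (cl t)))"
      by (rule bounded_subset[OF bounded_cball[of z r]]) (use Pball[OF that cl] in auto)
    ultimately show ?thesis
      unfolding T_def by (simp add: Bcontfun_inverse bcontfun_def)
  qed
  have "\<exists>!\<phi>\<in>X. T \<phi> = \<phi>"
  proof (rule Banach_fix[where c = "1/2"])
    show "complete X" unfolding X_def complete_eq_closed by (intro closed_PiC) auto
    have "const_bcontfun z \<in> X" using r by (auto simp: X_def mem_PiC_iff const_bcontfun.rep_eq)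
    then show "X \<noteq> {}" by blast
    show "T ` X \<subseteq> X"
    proof safe
      fix \<phi> assume \<phi>: "\<phi> \<in> X"
      show "T \<phi> \<in> X" unfolding X_def mem_PiC_iff using T[OF \<phi>] Pball[OF \<phi> cl] by auto
    qed
    fix \<phi> \<psi> assume "\<phi> \<in> X" "\<psi> \<in> X"
    then show "dist (T \<phi>) (T \<psi>) \<le> 1 / 2 * dist \<phi> \<psi>"
      using T Plip[OF _ _ cl] by (intro dist_bound) (simp add: dist_norm)
  qed auto
  then obtain \<phi> where \<phi>: "\<phi> \<in> X" "T \<phi> = \<phi>" by blast
  have eq: "apply_bcontfun \<phi> t = P \<phi> t" if "t \<in> {-d..d}" for t
    using T[OF \<phi>(1), of t] \<phi>(2) clid[OF that] by simp
  show ?thesis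
  proof (rule that)
    show "d > 0" by (rule d)
    show "apply_bcontfun \<phi> 0 = z" using eq[of 0] d(1) by (simp add: P0)
    fix t assume t: "\<bar>t\<bar> < d"
    have "(P \<phi> has_vector_derivative F (apply_bcontfun \<phi> t)) (at t within {-d<..<d})"
      using t by (intro has_vector_derivative_within_subset[OF Pder[OF \<phi>(1)]]) auto
    then have "(P \<phi> has_vector_derivative F (apply_bcontfun \<phi> t)) (at t)"
      using t at_within_open[of t "{-d<..<d}"] by (simp add: abs_less_iff)
    then have "(apply_bcontfun \<phi> has_vector_derivative F (apply_bcontfun \<phi> t)) (at t)"
      by (rule has_vector_derivative_transform_within_open[of _ _ _ "{-d<..<d}"])
        (use t in \<open>auto simp: eq\<close>)
    with XD[OF \<phi>(1)] show "apply_bcontfun \<phi> t \<in> cball z r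
        \<and> (apply_bcontfun \<phi> has_vector_derivative F (apply_bcontfun \<phi> t)) (at t)" by blast
  qed
qed

text \<open>
  A bound C for the distance of the two solutions improves to C / 2 by integrating the equation, hence
  to C / 2^n for every n.
\<close>

lemma ode_unique:
  fixes F :: "'a::real_normed_vector \<Rightarrow> 'a"
  assumes lip: "K-lipschitz_on X F" and X: "bounded X" and Kd: "K * d \<le> 1 / 2"
    and x: "\<And>t. \<bar>t\<bar> < d \<Longrightarrow> x t \<in> X \<and> (x has_vector_derivative F (x t)) (at t)"
    and y: "\<And>t. \<bar>t\<bar> < d \<Longrightarrow> y t \<in> X \<and> (y has_vector_derivative F (y t)) (at t)"
    and "x 0 = y 0" "\<bar>t\<bar> < d"
  shows "x t = y t"
proof -
  have K: "K \<ge> 0" using lip by (rule lipschitz_on_nonneg)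
  obtain C where C: "\<And>a b. a \<in> X \<Longrightarrow> b \<in> X \<Longrightarrow> norm (a - b) \<le> C"
    using X unfolding bounded_two_points dist_norm by auto
  have *: "norm (x t - y t) \<le> C * (1 / 2) ^ n" if "\<bar>t\<bar> < d" for n t
    using that
  proof (induction n arbitrary: t)
    case 0
    then show ?case using C x y by simp
  next
    case (Suc n)
    have C0: "C * (1 / 2) ^ n \<ge> 0" using order_trans[OF norm_ge_zero Suc.IH[OF Suc.prems]] .
    have "norm ((x t - y t) - (x 0 - y 0)) \<le> (K * (C * (1 / 2) ^ n)) * \<bar>t - 0\<bar>"
    proof (rule vector_derivative_bound[where S = "{-d<..<d}"])
      fix s assume s: "s \<in> {-d<..<d}"
      then have s': "\<bar>s\<bar> < d" by auto
      show "((\<lambda>t. x t - y t) has_vector_derivative (F (x s) - F (y s))) (at s within {-d<..<d})"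
        by (rule has_vector_derivative_at_within, rule has_vector_derivative_diff)
          (use x[OF s'] y[OF s'] in auto)
      have "norm (F (x s) - F (y s)) \<le> K * norm (x s - y s)"
        using lipschitz_onD[OF lip] x[OF s'] y[OF s'] by (simp add: dist_norm)
      also have "\<dots> \<le> K * (C * (1 / 2) ^ n)" using K Suc.IH[OF s'] by (intro mult_left_mono)
      finally show "norm (F (x s) - F (y s)) \<le> K * (C * (1 / 2) ^ n)" .
    qed (use Suc.prems in auto)
    also have "\<dots> \<le> (K * (C * (1 / 2) ^ n)) * d"
      using Suc.prems by (intro mult_left_mono mult_nonneg_nonneg[OF K C0]) auto
    also have "\<dots> = (K * d) * (C * (1 / 2) ^ n)" by simp
    also have "\<dots> \<le> 1 / 2 * (C * (1 / 2) ^ n)" using Kd C0 by (rule mult_right_mono)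
    finally show ?case using assms(6) by simp
  qed
  have "(\<lambda>n. C * (1 / 2) ^ n) \<longlonglongrightarrow> C * 0"
    by (intro tendsto_mult tendsto_const LIMSEQ_realpow_zero) auto
  then have "norm (x t - y t) \<le> C * 0"
    by (rule tendsto_lowerbound) (use *[OF assms(7)] in auto)
  then show ?thesis by simp
qed

section \<open>Charts and coordinate representations\<close>

lemma is_chart_inj_on:
  assumes "is_chart X c"
  shows "inj_on (chart_fun c) (chart_dom c)"
proof -
  have "chart_dom c \<subseteq> topspace X" using assms openin_subset unfolding is_chart_def by blast
  moreover have "inj_on (chart_fun c) (topspace (subtopology X (chart_dom c)))"
    using assms unfolding is_chart_def homeomorphic_map_def by blast
  ultimately show ?thesis by (simp only: topspace_subtopology_subset)
qed

lemma chart_inv_chart_fun: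
  "is_chart X c \<Longrightarrow> p \<in> chart_dom c \<Longrightarrow> chart_inv c (chart_fun c p) = p"
  unfolding chart_inv_def by (rule inv_into_f_f[OF is_chart_inj_on])

lemma open_chart_image:
  assumes c: "is_chart X c" and U: "openin X U"
  shows "open (chart_fun c ` (chart_dom c \<inter> U))"
proof -
  have "open_map (subtopology X (chart_dom c)) (top_of_set (chart_fun c ` chart_dom c)) (chart_fun c)"
    using c homeomorphic_imp_open_map unfolding is_chart_def by blast
  moreover have "openin (subtopology X (chart_dom c)) (chart_dom c \<inter> U)"
    using U by (rule openin_subtopology_Int2)
  ultimately have "openin (top_of_set (chart_fun c ` chart_dom c)) (chart_fun c ` (chart_dom c \<inter> U))"
    unfolding open_map_def by blast
  then show ?thesis using c openin_open_trans unfolding is_chart_def by blast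
qed

lemma openin_chart_preimage:
  assumes c: "is_chart X c" and S: "open S"
  shows "openin X {p \<in> chart_dom c. chart_fun c p \<in> S}"
proof -
  have cont: "continuous_map (subtopology X (chart_dom c)) (top_of_set (chart_fun c ` chart_dom c)) (chart_fun c)"
    using c homeomorphic_imp_continuous_map unfolding is_chart_def by blast
  have dom: "openin X (chart_dom c)" using c by (simp add: is_chart_def)
  have "openin (subtopology X (chart_dom c))
      {p \<in> topspace (subtopology X (chart_dom c)). chart_fun c p \<in> chart_fun c ` chart_dom c \<inter> S}"
    by (rule openin_continuous_map_preimage[OF cont]) (simp add: S openin_open_Int)
  moreover have "{p \<in> topspace (subtopology X (chart_dom c)). chart_fun c p \<in> chart_fun c ` chart_dom c \<inter> S}
      = {p \<in> chart_dom c. chart_fun c p \<in> S}"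
    using openin_subset[OF dom] by auto
  ultimately have "openin (subtopology X (chart_dom c)) {p \<in> chart_dom c. chart_fun c p \<in> S}"
    by (simp only:)
  then show ?thesis using dom by (rule openin_trans_full)
qed

lemma eventually_chart_inv:
  assumes c: "is_chart X c" and "openin X U" "p \<in> chart_dom c" "p \<in> U"
  shows "\<forall>\<^sub>F x in nhds (chart_fun c p).
           chart_inv c x \<in> chart_dom c \<and> chart_inv c x \<in> U \<and> chart_fun c (chart_inv c x) = x"
proof -
  have "\<forall>\<^sub>F x in nhds (chart_fun c p). x \<in> chart_fun c ` (chart_dom c \<inter> U)"
    using assms by (intro eventually_nhds_in_open open_chart_image) auto
  then show ?thesis by eventually_elim (auto simp: chart_inv_chart_fun[OF c])
qed

lemma eventually_curve_in:
  assumes "continuous_map euclidean X \<gamma>" "openin X U" "\<gamma> t \<in> U"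
  shows "\<forall>\<^sub>F s in nhds t. \<gamma> s \<in> U"
proof -
  have "open {s. \<gamma> s \<in> U}"
    using openin_continuous_map_preimage[OF assms(1,2)] by simp
  then show ?thesis using eventually_nhds_in_open[of "{s. \<gamma> s \<in> U}" t] assms(3) by simp
qed

lemma smooth_manifold_chart: "smooth_manifold M \<Longrightarrow> c \<in> atlas M \<Longrightarrow> is_chart (mtop M) c"
  by (simp add: smooth_manifold_def)

lemma smooth_manifold_chart_at:
  assumes "smooth_manifold M" "p \<in> pts M"
  shows "chart_at M p \<in> atlas M" "p \<in> chart_dom (chart_at M p)"
  using assms by (auto simp: smooth_manifold_def)

lemma chart_dom_subset_pts: "smooth_manifold M \<Longrightarrow> c \<in> atlas M \<Longrightarrow> chart_dom c \<subseteq> pts M"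
  using smooth_manifold_chart openin_subset unfolding is_chart_def by blast

abbreviation coord_rep ::
  "('a, 'e) chart \<Rightarrow> ('b, 'f) chart \<Rightarrow> ('a \<Rightarrow> 'b) \<Rightarrow> 'e \<Rightarrow> 'f" where
  "coord_rep c d F \<equiv> chart_fun d \<circ> F \<circ> chart_inv c"

lemma openin_smooth_map_domain:
  assumes N: "smooth_manifold N" and F: "smooth_map_on U M N F" and d: "d \<in> atlas N"
  shows "openin (mtop M) {p \<in> U. F p \<in> chart_dom d}"
proof -
  have U: "openin (mtop M) U" using F by (simp add: smooth_map_on_def)
  have "openin (subtopology (mtop M) U) {p \<in> topspace (subtopology (mtop M) U). F p \<in> chart_dom d}"
    using F smooth_manifold_chart[OF N d]
    by (intro openin_continuous_map_preimage) (auto simp: smooth_map_on_def is_chart_def)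
  moreover have "topspace (subtopology (mtop M) U) = U"
    using openin_subset[OF U] by (rule topspace_subtopology_subset)
  ultimately have "openin (subtopology (mtop M) U) {p \<in> U. F p \<in> chart_dom d}"
    by (simp only:)
  then show ?thesis using U by (rule openin_trans_full)
qed

lemma open_coord_domain:
  assumes "smooth_manifold M" "smooth_manifold N" "smooth_map_on U M N F" "c \<in> atlas M" "d \<in> atlas N"
  shows "open (chart_fun c ` {p \<in> chart_dom c \<inter> U. F p \<in> chart_dom d})"
proof -
  have "{p \<in> chart_dom c \<inter> U. F p \<in> chart_dom d} = chart_dom c \<inter> {p \<in> U. F p \<in> chart_dom d}" by auto
  then show ?thesis
    using open_chart_image[OF smooth_manifold_chart[OF assms(1,4)]
        openin_smooth_map_domain[OF assms(2,3,5)]] by simp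
qed

lemma coord_rep_Ck:
  assumes "smooth_map_on U M N F" "c \<in> atlas M" "d \<in> atlas N"
  shows "Ck_on k (chart_fun c ` {p \<in> chart_dom c \<inter> U. F p \<in> chart_dom d}) (coord_rep c d F)"
  using assms unfolding smooth_map_on_def smooth_on_def by blast

lemma coord_rep_has_derivative:
  assumes F: "smooth_map_on U M N F" and "c \<in> atlas M" "d \<in> atlas N"
    and "p \<in> chart_dom c" "p \<in> U" "F p \<in> chart_dom d"
  shows "(coord_rep c d F has_derivative frechet_derivative (coord_rep c d F) (at (chart_fun c p)))
           (at (chart_fun c p))"
proof -
  have "chart_fun c p \<in> chart_fun c ` {p \<in> chart_dom c \<inter> U. F p \<in> chart_dom d}"
    using assms(4-6) by blast
  moreover have "\<forall>x\<in>chart_fun c ` {p \<in> chart_dom c \<inter> U. F p \<in> chart_dom d}.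
      coord_rep c d F differentiable (at x)"
    using coord_rep_Ck[OF assms(1-3), of 1] unfolding One_nat_def Ck_on.simps by (rule conjunct1)
  ultimately have "coord_rep c d F differentiable (at (chart_fun c p))"
    by (rule bspec[rotated])
  then show ?thesis unfolding frechet_derivative_works .
qed

text \<open>
  The chain rule for tangent maps in coordinates.  The three charts are arbitrary; this freedom
  is what allows a passage between the preferred charts of different points.
\<close>

lemma coord_derivative_compose:
  assumes M: "smooth_manifold M" and N: "smooth_manifold N"
    and F: "smooth_map_on U M N F" and K: "smooth_map_on V N P K"
    and c: "c \<in> atlas M" and d: "d \<in> atlas N" and e: "e \<in> atlas P"
    and p: "p \<in> U" "p \<in> chart_dom c" "F p \<in> V" "F p \<in> chart_dom d" "K (F p) \<in> chart_dom e"
  shows "frechet_derivative (coord_rep c e (K \<circ> F)) (at (chart_fun c p))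
       = frechet_derivative (coord_rep d e K) (at (chart_fun d (F p)))
         \<circ> frechet_derivative (coord_rep c d F) (at (chart_fun c p))"
proof -
  note cc = smooth_manifold_chart[OF M c] and dd = smooth_manifold_chart[OF N d]
  have inv: "chart_inv c (chart_fun c p) = p" using cc p(2) by (rule chart_inv_chart_fun)
  have "(coord_rep d e K \<circ> coord_rep c d F has_derivative
          frechet_derivative (coord_rep d e K) (at (chart_fun d (F p)))
         \<circ> frechet_derivative (coord_rep c d F) (at (chart_fun c p))) (at (chart_fun c p))"
    using coord_rep_has_derivative[OF K d e p(4,3,5)]
    by (intro diff_chain_at coord_rep_has_derivative[OF F c d p(2,1,4)]) (simp add: inv)
  moreover have "\<forall>\<^sub>F x in nhds (chart_fun c p).
      (coord_rep d e K \<circ> coord_rep c d F) x = coord_rep c e (K \<circ> F) x"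
    using eventually_chart_inv[OF cc openin_smooth_map_domain[OF N F d] p(2)] p
    by (auto elim!: eventually_mono simp: chart_inv_chart_fun[OF dd])
  ultimately have "(coord_rep c e (K \<circ> F) has_derivative
          frechet_derivative (coord_rep d e K) (at (chart_fun d (F p)))
         \<circ> frechet_derivative (coord_rep c d F) (at (chart_fun c p))) (at (chart_fun c p))"
    by (rule has_derivative_eventually_eq)
  from frechet_derivative_at[OF this] show ?thesis ..
qed

lemma smooth_map_id:
  assumes M: "smooth_manifold M"
  shows "smooth_map M M id"
proof -
  have eq: "{p \<in> chart_dom c \<inter> pts M. id p \<in> chart_dom d} = chart_dom c \<inter> chart_dom d"
    if "c \<in> atlas M" for c d
    using chart_dom_subset_pts[OF M that] by auto
  have sm: "\<forall>c\<in>atlas M. \<forall>d\<in>atlas M.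
      smooth_on (chart_fun c ` (chart_dom c \<inter> chart_dom d)) (chart_fun d \<circ> id \<circ> chart_inv c)"
    using M unfolding smooth_manifold_def comp_id by blast
  show ?thesis
    unfolding smooth_map_def smooth_map_on_def
  proof (intro conjI ballI)
    fix c d assume "c \<in> atlas M" "d \<in> atlas M"
    then show "smooth_on (chart_fun c ` {p \<in> chart_dom c \<inter> pts M. id p \<in> chart_dom d})
        (chart_fun d \<circ> id \<circ> chart_inv c)"
      unfolding eq[OF \<open>c \<in> atlas M\<close>] using sm by blast
  qed simp_all
qed

lemma coord_derivative_id:
  assumes M: "smooth_manifold M" and c: "c \<in> atlas M" "p \<in> chart_dom c"
  shows "frechet_derivative (coord_rep c c id) (at (chart_fun c p)) v = v"
proof -
  note cc = smooth_manifold_chart[OF M c(1)]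
  have "openin (mtop M) (chart_dom c)" using cc by (simp add: is_chart_def)
  from eventually_chart_inv[OF cc this c(2) c(2)]
  have "\<forall>\<^sub>F x in nhds (chart_fun c p). x = coord_rep c c id x" by eventually_elim simp
  then have "(coord_rep c c id has_derivative (\<lambda>v. v)) (at (chart_fun c p))"
    by (rule has_derivative_eventually_eq[OF has_derivative_ident])
  from frechet_derivative_at[OF this] show ?thesis by metis
qed

lemma coord_derivative_cong:
  assumes M: "smooth_manifold M" and c: "c \<in> atlas M" "p \<in> chart_dom c"
    and eq: "\<And>p. p \<in> pts M \<Longrightarrow> F p = F' p"
  shows "frechet_derivative (coord_rep c d F) (at (chart_fun c p))
       = frechet_derivative (coord_rep c d F') (at (chart_fun c p))"
proof -
  note cc = smooth_manifold_chart[OF M c(1)]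
  have "openin (mtop M) (chart_dom c)" using cc by (simp add: is_chart_def)
  from eventually_chart_inv[OF cc this c(2) c(2)]
  have ev: "\<forall>\<^sub>F x in nhds (chart_fun c p). coord_rep c d F x = coord_rep c d F' x"
    by eventually_elim (use chart_dom_subset_pts[OF M c(1)] eq in auto)
  then have ev': "\<forall>\<^sub>F x in nhds (chart_fun c p). coord_rep c d F' x = coord_rep c d F x"
    by eventually_elim simp
  have "(coord_rep c d F has_derivative D) (at (chart_fun c p))
      \<longleftrightarrow> (coord_rep c d F' has_derivative D) (at (chart_fun c p))" for D
    using has_derivative_eventually_eq[OF _ ev] has_derivative_eventually_eq[OF _ ev'] by (rule iffI)
  then show ?thesis unfolding frechet_derivative_def by simp
qed

lemma smooth_map_cong:
  assumes M: "smooth_manifold M" and N: "smooth_manifold N"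
    and F: "smooth_map M N F" and eq: "\<And>p. p \<in> pts M \<Longrightarrow> F p = F' p"
  shows "smooth_map M N F'"
  unfolding smooth_map_def smooth_map_on_def
proof (intro conjI ballI)
  show "continuous_map (subtopology (mtop M) (pts M)) (mtop N) F'"
    by (rule continuous_map_eq[of _ _ F]) (use F eq in \<open>auto simp: smooth_map_def smooth_map_on_def\<close>)
  fix c d assume c: "c \<in> atlas M" and d: "d \<in> atlas N"
  note cc = smooth_manifold_chart[OF M c]
  have "{p \<in> chart_dom c \<inter> pts M. F' p \<in> chart_dom d} = {p \<in> chart_dom c \<inter> pts M. F p \<in> chart_dom d}"
    using eq by auto
  moreover have "Ck_on k (chart_fun c ` {p \<in> chart_dom c \<inter> pts M. F p \<in> chart_dom d}) (coord_rep c d F')" for k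
  proof (rule Ck_on_cong[OF open_coord_domain[OF M N F[unfolded smooth_map_def] c d] _
        coord_rep_Ck[OF F[unfolded smooth_map_def] c d]])
    fix x assume "x \<in> chart_fun c ` {p \<in> chart_dom c \<inter> pts M. F p \<in> chart_dom d}"
    then obtain p where "x = chart_fun c p" "p \<in> chart_dom c" "p \<in> pts M" by blast
    then show "coord_rep c d F x = coord_rep c d F' x"
      using chart_inv_chart_fun[OF cc] eq by simp
  qed
  ultimately show "smooth_on (chart_fun c ` {p \<in> chart_dom c \<inter> pts M. F' p \<in> chart_dom d}) (coord_rep c d F')"
    by (simp add: smooth_on_def)
qed simp

lemma mderiv_compose:
  assumes M: "smooth_manifold M" and N: "smooth_manifold N" and P: "smooth_manifold P"
    and F: "smooth_map M N F" and K: "smooth_map N P K" and p: "p \<in> pts M"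
  shows "mderiv M P (K \<circ> F) p = mderiv N P K (F p) \<circ> mderiv M N F p"
proof -
  have Fp: "F p \<in> pts N" and KFp: "K (F p) \<in> pts P"
    using F K p unfolding smooth_map_def smooth_map_on_def by (auto simp: continuous_map_def)
  show ?thesis
    unfolding mderiv_def comp_apply[of K F p]
    by (rule coord_derivative_compose[OF M N F[unfolded smooth_map_def] K[unfolded smooth_map_def]])
      (intro p Fp smooth_manifold_chart_at M N P KFp)+
qed

section \<open>Velocities of curves\<close>

lemma curve_coord_derivative:
  assumes M: "smooth_manifold M" and F: "smooth_map_on U M N F"
    and c: "c \<in> atlas M" and d: "d \<in> atlas N"
    and \<gamma>: "continuous_map euclidean (mtop M) \<gamma>"
    and p: "\<gamma> t \<in> U" "\<gamma> t \<in> chart_dom c" "F (\<gamma> t) \<in> chart_dom d"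
    and v: "((\<lambda>s. chart_fun c (\<gamma> s)) has_vector_derivative v) (at t)"
  shows "((\<lambda>s. chart_fun d (F (\<gamma> s))) has_vector_derivative
           frechet_derivative (coord_rep c d F) (at (chart_fun c (\<gamma> t))) v) (at t)"
proof -
  note cc = smooth_manifold_chart[OF M c]
  define D where "D = frechet_derivative (coord_rep c d F) (at (chart_fun c (\<gamma> t)))"
  have D: "(coord_rep c d F has_derivative D) (at (chart_fun c (\<gamma> t)))"
    unfolding D_def by (rule coord_rep_has_derivative[OF F c d p(2,1,3)])
  have "((\<lambda>s. coord_rep c d F (chart_fun c (\<gamma> s))) has_derivative (\<lambda>s. D (s *\<^sub>R v))) (at t)"
    using has_derivative_compose[OF v[unfolded has_vector_derivative_def] D] .
  then have "((\<lambda>s. chart_fun d (F (\<gamma> s))) has_derivative (\<lambda>s. D (s *\<^sub>R v))) (at t)"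
  proof (rule has_derivative_transform_eventually)
    have "openin (mtop M) (chart_dom c)" using cc by (simp add: is_chart_def)
    from eventually_curve_in[OF \<gamma> this p(2)]
    show "\<forall>\<^sub>F s in at t. coord_rep c d F (chart_fun c (\<gamma> s)) = chart_fun d (F (\<gamma> s))"
      unfolding eventually_nhds_conv_at
      by (auto elim!: eventually_mono simp: chart_inv_chart_fun[OF cc])
  qed (auto simp: chart_inv_chart_fun[OF cc p(2)])
  then show ?thesis
    unfolding has_vector_derivative_def D_def[symmetric]
    by (simp add: linear_scale[OF has_derivative_linear[OF D]])
qed

lemma has_velocity0_image:
  assumes M: "smooth_manifold M" and N: "smooth_manifold N" and F: "smooth_map M N F"
    and \<gamma>: "continuous_map euclidean (mtop M) \<gamma>" and v: "has_velocity0 M \<gamma> v"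
  shows "has_velocity0 N (\<lambda>t. F (\<gamma> t)) (mderiv M N F (\<gamma> 0) v)"
proof -
  have p: "\<gamma> 0 \<in> pts M" using \<gamma> by (auto simp: continuous_map_def)
  have Fp: "F (\<gamma> 0) \<in> pts N"
    using F p unfolding smooth_map_def smooth_map_on_def by (auto simp: continuous_map_def)
  show ?thesis
    using curve_coord_derivative[OF M F[unfolded smooth_map_def] smooth_manifold_chart_at(1)[OF M p]
        smooth_manifold_chart_at(1)[OF N Fp] \<gamma> p smooth_manifold_chart_at(2)[OF M p]
        smooth_manifold_chart_at(2)[OF N Fp], of v] v
    unfolding has_velocity0_def mderiv_def comp_def by simp
qed

lemma has_velocity0_unique: "has_velocity0 M \<gamma> v \<Longrightarrow> has_velocity0 M \<gamma> w \<Longrightarrow> v = w"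
  unfolding has_velocity0_def by (rule vector_derivative_unique_at)

lemma velocity0_eqI: "has_velocity0 M \<gamma> v \<Longrightarrow> velocity0 M \<gamma> = v"
  unfolding has_velocity0_def velocity0_def by (rule vector_derivative_at)

section \<open>Product manifolds\<close>

lemma prod_chart_simps [simp]:
  "chart_dom (prod_chart c d) = chart_dom c \<times> chart_dom d"
  "chart_fun (prod_chart c d) (p, q) = (chart_fun c p, chart_fun d q)"
  by (simp_all add: prod_chart_def)

lemma prod_manifold_simps [simp]:
  "mtop (M \<times>\<^sub>M N) = prod_topology (mtop M) (mtop N)"
  "chart_at (M \<times>\<^sub>M N) (p, q) = prod_chart (chart_at M p) (chart_at N q)"
  by (simp_all add: prod_manifold_def)

lemma prod_chart_in_atlas [simp]:
  "c \<in> atlas M \<Longrightarrow> d \<in> atlas N \<Longrightarrow> prod_chart c d \<in> atlas (M \<times>\<^sub>M N)"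
  unfolding prod_manifold_def by (simp del: split_paired_Ex) blast

lemma atlas_prodE:
  assumes "c \<in> atlas (M \<times>\<^sub>M N)"
  obtains c1 c2 where "c = prod_chart c1 c2" "c1 \<in> atlas M" "c2 \<in> atlas N"
  using assms by (auto simp: prod_manifold_def simp del: split_paired_Ex)

lemma prod_chart_image:
  "chart_fun (prod_chart c d) ` (S \<times> T) = (chart_fun c ` S) \<times> (chart_fun d ` T)"
  by (force simp: prod_chart_def)

lemma is_chart_prod:
  assumes "is_chart X c" "is_chart Y d"
  shows "is_chart (prod_topology X Y) (prod_chart c d)"
proof -
  obtain c' d' where
    "homeomorphic_maps (subtopology X (chart_dom c)) (top_of_set (chart_fun c ` chart_dom c)) (chart_fun c) c'"
    "homeomorphic_maps (subtopology Y (chart_dom d)) (top_of_set (chart_fun d ` chart_dom d)) (chart_fun d) d'"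
    using assms unfolding is_chart_def homeomorphic_map_maps by blast
  then have "homeomorphic_maps
      (prod_topology (subtopology X (chart_dom c)) (subtopology Y (chart_dom d)))
      (prod_topology (top_of_set (chart_fun c ` chart_dom c)) (top_of_set (chart_fun d ` chart_dom d)))
      (\<lambda>(x, y). (chart_fun c x, chart_fun d y)) (\<lambda>(x, y). (c' x, d' y))"
    unfolding homeomorphic_maps_prod by blast
  then have "homeomorphic_map
      (prod_topology (subtopology X (chart_dom c)) (subtopology Y (chart_dom d)))
      (prod_topology (top_of_set (chart_fun c ` chart_dom c)) (top_of_set (chart_fun d ` chart_dom d)))
      (\<lambda>(x, y). (chart_fun c x, chart_fun d y))"
    by (rule homeomorphic_maps_imp_map)
  moreover have "chart_fun (prod_chart c d) = (\<lambda>(x, y). (chart_fun c x, chart_fun d y))"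
    by (auto simp: fun_eq_iff)
  ultimately show ?thesis
    using assms unfolding is_chart_def prod_chart_simps(1) prod_chart_image
    by (simp add: subtopology_Times[symmetric] openin_prod_Times_iff open_Times)
qed

lemma chart_inv_prod:
  assumes "is_chart X c" "is_chart Y d" "p \<in> chart_dom c" "q \<in> chart_dom d"
  shows "chart_inv (prod_chart c d) (chart_fun c p, chart_fun d q) = (p, q)"
  using chart_inv_chart_fun[OF is_chart_prod[OF assms(1,2)], of "(p, q)"] assms(3,4) by simp

lemma second_countable_prod:
  assumes "second_countable X" "second_countable Y"
  shows "second_countable (prod_topology X Y)"
proof -
  obtain A where A: "countable A" "\<forall>V\<in>A. openin X V"
      "\<forall>U x. openin X U \<and> x \<in> U \<longrightarrow> (\<exists>V\<in>A. x \<in> V \<and> V \<subseteq> U)"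
    using assms(1) unfolding second_countable_def by (elim exE conjE)
  obtain B where B: "countable B" "\<forall>V\<in>B. openin Y V"
      "\<forall>U x. openin Y U \<and> x \<in> U \<longrightarrow> (\<exists>V\<in>B. x \<in> V \<and> V \<subseteq> U)"
    using assms(2) unfolding second_countable_def by (elim exE conjE)
  have "\<exists>W\<in>(\<lambda>(V, W). V \<times> W) ` (A \<times> B). z \<in> W \<and> W \<subseteq> U"
    if U: "openin (prod_topology X Y) U" "z \<in> U" for U z
  proof -
    obtain V W where VW: "openin X V" "openin Y W" "fst z \<in> V" "snd z \<in> W" "V \<times> W \<subseteq> U"
      using U unfolding openin_prod_topology_alt by (metis prod.collapse)
    obtain V' where V': "V' \<in> A" "fst z \<in> V'" "V' \<subseteq> V" using A(3) VW(1,3) by blast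
    obtain W' where W': "W' \<in> B" "snd z \<in> W'" "W' \<subseteq> W" using B(3) VW(2,4) by blast
    show ?thesis
    proof (rule bexI)
      show "V' \<times> W' \<in> (\<lambda>(V, W). V \<times> W) ` (A \<times> B)" using V' W' by blast
      show "z \<in> V' \<times> W' \<and> V' \<times> W' \<subseteq> U" using V' W' VW(5) by (cases z) auto
    qed
  qed
  moreover have "countable ((\<lambda>(V, W). V \<times> W) ` (A \<times> B))" using A(1) B(1) by simp
  moreover have "\<forall>W\<in>(\<lambda>(V, W). V \<times> W) ` (A \<times> B). openin (prod_topology X Y) W"
    using A(2) B(2) by (auto simp: openin_prod_Times_iff)
  ultimately show ?thesis unfolding second_countable_def by blast
qed

lemma Ck_on_map_prod:
  assumes "open S" "open T" "Ck_on k S f" "Ck_on k T g"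
  shows "Ck_on k (S \<times> T) (\<lambda>x. (f (fst x), g (snd x)))"
proof (rule Ck_on_Pair)
  show "open (S \<times> T)" using assms(1,2) by (rule open_Times)
  then show "Ck_on k (S \<times> T) (\<lambda>x. f (fst x))" "Ck_on k (S \<times> T) (\<lambda>x. g (snd x))"
    using has_derivative_fst[OF has_derivative_ident] has_derivative_snd[OF has_derivative_ident]
    by (auto intro!: Ck_on_compose_affine[OF _ _ _ assms(3)] Ck_on_compose_affine[OF _ _ _ assms(4)])
qed

lemma smooth_manifold_prod:
  assumes M: "smooth_manifold M" and N: "smooth_manifold N"
  shows "smooth_manifold (M \<times>\<^sub>M N)"
  unfolding smooth_manifold_def
proof (intro conjI)
  show "Hausdorff_space (mtop (M \<times>\<^sub>M N))" "second_countable (mtop (M \<times>\<^sub>M N))"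
    using M N by (simp_all add: smooth_manifold_def Hausdorff_space_prod_topology second_countable_prod)
  show "\<exists>B. finite B \<and> span B = (UNIV :: ('b \<times> 'd) set)"
  proof -
    obtain B1 :: "'b set" and B2 :: "'d set"
      where B: "finite B1" "span B1 = UNIV" "finite B2" "span B2 = UNIV"
      using M N unfolding smooth_manifold_def by blast
    let ?B = "(\<lambda>b. (b, 0)) ` B1 \<union> (\<lambda>b. (0, b)) ` B2"
    have l: "linear (\<lambda>b::'b. (b, 0::'d))" "linear (\<lambda>b::'d. (0::'b, b))"
      by (intro linearI; simp)+
    have 1: "(x, 0) \<in> span ?B" for x
    proof -
      have "(x, 0::'d) \<in> span ((\<lambda>b. (b, 0)) ` B1)" unfolding linear_span_image[OF l(1)] B(2) by blast
      then show ?thesis using span_mono[of "(\<lambda>b. (b, 0)) ` B1" ?B] by blast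
    qed
    have 2: "(0, y) \<in> span ?B" for y
    proof -
      have "(0::'b, y) \<in> span ((\<lambda>b. (0, b)) ` B2)" unfolding linear_span_image[OF l(2)] B(4) by blast
      then show ?thesis using span_mono[of "(\<lambda>b. (0, b)) ` B2" ?B] by blast
    qed
    have "(x, y) \<in> span ?B" for x y
      using span_add[OF 1[of x] 2[of y]] by simp
    then have "span ?B = UNIV" by auto
    moreover have "finite ?B" using B by simp
    ultimately show ?thesis by blast
  qed
  show "\<forall>c\<in>atlas (M \<times>\<^sub>M N). is_chart (mtop (M \<times>\<^sub>M N)) c"
    by (auto elim!: atlas_prodE intro!: is_chart_prod smooth_manifold_chart[OF M]
        smooth_manifold_chart[OF N] simp del: split_paired_All)
  show "\<forall>p\<in>pts (M \<times>\<^sub>M N). chart_at (M \<times>\<^sub>M N) p \<in> atlas (M \<times>\<^sub>M N) \<and> p \<in> chart_dom (chart_at (M \<times>\<^sub>M N) p)"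
    using smooth_manifold_chart_at[OF M] smooth_manifold_chart_at[OF N] by auto
  show "\<forall>c\<in>atlas (M \<times>\<^sub>M N). \<forall>d\<in>atlas (M \<times>\<^sub>M N).
      smooth_on (chart_fun c ` (chart_dom c \<inter> chart_dom d)) (chart_fun d \<circ> chart_inv c)"
  proof (intro ballI)
    fix c d assume cd: "c \<in> atlas (M \<times>\<^sub>M N)" "d \<in> atlas (M \<times>\<^sub>M N)"
    from cd(1) obtain c1 c2 where c: "c = prod_chart c1 c2" "c1 \<in> atlas M" "c2 \<in> atlas N"
      by (rule atlas_prodE)
    from cd(2) obtain d1 d2 where d: "d = prod_chart d1 d2" "d1 \<in> atlas M" "d2 \<in> atlas N"
      by (rule atlas_prodE)
    note cc = smooth_manifold_chart[OF M c(2)] smooth_manifold_chart[OF N c(3)]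
    note dd = smooth_manifold_chart[OF M d(2)] smooth_manifold_chart[OF N d(3)]
    let ?S1 = "chart_fun c1 ` (chart_dom c1 \<inter> chart_dom d1)"
    let ?S2 = "chart_fun c2 ` (chart_dom c2 \<inter> chart_dom d2)"
    have op: "open ?S1" "open ?S2"
      using dd by (auto intro!: open_chart_image cc simp: is_chart_def)
    have S: "chart_fun c ` (chart_dom c \<inter> chart_dom d) = ?S1 \<times> ?S2"
      unfolding c(1) d(1) prod_chart_simps(1) Times_Int_Times prod_chart_image ..
    have "Ck_on k (?S1 \<times> ?S2) (chart_fun d \<circ> chart_inv c)" for k
    proof (rule Ck_on_cong)
      show "Ck_on k (?S1 \<times> ?S2)
          (\<lambda>x. ((chart_fun d1 \<circ> chart_inv c1) (fst x), (chart_fun d2 \<circ> chart_inv c2) (snd x)))"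
        using M N c(2,3) d(2,3) unfolding smooth_manifold_def smooth_on_def
        by (intro Ck_on_map_prod op) blast+
    qed (use op in \<open>auto simp: c(1) d(1) open_Times chart_inv_prod[OF cc] chart_inv_chart_fun[OF cc(1)]
          chart_inv_chart_fun[OF cc(2)]\<close>)
    then show "smooth_on (chart_fun c ` (chart_dom c \<inter> chart_dom d)) (chart_fun d \<circ> chart_inv c)"
      unfolding S smooth_on_def by blast
  qed
qed

text \<open>
  Smoothness of F after a map that is affine in suitable charts.  It covers the slices q \<mapsto> (g, q) and
  the projections (g, (q0, q1)) \<mapsto> (g, q0) and (g, (q0, q1)) \<mapsto> (g, q1), which relate an action to its
  translations and to the diagonal action.
\<close>

lemma smooth_map_affine_precompose:
  assumes M: "smooth_manifold M" and N: "smooth_manifold N" and P: "smooth_manifold P"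
    and F: "smooth_map N P F" and \<pi>: "continuous_map (mtop M) (mtop N) \<pi>"
    and aff: "\<And>c p. c \<in> atlas M \<Longrightarrow> p \<in> chart_dom c \<Longrightarrow> \<exists>c'\<in>atlas N. \<exists>A A'. (\<forall>x. (A has_derivative A') (at x))
      \<and> (\<forall>p\<in>chart_dom c. \<pi> p \<in> chart_dom c' \<and> chart_fun c' (\<pi> p) = A (chart_fun c p))"
  shows "smooth_map M P (\<lambda>p. F (\<pi> p))"
  unfolding smooth_map_def smooth_map_on_def
proof (intro conjI ballI)
  show cont: "continuous_map (subtopology (mtop M) (pts M)) (mtop P) (\<lambda>p. F (\<pi> p))"
    using continuous_map_compose[OF \<pi>, of "mtop P" F] F
    by (simp add: smooth_map_def smooth_map_on_def comp_def)
  fix c e assume c: "c \<in> atlas M" and e: "e \<in> atlas P"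
  note cc = smooth_manifold_chart[OF M c]
  let ?S = "chart_fun c ` {p \<in> chart_dom c \<inter> pts M. F (\<pi> p) \<in> chart_dom e}"
  have "openin (mtop M) {p \<in> pts M. F (\<pi> p) \<in> chart_dom e}"
    using cont smooth_manifold_chart[OF P e]
    by (intro openin_continuous_map_preimage) (auto simp: is_chart_def)
  from open_chart_image[OF cc this] have op: "open ?S" by (simp add: Int_def conj_ac)
  show "smooth_on ?S (chart_fun e \<circ> (\<lambda>p. F (\<pi> p)) \<circ> chart_inv c)"
  proof (cases "chart_dom c = {}")
    case True
    have "Ck_on k {} h" for k and h :: "'b \<Rightarrow> 'f"
      by (induction k arbitrary: h) auto
    then show ?thesis using True by (simp add: smooth_on_def)
  next
    case False
    then obtain c' A A' where c': "c' \<in> atlas N" and A: "\<And>x. (A has_derivative A') (at x)"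
      and \<pi>c: "\<And>p. p \<in> chart_dom c \<Longrightarrow> \<pi> p \<in> chart_dom c' \<and> chart_fun c' (\<pi> p) = A (chart_fun c p)"
      using aff[OF c] by blast
    note cc' = smooth_manifold_chart[OF N c']
    have "Ck_on k ?S (chart_fun e \<circ> (\<lambda>p. F (\<pi> p)) \<circ> chart_inv c)" for k
    proof (rule Ck_on_cong[OF op])
      show "Ck_on k ?S (\<lambda>x. coord_rep c' e F (A x))"
      proof (rule Ck_on_compose_affine[OF op A _ coord_rep_Ck[OF F[unfolded smooth_map_def] c' e]])
        fix x assume "x \<in> ?S"
        then obtain p where "p \<in> chart_dom c" "F (\<pi> p) \<in> chart_dom e" "x = chart_fun c p" by blast
        then show "A x \<in> chart_fun c' ` {p \<in> chart_dom c' \<inter> pts N. F p \<in> chart_dom e}"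
          using \<pi>c chart_dom_subset_pts[OF N c'] by (intro image_eqI[of _ _ "\<pi> p"]) auto
      qed
      fix x assume "x \<in> ?S"
      then obtain p where "p \<in> chart_dom c" "x = chart_fun c p" by blast
      then show "coord_rep c' e F (A x) = (chart_fun e \<circ> (\<lambda>p. F (\<pi> p)) \<circ> chart_inv c) x"
        using \<pi>c[of p] chart_inv_chart_fun[OF cc', of "\<pi> p"] by (simp add: chart_inv_chart_fun[OF cc])
    qed
    then show ?thesis by (simp add: smooth_on_def)
  qed
qed simp

lemma smooth_map_Pair:
  assumes P: "smooth_manifold P" and M: "smooth_manifold M" and N: "smooth_manifold N"
    and F: "smooth_map P M F" and K: "smooth_map P N K"
  shows "smooth_map P (M \<times>\<^sub>M N) (\<lambda>p. (F p, K p))"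
  unfolding smooth_map_def smooth_map_on_def
proof (intro conjI ballI)
  show cont: "continuous_map (subtopology (mtop P) (pts P)) (mtop (M \<times>\<^sub>M N)) (\<lambda>p. (F p, K p))"
    using F K by (simp add: smooth_map_def smooth_map_on_def continuous_map_paired)
  fix c e assume c: "c \<in> atlas P" and e': "e \<in> atlas (M \<times>\<^sub>M N)"
  from e' obtain d1 d2 where e: "e = prod_chart d1 d2" "d1 \<in> atlas M" "d2 \<in> atlas N"
    by (rule atlas_prodE)
  note cc = smooth_manifold_chart[OF P c]
  have ee: "is_chart (mtop (M \<times>\<^sub>M N)) e"
    unfolding e(1) prod_manifold_simps(1)
    by (rule is_chart_prod[OF smooth_manifold_chart[OF M e(2)] smooth_manifold_chart[OF N e(3)]])
  let ?S = "chart_fun c ` {p \<in> chart_dom c \<inter> pts P. (F p, K p) \<in> chart_dom e}"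
  have "openin (mtop P) {p \<in> pts P. (F p, K p) \<in> chart_dom e}"
    using cont ee by (intro openin_continuous_map_preimage) (auto simp: is_chart_def)
  from open_chart_image[OF cc this] have op: "open ?S" by (simp add: Int_def conj_ac)
  have "Ck_on k ?S (chart_fun e \<circ> (\<lambda>p. (F p, K p)) \<circ> chart_inv c)" for k
  proof (rule Ck_on_cong[OF op])
    show "Ck_on k ?S (\<lambda>x. (coord_rep c d1 F x, coord_rep c d2 K x))"
    proof (rule Ck_on_Pair[OF op])
      show "Ck_on k ?S (coord_rep c d1 F)"
        by (rule Ck_on_subset[OF coord_rep_Ck[OF F[unfolded smooth_map_def] c e(2)]]) (auto simp: e(1))
      show "Ck_on k ?S (coord_rep c d2 K)"
        by (rule Ck_on_subset[OF coord_rep_Ck[OF K[unfolded smooth_map_def] c e(3)]]) (auto simp: e(1))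
    qed
  qed (simp add: e(1))
  then show "smooth_on ?S (chart_fun e \<circ> (\<lambda>p. (F p, K p)) \<circ> chart_inv c)"
    by (simp add: smooth_on_def)
qed simp

lemma smooth_manifold_real_line: "smooth_manifold real_line"
proof -
  have inv: "inv_into UNIV (id::real \<Rightarrow> real) = id" by (rule inv_id)
  have const: "Ck_on k UNIV (\<lambda>x::real. a::real)" for k a
    by (induction k arbitrary: a) (auto simp: frechet_derivative_const)
  have "Ck_on k UNIV (id::real \<Rightarrow> real)" for k
    by (cases k) (auto simp: const continuous_on_id id_def)
  moreover have "second_countable (euclidean :: real topology)"
  proof -
    obtain B :: "real set set" where "countable B" "topological_basis B" using ex_countable_basis by blast
    moreover have "\<exists>V\<in>B. x \<in> V \<and> V \<subseteq> U" if "open U" "x \<in> U" for U x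
      by (rule topological_basisE[OF \<open>topological_basis B\<close> that]) blast
    ultimately show ?thesis
      unfolding second_countable_def open_openin[symmetric]
      by (intro exI[of _ B] conjI ballI allI impI) (auto simp: topological_basis_open)
  qed
  moreover have "\<exists>B::real set. finite B \<and> span B = UNIV"
    by (intro exI[of _ "{1}"]) (auto simp: span_singleton)
  ultimately show ?thesis
    unfolding smooth_manifold_def real_line_def is_chart_def chart_inv_def smooth_on_def by simp
qed

text \<open>
  This connects the partial differentials of the discrete Lagrangian, which enter the momentum maps,
  with its differential on the product, to which invariance applies.
\<close>

lemma mderiv_partial:
  assumes M: "smooth_manifold M" and N: "smooth_manifold N" and P: "smooth_manifold P"
    and F: "smooth_map (M \<times>\<^sub>M N) P F" and p: "p \<in> pts M" and q: "q \<in> pts N"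
  shows "mderiv (M \<times>\<^sub>M N) P F (p, q) (v, w)
    = mderiv M P (\<lambda>p. F (p, q)) p v + mderiv N P (\<lambda>q. F (p, q)) q w"
proof -
  let ?c = "chart_at M p" and ?d = "chart_at N q"
  let ?e = "chart_at P (F (p, q))"
  let ?f = "coord_rep (prod_chart ?c ?d) ?e F"
  note cc = smooth_manifold_chart[OF M smooth_manifold_chart_at(1)[OF M p]]
    and dd = smooth_manifold_chart[OF N smooth_manifold_chart_at(1)[OF N q]]
  note pc = smooth_manifold_chart_at(2)[OF M p] and qd = smooth_manifold_chart_at(2)[OF N q]
  define D where "D = frechet_derivative ?f (at (chart_fun ?c p, chart_fun ?d q))"
  have Fpq: "F (p, q) \<in> pts P"
    using F p q unfolding smooth_map_def smooth_map_on_def by (auto simp: continuous_map_def)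
  have D: "(?f has_derivative D) (at (chart_fun ?c p, chart_fun ?d q))"
    using coord_rep_has_derivative[OF F[unfolded smooth_map_def], of "prod_chart ?c ?d" ?e "(p, q)"]
      smooth_manifold_chart_at[OF M p] smooth_manifold_chart_at[OF N q]
      smooth_manifold_chart_at[OF P Fpq] p q
    by (simp add: D_def)
  have "((\<lambda>x. ?f (x, chart_fun ?d q)) has_derivative (\<lambda>v. D (v, 0))) (at (chart_fun ?c p))"
    by (rule has_derivative_compose[OF has_derivative_Pair[OF has_derivative_ident has_derivative_const] D])
  moreover have "\<forall>\<^sub>F x in nhds (chart_fun ?c p). ?f (x, chart_fun ?d q) = coord_rep ?c ?e (\<lambda>p. F (p, q)) x"
    using eventually_chart_inv[OF cc _ pc pc] cc unfolding is_chart_def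
    by (auto elim!: eventually_mono) (metis cc chart_inv_prod dd qd)
  ultimately have "(coord_rep ?c ?e (\<lambda>p. F (p, q)) has_derivative (\<lambda>v. D (v, 0))) (at (chart_fun ?c p))"
    by (rule has_derivative_eventually_eq)
  from frechet_derivative_at[OF this] have 1: "mderiv M P (\<lambda>p. F (p, q)) p v = D (v, 0)"
    by (simp add: mderiv_def fun_eq_iff)
  have "((\<lambda>x. ?f (chart_fun ?c p, x)) has_derivative (\<lambda>v. D (0, v))) (at (chart_fun ?d q))"
    by (rule has_derivative_compose[OF has_derivative_Pair[OF has_derivative_const has_derivative_ident] D])
  moreover have "\<forall>\<^sub>F x in nhds (chart_fun ?d q). ?f (chart_fun ?c p, x) = coord_rep ?d ?e (\<lambda>q. F (p, q)) x"
    using eventually_chart_inv[OF dd _ qd qd] dd unfolding is_chart_def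
    by (auto elim!: eventually_mono) (metis cc chart_inv_prod dd pc)
  ultimately have "(coord_rep ?d ?e (\<lambda>q. F (p, q)) has_derivative (\<lambda>v. D (0, v))) (at (chart_fun ?d q))"
    by (rule has_derivative_eventually_eq)
  from frechet_derivative_at[OF this] have 2: "mderiv N P (\<lambda>q. F (p, q)) q w = D (0, w)"
    by (simp add: mderiv_def fun_eq_iff)
  have "mderiv (M \<times>\<^sub>M N) P F (p, q) (v, w) = D (v, w)" by (simp add: mderiv_def D_def)
  also have "\<dots> = D (v, 0) + D (0, w)"
    using linear_add[OF has_derivative_linear[OF D], of "(v, 0)" "(0, w)"] by simp
  finally show ?thesis using 1 2 by simp
qed

lemma has_velocity0_Pair:
  "has_velocity0 M \<gamma> v \<Longrightarrow> has_velocity0 N \<eta> w \<Longrightarrow> has_velocity0 (M \<times>\<^sub>M N) (\<lambda>t. (\<gamma> t, \<eta> t)) (v, w)"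
  unfolding has_velocity0_def has_vector_derivative_def comp_def
  using has_derivative_Pair[of "\<lambda>t. chart_fun (chart_at M (\<gamma> 0)) (\<gamma> t)" "\<lambda>x. x *\<^sub>R v" 0 UNIV
     "\<lambda>t. chart_fun (chart_at N (\<eta> 0)) (\<eta> t)" "\<lambda>x. x *\<^sub>R w"] by simp

lemma has_velocity0_const: "has_velocity0 M (\<lambda>t. p) 0"
  unfolding has_velocity0_def comp_def by (rule has_vector_derivative_const)

section \<open>Extending local one-parameter groups\<close>

lemma (in group) local_hom_pow:
  fixes g :: "real \<Rightarrow> 'a"
  assumes car: "\<And>t. \<bar>t\<bar> < \<delta> \<Longrightarrow> g t \<in> carrier G"
    and hom: "\<And>s t. \<bar>s\<bar> < \<delta> \<Longrightarrow> \<bar>t\<bar> < \<delta> \<Longrightarrow> \<bar>s + t\<bar> < \<delta> \<Longrightarrow> g (s + t) = g s \<otimes> g t"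
    and "\<bar>real n * s\<bar> < \<delta>"
  shows "g (real n * s) = g s [^] n"
  using assms(3)
proof (induction n)
  case 0
  then have "\<delta> > 0" by simp
  then have "g 0 = g 0 \<otimes> g 0" "g 0 \<in> carrier G" using hom[of 0 0] car[of 0] by auto
  then have "g 0 = \<one>" using r_cancel_one' by metis
  then show ?case by simp
next
  case (Suc n)
  have le: "\<bar>real n * s\<bar> \<le> \<bar>real (Suc n) * s\<bar>" "\<bar>s\<bar> \<le> \<bar>real (Suc n) * s\<bar>"
    by (auto simp: abs_mult intro: mult_right_mono mult_le_cancel_right1[THEN iffD2])
  then have "\<bar>real n * s\<bar> < \<delta>" "\<bar>s\<bar> < \<delta>" using Suc.prems by linarith+
  moreover have "real (Suc n) * s = real n * s + s" by (simp add: algebra_simps)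
  ultimately show ?case using hom[of "real n * s" s] Suc by simp
qed

text \<open>
  Every t is a multiple n (t / n) of an argument at which g is defined, which forces the value
  g(t / n)^n.  Two numbers n and n' give the same value because t / (n n') is a common subdivision.
\<close>

lemma (in group) extend_local_hom:
  fixes g :: "real \<Rightarrow> 'a"
  assumes \<delta>: "\<delta> > 0" and car: "\<And>t. \<bar>t\<bar> < \<delta> \<Longrightarrow> g t \<in> carrier G"
    and hom: "\<And>s t. \<bar>s\<bar> < \<delta> \<Longrightarrow> \<bar>t\<bar> < \<delta> \<Longrightarrow> \<bar>s + t\<bar> < \<delta> \<Longrightarrow> g (s + t) = g s \<otimes> g t"
  obtains \<gamma> where "\<And>t. \<gamma> t \<in> carrier G" "\<And>s t. \<gamma> (s + t) = \<gamma> s \<otimes> \<gamma> t"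
    "\<And>t. \<bar>t\<bar> < \<delta> \<Longrightarrow> \<gamma> t = g t"
proof -
  have pow: "g (real n * s) = g s [^] n" if "\<bar>real n * s\<bar> < \<delta>" for n s
    using car hom that by (rule local_hom_pow)
  \<comment> \<open>Some number of subdivisions that brings t into the domain of g.\<close>
  define N where "N t = (SOME n. n > 0 \<and> \<bar>t / real n\<bar> < \<delta>)" for t
  have ex: "\<exists>n0>0. \<forall>n\<ge>n0. \<bar>t / real n\<bar> < \<delta>" for t
  proof -
    obtain n0 where n0: "\<bar>t\<bar> / \<delta> < real n0" using reals_Archimedean2 by blast
    have "n0 > 0" using n0 \<delta> by (cases n0) (auto simp: divide_less_0_iff)
    moreover have "\<bar>t / real n\<bar> < \<delta>" if "n \<ge> n0" for n
    proof -
      have "\<bar>t\<bar> / \<delta> < real n" using n0 that by linarith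
      moreover have "real n > 0" using \<open>n0 > 0\<close> that by simp
      ultimately show ?thesis using \<delta> by (simp add: field_simps)
    qed
    ultimately show ?thesis by blast
  qed
  have N: "N t > 0" "\<bar>t / real (N t)\<bar> < \<delta>" for t
    using someI_ex[of "\<lambda>n. n > 0 \<and> \<bar>t / real n\<bar> < \<delta>"] ex[of t] unfolding N_def by blast+
  define \<gamma> where "\<gamma> t = g (t / real (N t)) [^] N t" for t
  have indep: "\<gamma> t = g (t / real n) [^] n" if n: "n > 0" "\<bar>t / real n\<bar> < \<delta>" for t n
  proof -
    \<comment> \<open>The common refinement of the subdivisions into n and into N t parts.\<close>
    let ?s = "t / (real n * real (N t))"
    have e: "t / real n = real (N t) * ?s" "t / real (N t) = real n * ?s"
      using n(1) N(1)[of t] by auto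
    have "\<bar>?s\<bar> \<le> \<bar>t / real n\<bar>"
      using N(1)[of t] n(1) mult_left_mono[of 1 "real (N t)" "\<bar>t\<bar>"] by (simp add: abs_mult field_simps)
    then have s: "g ?s \<in> carrier G" using n(2) car by auto
    have "g (t / real n) = g ?s [^] N t"
      using pow[where n = "N t" and s = ?s, folded e(1), OF n(2)] .
    moreover have "g (t / real (N t)) = g ?s [^] n"
      using pow[where n = n and s = ?s, folded e(2), OF N(2)[of t]] .
    ultimately show ?thesis unfolding \<gamma>_def using s by (simp add: nat_pow_pow mult.commute)
  qed
  show ?thesis
  proof (rule that)
    show "\<gamma> t \<in> carrier G" for t unfolding \<gamma>_def using N(2) car by (intro nat_pow_closed) auto
    show "\<gamma> t = g t" if "\<bar>t\<bar> < \<delta>" for t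
      using indep[of 1 t] that car by simp
    fix s t
    obtain n1 where n1: "n1 > 0" "\<forall>n\<ge>n1. \<bar>s / real n\<bar> < \<delta>" using ex by blast
    obtain n2 where n2: "n2 > 0" "\<forall>n\<ge>n2. \<bar>t / real n\<bar> < \<delta>" using ex by blast
    obtain n3 where n3: "n3 > 0" "\<forall>n\<ge>n3. \<bar>(s + t) / real n\<bar> < \<delta>" using ex by blast
    define n where "n = n1 + n2 + n3"
    have n: "n > 0" "\<bar>s / real n\<bar> < \<delta>" "\<bar>t / real n\<bar> < \<delta>" "\<bar>(s + t) / real n\<bar> < \<delta>"
    proof -
      have "n \<ge> n1" "n \<ge> n2" "n \<ge> n3" by (simp_all add: n_def)
      then show "n > 0" "\<bar>s / real n\<bar> < \<delta>" "\<bar>t / real n\<bar> < \<delta>" "\<bar>(s + t) / real n\<bar> < \<delta>"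
        using n1 n2(2) n3(2) by (simp, blast+)
    qed
    have sum: "\<bar>s / real n + t / real n\<bar> < \<delta>" "\<bar>t / real n + s / real n\<bar> < \<delta>"
      using n(4) by (simp_all add: add_divide_distrib add.commute)
    have comm: "g (s / real n) \<otimes> g (t / real n) = g (t / real n) \<otimes> g (s / real n)"
      using hom[OF n(2,3) sum(1)] hom[OF n(3,2) sum(2)] by (simp add: add.commute)
    have "\<gamma> (s + t) = (g (s / real n) \<otimes> g (t / real n)) [^] n"
      using indep[OF n(1,4)] hom[OF n(2,3) sum(1)] by (simp add: add_divide_distrib)
    also have "\<dots> = g (s / real n) [^] n \<otimes> g (t / real n) [^] n"
      by (rule pow_mult_distrib[OF comm car[OF n(2)] car[OF n(3)]])
    finally show "\<gamma> (s + t) = \<gamma> s \<otimes> \<gamma> t"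
      using indep[OF n(1,2)] indep[OF n(1,3)] by simp
  qed
qed

section \<open>The exponential map\<close>

text \<open>
  A one-parameter subgroup is determined by its restriction to a neighbourhood of 0, so that everything
  can be computed in one chart c at the identity, where the identity has the coordinates z0.
\<close>

locale lie_group_at_one =
  fixes G :: "'g monoid" (structure) and MG :: "('g, 'h::banach) manifold"
  assumes lie: "lie_group G MG"
begin

sublocale group G using lie by (simp add: lie_group_def)

abbreviation c :: "('g, 'h) chart" where "c \<equiv> chart_at MG \<one>"
abbreviation z0 :: 'h where "z0 \<equiv> chart_fun c \<one>"
definition local_mult :: "'h \<times> 'h \<Rightarrow> 'h" where "local_mult = coord_rep (prod_chart c c) c (\<lambda>(a, b). a \<otimes> b)"
definition mult_dom :: "('h \<times> 'h) set" where
  "mult_dom = chart_fun (prod_chart c c) ` {p \<in> chart_dom (prod_chart c c) \<inter> pts (MG \<times>\<^sub>M MG).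
         (\<lambda>(a, b). a \<otimes> b) p \<in> chart_dom c}"

lemma MG: "smooth_manifold MG" and carrier: "carrier G = pts MG"
  and mult: "smooth_map_on (pts (MG \<times>\<^sub>M MG)) (MG \<times>\<^sub>M MG) MG (\<lambda>(a, b). a \<otimes> b)"
  using lie by (auto simp: lie_group_def smooth_map_def)

lemma c: "c \<in> atlas MG" "\<one> \<in> chart_dom c"
  using smooth_manifold_chart_at[OF MG] carrier one_closed by auto

lemma cc: "is_chart (mtop MG) c" and openin_c: "openin (mtop MG) (chart_dom c)"
  using smooth_manifold_chart[OF MG c(1)] by (auto simp: is_chart_def)

lemma dom_carrier: "a \<in> chart_dom c \<Longrightarrow> a \<in> carrier G"
  using chart_dom_subset_pts[OF MG c(1)] carrier by blast

lemma pc: "prod_chart c c \<in> atlas (MG \<times>\<^sub>M MG)" using c by simp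

lemma open_mult_dom: "open mult_dom" unfolding mult_dom_def
  by (rule open_coord_domain[OF smooth_manifold_prod[OF MG MG] MG mult pc c(1)])

lemma mult_domI: "a \<in> chart_dom c \<Longrightarrow> b \<in> chart_dom c \<Longrightarrow> a \<otimes> b \<in> chart_dom c
    \<Longrightarrow> (chart_fun c a, chart_fun c b) \<in> mult_dom"
  unfolding mult_dom_def using dom_carrier carrier
  by (intro image_eqI[of _ _ "(a, b)"]) auto

lemma mult_domE:
  assumes "w \<in> mult_dom"
  obtains a b where "w = (chart_fun c a, chart_fun c b)" "a \<in> chart_dom c" "b \<in> chart_dom c"
    "a \<otimes> b \<in> chart_dom c"
  using assms unfolding mult_dom_def by auto

lemma Ck_local_mult: "Ck_on k mult_dom local_mult" unfolding mult_dom_def local_mult_def by (rule coord_rep_Ck[OF mult pc c(1)])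

lemma local_mult_eq: "a \<in> chart_dom c \<Longrightarrow> b \<in> chart_dom c \<Longrightarrow> local_mult (chart_fun c a, chart_fun c b) = chart_fun c (a \<otimes> b)"
  unfolding local_mult_def using chart_inv_prod[OF cc cc] by simp

lemma local_mult_deriv: "w \<in> mult_dom \<Longrightarrow> (local_mult has_derivative frechet_derivative local_mult (at w)) (at w)"
  using Ck_local_mult[of 1] unfolding frechet_derivative_works[symmetric] by simp

text \<open>
  The left-invariant vector field with the value \<xi> at the identity, in the chart c.
\<close>

definition left_field :: "'h \<Rightarrow> 'h \<Rightarrow> 'h" where "left_field \<xi> x = frechet_derivative local_mult (at (x, z0)) (0, \<xi>)"

lemma left_translation: "a \<in> carrier G \<Longrightarrow> continuous_map (mtop MG) (mtop MG) (\<lambda>h. a \<otimes> h)"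
proof -
  assume a: "a \<in> carrier G"
  have "continuous_map (prod_topology (mtop MG) (mtop MG)) (mtop MG) (\<lambda>(a, b). a \<otimes> b)"
    using mult unfolding smooth_map_on_def subtopology_topspace prod_manifold_simps by blast
  moreover have "continuous_map (mtop MG) (prod_topology (mtop MG) (mtop MG)) (\<lambda>h. (a, h))"
    using a carrier by (auto simp: continuous_map_paired)
  ultimately have "continuous_map (mtop MG) (mtop MG) ((\<lambda>(a, b). a \<otimes> b) \<circ> (\<lambda>h. (a, h)))"
    by (rule continuous_map_compose[rotated])
  then show ?thesis by (simp add: comp_def)
qed

lemma eventually_left_translation:
  assumes "a \<in> carrier G" "openin (mtop MG) V" "a \<in> V"
  shows "\<forall>\<^sub>F y in nhds z0. chart_inv c y \<in> chart_dom c \<and> a \<otimes> chart_inv c y \<in> V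
    \<and> chart_fun c (chart_inv c y) = y"
proof -
  have "openin (mtop MG) {h \<in> pts MG. a \<otimes> h \<in> V}"
    by (rule openin_continuous_map_preimage[OF left_translation[OF assms(1)] assms(2)])
  from eventually_chart_inv[OF cc this c(2)] show ?thesis
    using assms carrier one_closed by (auto elim!: eventually_mono)
qed

text \<open>
  Associativity a (b h) = (a b) h, differentiated with respect to h at the identity.
\<close>

lemma left_field_invariant:
  assumes a: "a \<in> chart_dom c" and b: "b \<in> chart_dom c" and ab: "a \<otimes> b \<in> chart_dom c"
  shows "left_field \<xi> (chart_fun c (a \<otimes> b))
    = frechet_derivative local_mult (at (chart_fun c a, chart_fun c b)) (0, left_field \<xi> (chart_fun c b))"
proof -
  note car = dom_carrier[OF a] dom_carrier[OF b] dom_carrier[OF ab]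
  have right: "((\<lambda>y. local_mult (chart_fun c x, y)) has_derivative
      (\<lambda>v. frechet_derivative local_mult (at (chart_fun c x, chart_fun c y)) (0, v))) (at (chart_fun c y))"
    if "x \<in> chart_dom c" "y \<in> chart_dom c" "x \<otimes> y \<in> chart_dom c" for x y
    by (rule has_derivative_compose[OF has_derivative_Pair[OF has_derivative_const has_derivative_ident]
          local_mult_deriv[OF mult_domI[OF that]]])
  have mb: "local_mult (chart_fun c b, z0) = chart_fun c b" using local_mult_eq[OF b c(2)] car by simp
  have "((\<lambda>y. local_mult (chart_fun c a, local_mult (chart_fun c b, y))) has_derivative
      (\<lambda>v. frechet_derivative local_mult (at (chart_fun c a, chart_fun c b)) (0,
        frechet_derivative local_mult (at (chart_fun c b, z0)) (0, v)))) (at z0)"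
    using has_derivative_compose[OF right[OF b c(2)], of "\<lambda>y. local_mult (chart_fun c a, y)"]
      right[OF a b ab] b car mb by simp
  moreover have "\<forall>\<^sub>F y in nhds z0. local_mult (chart_fun c a, local_mult (chart_fun c b, y)) = local_mult (chart_fun c (a \<otimes> b), y)"
    using eventually_left_translation[OF car(2) openin_c b]
  proof eventually_elim
    case (elim y)
    let ?h = "chart_inv c y"
    have h: "?h \<in> chart_dom c" "b \<otimes> ?h \<in> chart_dom c" "chart_fun c ?h = y" using elim by auto
    have "local_mult (chart_fun c a, local_mult (chart_fun c b, chart_fun c ?h)) = local_mult (chart_fun c (a \<otimes> b), chart_fun c ?h)"
      using h(1,2) local_mult_eq[OF b h(1)] local_mult_eq[OF a h(2)] local_mult_eq[OF ab h(1)] car dom_carrier[OF h(1)]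
      by (simp add: m_assoc)
    then show ?case using h(3) by simp
  qed
  ultimately have "((\<lambda>y. local_mult (chart_fun c (a \<otimes> b), y)) has_derivative
      (\<lambda>v. frechet_derivative local_mult (at (chart_fun c a, chart_fun c b)) (0,
        frechet_derivative local_mult (at (chart_fun c b, z0)) (0, v)))) (at z0)"
    by (rule has_derivative_eventually_eq)
  from has_derivative_unique[OF this right[OF ab c(2)]] show ?thesis
    unfolding left_field_def using ab car by (simp add: fun_eq_iff)
qed

text \<open>
  Left multiplication by the identity is the identity map, and so is its derivative.
\<close>

lemma left_field_one: "left_field \<xi> z0 = \<xi>"
proof -
  have w: "(z0, z0) \<in> mult_dom" using mult_domI[OF c(2) c(2)] c(2) by simp
  have "((\<lambda>y. local_mult (z0, y)) has_derivative (\<lambda>v. frechet_derivative local_mult (at (z0, z0)) (0, v))) (at z0)"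
    by (rule has_derivative_compose[OF has_derivative_Pair[OF has_derivative_const has_derivative_ident]
          local_mult_deriv[OF w]])
  moreover have "\<forall>\<^sub>F y in nhds z0. local_mult (z0, y) = y"
    using eventually_left_translation[OF one_closed openin_c c(2)]
  proof eventually_elim
    case (elim y)
    then show ?case using local_mult_eq[OF c(2), of "chart_inv c y"] dom_carrier by simp
  qed
  ultimately have "((\<lambda>y. y) has_derivative (\<lambda>v. frechet_derivative local_mult (at (z0, z0)) (0, v))) (at z0)"
    by (rule has_derivative_eventually_eq)
  from has_derivative_unique[OF this has_derivative_ident] show ?thesis
    by (simp add: left_field_def fun_eq_iff)
qed

lemma left_field_lipschitz:
  obtains r K where "r > 0" "cball z0 r \<subseteq> chart_fun c ` chart_dom c" "K-lipschitz_on (cball z0 r) (left_field \<xi>)"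
proof -
  obtain B :: "'h set" where B: "finite B" "span B = UNIV" using MG unfolding smooth_manifold_def by blast
  have op: "open (chart_fun c ` chart_dom c)" using cc by (simp add: is_chart_def)
  have "Ck_on 1 mult_dom (\<lambda>w. frechet_derivative local_mult (at w) (0, \<xi>))" using Ck_local_mult[of "Suc 1"] by simp
  then have "Ck_on 1 (chart_fun c ` chart_dom c) (\<lambda>x. frechet_derivative local_mult (at (x, z0)) (0, \<xi>))"
    by (rule Ck_on_compose_affine[OF op has_derivative_Pair[OF has_derivative_ident has_derivative_const], rotated])
      (use mult_domI c dom_carrier in auto)
  then have "Ck_on 1 (chart_fun c ` chart_dom c) (left_field \<xi>)" by (simp only: left_field_def[abs_def])
  from C1_locally_lipschitz[OF B op _ this, of z0] c(2) that show ?thesis by blast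
qed

lemma one_param_subgroup_zero:
  assumes "one_param_subgroup G MG \<gamma>"
  shows "\<gamma> t \<in> carrier G" "\<gamma> 0 = \<one>"
proof -
  show car: "\<gamma> t \<in> carrier G" for t
    using assms carrier by (auto simp: one_param_subgroup_def continuous_map_def)
  have "\<gamma> 0 = \<gamma> 0 \<otimes> \<gamma> 0" using assms unfolding one_param_subgroup_def by (metis add_0)
  then show "\<gamma> 0 = \<one>" using car[of 0] r_cancel_one' by metis
qed

text \<open>
  The equation \<gamma>(s) = \<gamma>(t) \<gamma>(s - t), differentiated with respect to s at s = t.
\<close>

lemma one_param_subgroup_ode:
  assumes \<gamma>: "one_param_subgroup G MG \<gamma>" "has_velocity0 MG \<gamma> \<xi>" and t: "\<gamma> t \<in> chart_dom c"
  shows "((\<lambda>s. chart_fun c (\<gamma> s)) has_vector_derivative left_field \<xi> (chart_fun c (\<gamma> t))) (at t)"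
proof -
  note car = one_param_subgroup_zero(1)[OF \<gamma>(1)] and zero = one_param_subgroup_zero(2)[OF \<gamma>(1)]
  have cont: "continuous_map euclidean (mtop MG) \<gamma>" and hom: "\<And>s t. \<gamma> (s + t) = \<gamma> s \<otimes> \<gamma> t"
    using \<gamma>(1) by (auto simp: one_param_subgroup_def)
  have w: "(chart_fun c (\<gamma> t), z0) \<in> mult_dom" using mult_domI[OF t c(2)] t car by simp
  have "((\<lambda>s. chart_fun c (\<gamma> s)) has_derivative (\<lambda>h. h *\<^sub>R \<xi>)) (at (t - t))"
    using \<gamma>(2) zero by (simp add: has_velocity0_def has_vector_derivative_def comp_def)
  moreover have "((\<lambda>s. s - t) has_derivative (\<lambda>h. h)) (at t)" by (auto intro!: derivative_eq_intros)
  ultimately have "((\<lambda>s. chart_fun c (\<gamma> (s - t))) has_derivative (\<lambda>h. h *\<^sub>R \<xi>)) (at t)"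
    by (rule has_derivative_compose[rotated])
  then have "((\<lambda>s. (chart_fun c (\<gamma> t), chart_fun c (\<gamma> (s - t)))) has_derivative (\<lambda>h. (0, h *\<^sub>R \<xi>))) (at t)"
    by (intro has_derivative_Pair has_derivative_const)
  from has_derivative_compose[OF this, of local_mult] local_mult_deriv[OF w]
  have "((\<lambda>s. local_mult (chart_fun c (\<gamma> t), chart_fun c (\<gamma> (s - t)))) has_derivative
      (\<lambda>h. frechet_derivative local_mult (at (chart_fun c (\<gamma> t), z0)) (0, h *\<^sub>R \<xi>))) (at t)"
    by (simp add: zero)
  moreover have "\<forall>\<^sub>F s in nhds t. local_mult (chart_fun c (\<gamma> t), chart_fun c (\<gamma> (s - t))) = chart_fun c (\<gamma> s)"
  proof -
    have "continuous_map euclidean euclidean (\<lambda>s. s - t)"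
      by (simp add: continuous_intros)
    from continuous_map_compose[OF this cont]
    have "continuous_map euclidean (mtop MG) (\<lambda>s. \<gamma> (s - t))" by (simp add: comp_def)
    from eventually_curve_in[OF this openin_c, of t] have "\<forall>\<^sub>F s in nhds t. \<gamma> (s - t) \<in> chart_dom c"
      using zero c(2) by simp
    then show ?thesis
    proof eventually_elim
      case (elim s)
      have "\<gamma> t \<otimes> \<gamma> (s - t) = \<gamma> s" using hom[of t "s - t"] by simp
      then show ?case using local_mult_eq[OF t elim] by simp
    qed
  qed
  ultimately have "((\<lambda>s. chart_fun c (\<gamma> s)) has_derivative
      (\<lambda>h. frechet_derivative local_mult (at (chart_fun c (\<gamma> t), z0)) (0, h *\<^sub>R \<xi>))) (at t)"
    by (rule has_derivative_eventually_eq)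
  moreover have "frechet_derivative local_mult (at (chart_fun c (\<gamma> t), z0)) (0, h *\<^sub>R \<xi>) = h *\<^sub>R left_field \<xi> (chart_fun c (\<gamma> t))" for h
    using linear_scale[OF has_derivative_linear[OF local_mult_deriv[OF w]], of h "(0, \<xi>)"] by (simp add: left_field_def)
  ultimately show ?thesis by (simp add: has_vector_derivative_def)
qed

lemma one_param_subgroup_pow:
  assumes "one_param_subgroup G MG \<gamma>"
  shows "\<gamma> (real n * s) = \<gamma> s [^] n"
  using local_hom_pow[of "\<bar>real n * s\<bar> + 1" \<gamma> n s] one_param_subgroup_zero[OF assms] assms
  by (simp add: one_param_subgroup_def)

text \<open>
  Near 0 both curves solve the same differential equation with the same initial value; a
  one-parameter subgroup is determined by its values near 0, since \<gamma>(t) = \<gamma>(t / n)^n.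
\<close>

lemma one_param_subgroup_unique:
  assumes \<gamma>: "one_param_subgroup G MG \<gamma>" "has_velocity0 MG \<gamma> \<xi>"
    and \<eta>: "one_param_subgroup G MG \<eta>" "has_velocity0 MG \<eta> \<xi>"
  shows "\<gamma> = \<eta>"
proof -
  obtain r K where r: "r > 0" "cball z0 r \<subseteq> chart_fun c ` chart_dom c"
    and lip: "K-lipschitz_on (cball z0 r) (left_field \<xi>)"
    by (rule left_field_lipschitz)
  have near: "\<forall>\<^sub>F t in nhds 0. \<gamma> t \<in> chart_dom c \<and> chart_fun c (\<gamma> t) \<in> cball z0 r"
    if \<gamma>: "one_param_subgroup G MG \<gamma>" "has_velocity0 MG \<gamma> \<xi>" for \<gamma>
  proof -
    have zero: "\<gamma> 0 = \<one>" by (rule one_param_subgroup_zero(2)[OF \<gamma>(1)])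
    have "\<forall>\<^sub>F t in nhds 0. \<gamma> t \<in> chart_dom c"
      using \<gamma>(1) zero c(2) openin_c by (intro eventually_curve_in) (auto simp: one_param_subgroup_def)
    moreover have "isCont (\<lambda>t. chart_fun c (\<gamma> t)) 0"
      using has_vector_derivative_continuous[OF one_param_subgroup_ode[OF \<gamma>, of 0]] zero c(2) by simp
    then have "((\<lambda>t. chart_fun c (\<gamma> t)) \<longlongrightarrow> z0) (nhds 0)"
      using isCont_tendsto_nhds[of 0 "\<lambda>t. chart_fun c (\<gamma> t)"] zero by simp
    then have "\<forall>\<^sub>F t in nhds 0. chart_fun c (\<gamma> t) \<in> ball z0 r"
      by (rule topological_tendstoD[OF _ open_ball]) (use r(1) in auto)
    ultimately show ?thesis by eventually_elim auto
  qed
  have "\<forall>\<^sub>F t in nhds 0. (\<gamma> t \<in> chart_dom c \<and> chart_fun c (\<gamma> t) \<in> cball z0 r)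
      \<and> (\<eta> t \<in> chart_dom c \<and> chart_fun c (\<eta> t) \<in> cball z0 r)"
    using near[OF \<gamma>] near[OF \<eta>] by (rule eventually_conj)
  then obtain d0 where d0: "d0 > 0" "\<And>t. \<bar>t\<bar> < d0 \<Longrightarrow> \<gamma> t \<in> chart_dom c \<and> chart_fun c (\<gamma> t) \<in> cball z0 r
      \<and> \<eta> t \<in> chart_dom c \<and> chart_fun c (\<eta> t) \<in> cball z0 r"
    unfolding eventually_nhds_metric dist_real_def by auto
  have K: "K \<ge> 0" using lip by (rule lipschitz_on_nonneg)
  define d where "d = min d0 (1 / (2 * (K + 1)))"
  have d: "d > 0" "d \<le> d0" using d0 K by (auto simp: d_def)
  have "K * d \<le> K * (1 / (2 * (K + 1)))" using K by (intro mult_left_mono) (simp_all add: d_def)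
  also have "\<dots> \<le> 1 / 2" using K by (simp add: field_simps)
  finally have Kd: "K * d \<le> 1 / 2" .
  have local: "\<gamma> t = \<eta> t" if t: "\<bar>t\<bar> < d" for t
  proof -
    have "chart_fun c (\<gamma> t) = chart_fun c (\<eta> t)"
    proof (rule ode_unique[OF lip bounded_cball Kd])
      show "chart_fun c (\<gamma> s) \<in> cball z0 r
          \<and> ((\<lambda>t. chart_fun c (\<gamma> t)) has_vector_derivative left_field \<xi> (chart_fun c (\<gamma> s))) (at s)"
        if "\<bar>s\<bar> < d" for s
        using that d(2) d0(2)[of s] one_param_subgroup_ode[OF \<gamma>] by auto
      show "chart_fun c (\<eta> s) \<in> cball z0 r
          \<and> ((\<lambda>t. chart_fun c (\<eta> t)) has_vector_derivative left_field \<xi> (chart_fun c (\<eta> s))) (at s)"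
        if "\<bar>s\<bar> < d" for s
        using that d(2) d0(2)[of s] one_param_subgroup_ode[OF \<eta>] by auto
    qed (use t one_param_subgroup_zero(2)[OF \<gamma>(1)] one_param_subgroup_zero(2)[OF \<eta>(1)] in auto)
    then show ?thesis
      using d0(2)[of t] t d(2) inj_onD[OF is_chart_inj_on[OF cc]] by auto
  qed
  show ?thesis
  proof
    fix t
    obtain n where n: "\<bar>t\<bar> / d < real n" using reals_Archimedean2 by blast
    then have n0: "real n > 0" using d(1) by (smt (verit) divide_nonneg_pos)
    then have "\<bar>t / real n\<bar> < d" using n d(1) by (simp add: field_simps)
    then have "\<gamma> (t / real n) = \<eta> (t / real n)" by (rule local)
    then have "\<gamma> (real n * (t / real n)) = \<eta> (real n * (t / real n))"
      unfolding one_param_subgroup_pow[OF \<gamma>(1)] one_param_subgroup_pow[OF \<eta>(1)] by simp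
    then show "\<gamma> t = \<eta> t" using n0 by simp
  qed
qed

text \<open>
  An integral curve x of the left-invariant field through the identity is a local homomorphism:
  for fixed s, the products x(s) x(t) and the values x(s + t) solve, as functions of t, the
  same equation with the same initial value x(s).
\<close>

lemma one_param_subgroup_exists:
  obtains \<gamma> where "one_param_subgroup G MG \<gamma>" "has_velocity0 MG \<gamma> \<xi>"
proof -
  obtain r K where r: "r > 0" "cball z0 r \<subseteq> chart_fun c ` chart_dom c"
    and lip: "K-lipschitz_on (cball z0 r) (left_field \<xi>)"
    by (rule left_field_lipschitz)
  obtain d x where d: "d > 0" and x0: "x 0 = z0"
    and x: "\<And>t. \<bar>t\<bar> < d \<Longrightarrow> x t \<in> cball z0 r \<and> (x has_vector_derivative left_field \<xi> (x t)) (at t)"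
    using picard_lindelof[OF r(1) lip] by blast
  have K: "K \<ge> 0" using lip by (rule lipschitz_on_nonneg)
  have xU: "x t \<in> chart_fun c ` chart_dom c" if "\<bar>t\<bar> < d" for t using x[OF that] r(2) by blast
  define g where "g t = chart_inv c (x t)" for t
  have g: "g t \<in> chart_dom c" "chart_fun c (g t) = x t" if "\<bar>t\<bar> < d" for t
    using xU[OF that] chart_inv_chart_fun[OF cc] by (auto simp: g_def)
  have g0: "g 0 = \<one>" using chart_inv_chart_fun[OF cc c(2)] by (simp add: g_def x0)
  have xcont: "(x \<longlongrightarrow> z0) (nhds 0)"
    using has_vector_derivative_continuous[of x _ 0 UNIV] x[of 0] d x0 isCont_tendsto_nhds[of 0 x]
    by auto
  have "continuous_on mult_dom local_mult" using Ck_local_mult[of 0] by simp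
  then have "open {w \<in> mult_dom. local_mult w \<in> ball z0 r}"
    using open_mult_dom continuous_on_open_vimage[of mult_dom local_mult] by (auto simp: vimage_def Int_def conj_commute)
  moreover have "(z0, z0) \<in> {w \<in> mult_dom. local_mult w \<in> ball z0 r}"
    using mult_domI[OF c(2) c(2)] local_mult_eq[OF c(2) c(2)] c(2) r(1) by simp
  ultimately obtain A A' where A: "open A" "open A'" "z0 \<in> A" "z0 \<in> A'" "A \<times> A' \<subseteq> {w \<in> mult_dom. local_mult w \<in> ball z0 r}"
    by (rule open_prod_elim) blast
  have "\<forall>\<^sub>F t in nhds 0. x t \<in> A \<inter> A'"
    using A by (intro topological_tendstoD[OF xcont]) auto
  then obtain d1 where d1: "d1 > 0" "\<And>t. \<bar>t\<bar> < d1 \<Longrightarrow> x t \<in> A \<inter> A'"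
    unfolding eventually_nhds_metric dist_real_def by auto
  \<comment> \<open>For |s|, |t| < \<delta> the sum s + t stays in the domain of x, the products x(s) x(t) stay in the
    ball on which the field is Lipschitz, and the uniqueness lemma applies on the interval.\<close>
  define \<delta> where "\<delta> = min (min (d / 2) d1) (1 / (2 * (K + 1)))"
  have \<delta>: "\<delta> > 0" "\<delta> \<le> d / 2" "\<delta> \<le> d1" using d d1 K by (auto simp: \<delta>_def)
  have "K * \<delta> \<le> K * (1 / (2 * (K + 1)))" using K by (intro mult_left_mono) (simp_all add: \<delta>_def)
  also have "\<dots> \<le> 1 / 2" using K by (simp add: field_simps)
  finally have K\<delta>: "K * \<delta> \<le> 1 / 2" .
  have in_dom: "(x s, x t) \<in> mult_dom" "local_mult (x s, x t) \<in> cball z0 r" if "\<bar>s\<bar> < \<delta>" "\<bar>t\<bar> < \<delta>" for s t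
  proof -
    have "(x s, x t) \<in> A \<times> A'" using d1(2)[of s] d1(2)[of t] that \<delta>(3) by auto
    with A(5) show "(x s, x t) \<in> mult_dom" "local_mult (x s, x t) \<in> cball z0 r" by auto
  qed
  have hom: "g (s + t) = g s \<otimes> g t" if s: "\<bar>s\<bar> < \<delta>" and t: "\<bar>t\<bar> < \<delta>" for s t
  proof -
    have dom: "g s \<in> chart_dom c" "g t \<in> chart_dom c" "g s \<otimes> g t \<in> chart_dom c"
      if "\<bar>s\<bar> < \<delta>" "\<bar>t\<bar> < \<delta>" for s t
    proof -
      show st: "g s \<in> chart_dom c" "g t \<in> chart_dom c" using g that \<delta> by auto
      from in_dom(1)[OF that] obtain a b where ab: "(x s, x t) = (chart_fun c a, chart_fun c b)"
        "a \<in> chart_dom c" "b \<in> chart_dom c" "a \<otimes> b \<in> chart_dom c" by (rule mult_domE)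
      then have "a = g s" "b = g t" by (simp_all add: g_def chart_inv_chart_fun[OF cc])
      then show "g s \<otimes> g t \<in> chart_dom c" using ab(4) by simp
    qed
    have xg: "chart_fun c (g s) = x s" if "\<bar>s\<bar> < \<delta>" for s using that \<delta> g(2)[of s] by simp
    have "local_mult (x s, x t) = x (s + t)"
    proof (rule ode_unique[OF lip bounded_cball K\<delta>, of "\<lambda>t. local_mult (x s, x t)" "\<lambda>t. x (s + t)"])
      fix t assume t: "\<bar>t\<bar> < \<delta>"
      have "((\<lambda>t. (x s, x t)) has_derivative (\<lambda>h. (0, h *\<^sub>R left_field \<xi> (x t)))) (at t)"
        using x[of t] t \<delta> by (intro has_derivative_Pair has_derivative_const)
          (auto simp: has_vector_derivative_def)
      from has_derivative_compose[OF this local_mult_deriv[OF in_dom(1)[OF s t]]]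
      have "((\<lambda>t. local_mult (x s, x t)) has_derivative
          (\<lambda>h. frechet_derivative local_mult (at (x s, x t)) (0, h *\<^sub>R left_field \<xi> (x t)))) (at t)" .
      moreover have "frechet_derivative local_mult (at (x s, x t)) (0, h *\<^sub>R left_field \<xi> (x t))
          = h *\<^sub>R left_field \<xi> (local_mult (x s, x t))" for h
      proof -
        have "frechet_derivative local_mult (at (x s, x t)) (0, left_field \<xi> (x t)) = left_field \<xi> (local_mult (x s, x t))"
          using left_field_invariant[OF dom[OF s t], of \<xi>] local_mult_eq[OF dom(1,2)[OF s t]] xg[OF s] xg[OF t]
          by simp
        then show ?thesis
          using linear_scale[OF has_derivative_linear[OF local_mult_deriv[OF in_dom(1)[OF s t]]], of h "(0, left_field \<xi> (x t))"]
          by simp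
      qed
      ultimately show "local_mult (x s, x t) \<in> cball z0 r \<and>
          ((\<lambda>t. local_mult (x s, x t)) has_vector_derivative left_field \<xi> (local_mult (x s, x t))) (at t)"
        using in_dom(2)[OF s t] by (simp add: has_vector_derivative_def)
      have st: "\<bar>s + t\<bar> < d" using s t \<delta> by linarith
      have "((\<lambda>t. s + t) has_derivative (\<lambda>h. h)) (at t)" by (auto intro!: derivative_eq_intros)
      from has_derivative_compose[OF this, of x] x[OF st]
      have "((\<lambda>t. x (s + t)) has_vector_derivative left_field \<xi> (x (s + t))) (at t)"
        by (simp add: has_vector_derivative_def)
      then show "x (s + t) \<in> cball z0 r \<and>
          ((\<lambda>t. x (s + t)) has_vector_derivative left_field \<xi> (x (s + t))) (at t)"
        using x[OF st] by simp
    next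
      have "\<bar>0::real\<bar> < \<delta>" using \<delta> by simp
      from local_mult_eq[OF dom(1,2)[OF s this]] show "local_mult (x s, x 0) = x (s + 0)"
        using xg[OF s] g0 dom_carrier[OF dom(1)[OF s s]] by (simp add: x0)
    qed (rule t)
    then have "chart_fun c (g (s + t)) = chart_fun c (g s \<otimes> g t)"
      using local_mult_eq[OF dom(1,2)[OF s t]] xg[OF s] xg[OF t] g(2)[of "s + t"] s t \<delta> by simp
    then show ?thesis
      using inj_onD[OF is_chart_inj_on[OF cc]] dom(3)[OF s t] g(1)[of "s + t"] s t \<delta> by simp
  qed
  have gcar: "g t \<in> carrier G" if "\<bar>t\<bar> < \<delta>" for t using g(1)[of t] that \<delta> dom_carrier by simp
  obtain \<gamma> where \<gamma>: "\<And>t. \<gamma> t \<in> carrier G" "\<And>s t. \<gamma> (s + t) = \<gamma> s \<otimes> \<gamma> t"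
    "\<And>t. \<bar>t\<bar> < \<delta> \<Longrightarrow> \<gamma> t = g t"
    using extend_local_hom[of \<delta> g, OF \<delta>(1) gcar hom] by blast
  have ev\<delta>: "\<forall>\<^sub>F t in nhds 0. \<bar>t\<bar> < \<delta>"
    using \<delta>(1) unfolding eventually_nhds_metric dist_real_def by auto
  have "continuous_map euclidean (mtop MG) \<gamma>"
    unfolding continuous_map_def
  proof (intro conjI allI impI)
    show "\<gamma> \<in> topspace euclidean \<rightarrow> pts MG" using \<gamma>(1) carrier by auto
    fix V assume V: "openin (mtop MG) V"
    have "\<forall>\<^sub>F t in nhds t0. \<gamma> t \<in> V" if "\<gamma> t0 \<in> V" for t0
    proof -
      have "\<forall>\<^sub>F y in nhds z0. \<gamma> t0 \<otimes> chart_inv c y \<in> V"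
        using eventually_left_translation[OF \<gamma>(1) V that] by eventually_elim simp
      from eventually_compose_filterlim[OF this xcont]
      have "\<forall>\<^sub>F t in nhds 0. \<gamma> t0 \<otimes> chart_inv c (x t) \<in> V" .
      with ev\<delta> have "\<forall>\<^sub>F t in nhds 0. \<gamma> (t0 + t) \<in> V"
        by eventually_elim (simp add: \<gamma>(2,3) g_def)
      moreover have "((\<lambda>t. t - t0) \<longlongrightarrow> 0) (nhds t0)"
        using isCont_tendsto_nhds[of t0 "\<lambda>t. t - t0"] by simp
      ultimately have "\<forall>\<^sub>F t in nhds t0. \<gamma> (t0 + (t - t0)) \<in> V"
        by (rule eventually_compose_filterlim)
      then show ?thesis by simp
    qed
    then have "open {t. \<gamma> t \<in> V}"
      unfolding eventually_nhds by (subst open_subopen) (simp add: subset_iff Ball_def)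
    then show "openin euclidean {t \<in> topspace euclidean. \<gamma> t \<in> V}" by simp
  qed
  with \<gamma>(2) have "one_param_subgroup G MG \<gamma>" by (simp add: one_param_subgroup_def)
  moreover have "has_velocity0 MG \<gamma> \<xi>"
  proof -
    have \<gamma>0: "\<gamma> 0 = \<one>" using \<gamma>(3)[of 0] \<delta> g0 by simp
    have "(x has_derivative (\<lambda>h. h *\<^sub>R \<xi>)) (at 0)"
      using x[of 0] d x0 left_field_one[of \<xi>] by (simp add: has_vector_derivative_def)
    moreover have "\<forall>\<^sub>F t in nhds 0. x t = chart_fun c (\<gamma> t)"
      using ev\<delta> by eventually_elim (use \<gamma>(3) g(2) \<delta>(2) in auto)
    ultimately have "((\<lambda>t. chart_fun c (\<gamma> t)) has_derivative (\<lambda>h. h *\<^sub>R \<xi>)) (at 0)"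
      by (rule has_derivative_eventually_eq)
    then show ?thesis by (simp add: has_velocity0_def \<gamma>0 comp_def has_vector_derivative_def)
  qed
  ultimately show ?thesis by (rule that)
qed

lemma lie_exp_eqI:
  assumes "one_param_subgroup G MG \<gamma>" "has_velocity0 MG \<gamma> \<xi>"
  shows "lie_exp G MG \<xi> = \<gamma> 1"
proof -
  have "(THE \<gamma>. one_param_subgroup G MG \<gamma> \<and> has_velocity0 MG \<gamma> \<xi>) = \<gamma>"
    using assms one_param_subgroup_unique by (intro the_equality) auto
  then show ?thesis by (simp add: lie_exp_def)
qed

text \<open>
  The subgroup with velocity t \<xi> is the one with velocity \<xi>, run at speed t; its value at time 1 is
  the value of the latter at time t.
\<close>

lemma lie_exp_one_param:
  "one_param_subgroup G MG (\<lambda>t. lie_exp G MG (t *\<^sub>R \<xi>))"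
  "has_velocity0 MG (\<lambda>t. lie_exp G MG (t *\<^sub>R \<xi>)) \<xi>"
proof -
  obtain \<gamma> where \<gamma>: "one_param_subgroup G MG \<gamma>" "has_velocity0 MG \<gamma> \<xi>"
    by (rule one_param_subgroup_exists)
  have "lie_exp G MG (t *\<^sub>R \<xi>) = \<gamma> t" for t
  proof -
    have "one_param_subgroup G MG (\<lambda>s. \<gamma> (t * s))"
      unfolding one_param_subgroup_def
    proof (intro conjI allI)
      have "continuous_map euclidean euclidean (\<lambda>s::real. t * s)" by (simp add: continuous_intros)
      from continuous_map_compose[OF this, of "mtop MG" \<gamma>] \<gamma>(1)
      show "continuous_map euclidean (mtop MG) (\<lambda>s. \<gamma> (t * s))"
        by (simp add: one_param_subgroup_def comp_def)
      show "\<gamma> (t * (s + s')) = \<gamma> (t * s) \<otimes> \<gamma> (t * s')" for s s'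
        using \<gamma>(1) by (simp add: one_param_subgroup_def distrib_left)
    qed
    moreover have "has_velocity0 MG (\<lambda>s. \<gamma> (t * s)) (t *\<^sub>R \<xi>)"
    proof -
      have "((\<lambda>s. t * s) has_derivative (\<lambda>s. t * s)) (at 0)"
        by (auto intro!: derivative_eq_intros)
      moreover have "((\<lambda>s. chart_fun (chart_at MG (\<gamma> 0)) (\<gamma> s)) has_derivative (\<lambda>h. h *\<^sub>R \<xi>)) (at (t * 0))"
        using \<gamma>(2) by (simp add: has_velocity0_def has_vector_derivative_def comp_def)
      ultimately have "((\<lambda>s. chart_fun (chart_at MG (\<gamma> 0)) (\<gamma> (t * s))) has_derivative (\<lambda>s. (t * s) *\<^sub>R \<xi>)) (at 0)"
        by (rule has_derivative_compose)
      then show ?thesis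
        by (simp add: has_velocity0_def has_vector_derivative_def comp_def mult.commute)
    qed
    ultimately show ?thesis using lie_exp_eqI[of "\<lambda>s. \<gamma> (t * s)"] by simp
  qed
  with \<gamma> show "one_param_subgroup G MG (\<lambda>t. lie_exp G MG (t *\<^sub>R \<xi>))"
    "has_velocity0 MG (\<lambda>t. lie_exp G MG (t *\<^sub>R \<xi>)) \<xi>" by simp_all
qed

end

section \<open>Smooth actions and infinitesimal generators\<close>

locale smooth_lie_action =
  fixes G :: "'g monoid" (structure) and MG :: "('g, 'h::banach) manifold"
    and M :: "('m, 'e::banach) manifold" and \<Delta> :: "'g \<Rightarrow> 'm \<Rightarrow> 'm"
  assumes lie: "lie_group G MG" and M: "smooth_manifold M" and act: "smooth_action G MG M \<Delta>"
begin

sublocale group_action G "pts M" \<Delta> using act by (simp add: smooth_action_def)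
sublocale group G using lie by (simp add: lie_group_def)

lemma MG: "smooth_manifold MG" and carrier: "carrier G = pts MG"
  using lie by (auto simp: lie_group_def)

lemma action_map: "smooth_map (MG \<times>\<^sub>M M) M (\<lambda>(g, q). \<Delta> g q)"
  using act by (simp add: smooth_action_def)

lemma action_closed: "g \<in> carrier G \<Longrightarrow> q \<in> pts M \<Longrightarrow> \<Delta> g q \<in> pts M"
  using element_image by blast

lemma action_one: "q \<in> pts M \<Longrightarrow> \<Delta> \<one> q = q"
  using fun_cong[OF id_eq_one, of q] by simp

lemma action_inv: "g \<in> carrier G \<Longrightarrow> q \<in> pts M \<Longrightarrow> \<Delta> (inv g) (\<Delta> g q) = q"
  using orbit_sym_aux by blast

lemma orbit_action:
  assumes "g \<in> carrier G" "q \<in> pts M"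
  shows "orbit G \<Delta> (\<Delta> g q) = orbit G \<Delta> q"
proof
  show "orbit G \<Delta> (\<Delta> g q) \<subseteq> orbit G \<Delta> q"
  proof
    fix x assume "x \<in> orbit G \<Delta> (\<Delta> g q)"
    then obtain k where k: "k \<in> carrier G" "x = \<Delta> k (\<Delta> g q)" unfolding orbit_def by blast
    have "x = \<Delta> (k \<otimes> g) q" using composition_rule[OF assms(2) k(1) assms(1)] k(2) by simp
    then show "x \<in> orbit G \<Delta> q" unfolding orbit_def using k(1) assms(1) by blast
  qed
  show "orbit G \<Delta> q \<subseteq> orbit G \<Delta> (\<Delta> g q)"
  proof
    fix x assume "x \<in> orbit G \<Delta> q"
    then obtain k where k: "k \<in> carrier G" "x = \<Delta> k q" unfolding orbit_def by blast
    have "x = \<Delta> (k \<otimes> inv g) (\<Delta> g q)"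
      using composition_rule[OF action_closed[OF assms] k(1) inv_closed[OF assms(1)]]
        action_inv[OF assms] k(2) by simp
    then show "x \<in> orbit G \<Delta> (\<Delta> g q)" unfolding orbit_def using k(1) assms(1) by blast
  qed
qed

lemma smooth_translation:
  assumes g: "g \<in> carrier G"
  shows "smooth_map M M (\<Delta> g)"
proof -
  have gM: "g \<in> pts MG" using g carrier by simp
  have "smooth_map M M (\<lambda>q. (\<lambda>(g, q). \<Delta> g q) (g, q))"
  proof (rule smooth_map_affine_precompose[OF M smooth_manifold_prod[OF MG M] M action_map])
    show "continuous_map (mtop M) (mtop (MG \<times>\<^sub>M M)) (\<lambda>q. (g, q))"
      using gM by (simp add: continuous_map_paired)
    fix c :: "('m, 'e) chart" and p assume c: "c \<in> atlas M"
    show "\<exists>c'\<in>atlas (MG \<times>\<^sub>M M). \<exists>A A'. (\<forall>x. (A has_derivative A') (at x))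
      \<and> (\<forall>p\<in>chart_dom c. (g, p) \<in> chart_dom c' \<and> chart_fun c' (g, p) = A (chart_fun c p))"
    proof (intro bexI exI conjI allI)
      show "prod_chart (chart_at MG g) c \<in> atlas (MG \<times>\<^sub>M M)"
        using smooth_manifold_chart_at[OF MG gM] c by simp
      show "((\<lambda>x. (chart_fun (chart_at MG g) g, x)) has_derivative (\<lambda>x. (0, x))) (at x)" for x
        by (rule has_derivative_Pair[OF has_derivative_const has_derivative_ident])
    qed (use smooth_manifold_chart_at[OF MG gM] in auto)
  qed
  then show ?thesis by simp
qed

lemma mderiv_translation_inv:
  assumes g: "g \<in> carrier G" and q: "q \<in> pts M"
  shows "mderiv M M (\<Delta> (inv g)) (\<Delta> g q) (mderiv M M (\<Delta> g) q v) = v"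
proof -
  have "mderiv M M (\<Delta> (inv g)) (\<Delta> g q) (mderiv M M (\<Delta> g) q v) = mderiv M M (\<Delta> (inv g) \<circ> \<Delta> g) q v"
    using mderiv_compose[OF M M M smooth_translation[OF g] smooth_translation[OF inv_closed[OF g]] q]
    by simp
  also have "\<dots> = frechet_derivative (coord_rep (chart_at M q) (chart_at M q) id)
      (at (chart_fun (chart_at M q) q)) v"
    unfolding mderiv_def comp_apply[of "\<Delta> (inv g)"] action_inv[OF g q]
    by (rule fun_cong[OF coord_derivative_cong[OF M smooth_manifold_chart_at[OF M q]]])
      (simp add: action_inv[OF g])
  also have "\<dots> = v" by (rule coord_derivative_id[OF M smooth_manifold_chart_at[OF M q]])
  finally show ?thesis .
qed

text \<open>
  The derivative of the action map in the group direction.  Compared with inf_generator this form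
  inf_generator, it shows the smooth dependence on the point q.
\<close>

definition generator :: "'h \<Rightarrow> 'm \<Rightarrow> 'e" where
  "generator \<xi> q = mderiv (MG \<times>\<^sub>M M) M (\<lambda>(g, q). \<Delta> g q) (\<one>, q) (\<xi>, 0)"

lemma
  assumes \<gamma>: "continuous_map euclidean (mtop MG) \<gamma>" and q: "q \<in> pts M"
  shows continuous_map_pair_const: "continuous_map euclidean (mtop (MG \<times>\<^sub>M M)) (\<lambda>t. (\<gamma> t, q))"
    and continuous_map_orbit_curve: "continuous_map euclidean (mtop M) (\<lambda>t. \<Delta> (\<gamma> t) q)"
proof -
  show 1: "continuous_map euclidean (mtop (MG \<times>\<^sub>M M)) (\<lambda>t. (\<gamma> t, q))"
    using \<gamma> q by (simp add: continuous_map_paired)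
  have "continuous_map (mtop (MG \<times>\<^sub>M M)) (mtop M) (\<lambda>(g, q). \<Delta> g q)"
    using action_map unfolding smooth_map_def smooth_map_on_def subtopology_topspace by blast
  from continuous_map_compose[OF 1 this]
  show "continuous_map euclidean (mtop M) (\<lambda>t. \<Delta> (\<gamma> t) q)" by (simp add: comp_def)
qed

text \<open>
  Any curve in the group with initial velocity \<xi> produces the generator, by the chain rule for the
  action map along the curve t \<mapsto> (\<gamma> t, q).
\<close>

lemma generator_velocity:
  assumes \<gamma>: "continuous_map euclidean (mtop MG) \<gamma>" "\<gamma> 0 = \<one>" "has_velocity0 MG \<gamma> \<xi>"
    and q: "q \<in> pts M"
  shows "has_velocity0 M (\<lambda>t. \<Delta> (\<gamma> t) q) (generator \<xi> q)"
  using has_velocity0_image[OF smooth_manifold_prod[OF MG M] M action_map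
      continuous_map_pair_const[OF \<gamma>(1) q] has_velocity0_Pair[OF \<gamma>(3) has_velocity0_const]]
  by (simp add: generator_def \<gamma>(2))

lemma exp_curve:
  "continuous_map euclidean (mtop MG) (\<lambda>t. lie_exp G MG (t *\<^sub>R \<xi>))"
  "lie_exp G MG 0 = \<one>" "has_velocity0 MG (\<lambda>t. lie_exp G MG (t *\<^sub>R \<xi>)) \<xi>"
  "lie_exp G MG (t *\<^sub>R \<xi>) \<in> carrier G"
proof -
  interpret L: lie_group_at_one G MG by unfold_locales (rule lie)
  show "continuous_map euclidean (mtop MG) (\<lambda>t. lie_exp G MG (t *\<^sub>R \<xi>))"
    "has_velocity0 MG (\<lambda>t. lie_exp G MG (t *\<^sub>R \<xi>)) \<xi>"
    using L.lie_exp_one_param[of \<xi>] by (simp_all add: one_param_subgroup_def)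
  show "lie_exp G MG 0 = \<one>" "lie_exp G MG (t *\<^sub>R \<xi>) \<in> carrier G"
    using L.one_param_subgroup_zero[OF L.lie_exp_one_param(1)[of \<xi>]] by simp_all
qed

lemma generator_velocity_exp:
  "q \<in> pts M \<Longrightarrow> has_velocity0 M (\<lambda>t. \<Delta> (lie_exp G MG (t *\<^sub>R \<xi>)) q) (generator \<xi> q)"
  by (rule generator_velocity) (simp_all add: exp_curve)

lemma inf_generator_eq: "q \<in> pts M \<Longrightarrow> inf_generator G MG M \<Delta> \<xi> q = generator \<xi> q"
  unfolding inf_generator_def by (rule velocity0_eqI[OF generator_velocity_exp])

text \<open>
  An invariant map is constant along the curve exp(t \<xi>) q, whose velocity is the generator.  It is
  applied to the orbit projection and to the discrete Lagrangian.
\<close>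

lemma generator_vertical:
  assumes N: "smooth_manifold N" and F: "smooth_map M N F" and q: "q \<in> pts M"
    and inv: "\<And>g. g \<in> carrier G \<Longrightarrow> F (\<Delta> g q) = F q"
  shows "mderiv M N F q (generator \<xi> q) = 0"
proof -
  have "has_velocity0 N (\<lambda>t. F (\<Delta> (lie_exp G MG (t *\<^sub>R \<xi>)) q)) (mderiv M N F q (generator \<xi> q))"
    using has_velocity0_image[OF M N F continuous_map_orbit_curve[OF exp_curve(1) q]
        generator_velocity_exp[OF q]] exp_curve(2) action_one[OF q] by simp
  moreover have "(\<lambda>t. F (\<Delta> (lie_exp G MG (t *\<^sub>R \<xi>)) q)) = (\<lambda>t. F q)"
    using inv[OF exp_curve(4)] by simp
  ultimately show ?thesis using has_velocity0_unique[OF _ has_velocity0_const] by simp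
qed

text \<open>
  In an arbitrary chart c around q, the generator is the partial derivative of the coordinate expression
  of the action in the direction \<xi>; the change of charts from c to the preferred chart at q
  translates it into the vector that represents it.
\<close>

lemma generator_coord:
  assumes c: "c \<in> atlas M" "q \<in> chart_dom c"
  defines "k \<equiv> chart_at MG \<one>"
  shows "generator \<xi> q = frechet_derivative (coord_rep c (chart_at M q) id) (at (chart_fun c q))
      (frechet_derivative (coord_rep (prod_chart k c) c (\<lambda>(g, q). \<Delta> g q)) (at (chart_fun k \<one>, chart_fun c q)) (\<xi>, 0))"
proof -
  let ?\<gamma> = "\<lambda>t. lie_exp G MG (t *\<^sub>R \<xi>)"
  have q: "q \<in> pts M" using chart_dom_subset_pts[OF M c(1)] c(2) by blast
  have one: "\<one> \<in> pts MG" using carrier one_closed by simp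
  have k: "k \<in> atlas MG" "\<one> \<in> chart_dom k"
    unfolding k_def using smooth_manifold_chart_at[OF MG one] by auto
  have "((\<lambda>t. chart_fun k (?\<gamma> t)) has_derivative (\<lambda>h. h *\<^sub>R \<xi>)) (at 0)"
    using exp_curve(3)[of \<xi>] by (simp add: has_velocity0_def has_vector_derivative_def comp_def exp_curve(2) k_def)
  from has_derivative_Pair[OF this has_derivative_const[of "chart_fun c q"]]
  have v: "((\<lambda>t. chart_fun (prod_chart k c) (?\<gamma> t, q)) has_vector_derivative (\<xi>, 0)) (at 0)"
    by (simp add: has_vector_derivative_def)
  have 1: "((\<lambda>t. chart_fun c (\<Delta> (?\<gamma> t) q)) has_vector_derivative
      frechet_derivative (coord_rep (prod_chart k c) c (\<lambda>(g, q). \<Delta> g q)) (at (chart_fun k \<one>, chart_fun c q)) (\<xi>, 0)) (at 0)"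
    using curve_coord_derivative[OF smooth_manifold_prod[OF MG M] action_map[unfolded smooth_map_def]
        prod_chart_in_atlas[OF k(1) c(1)] c(1) continuous_map_pair_const[OF exp_curve(1) q] _ _ _ v]
      exp_curve(2) one q k(2) c(2) action_one[OF q] by simp
  have "((\<lambda>t. chart_fun (chart_at M q) (id (\<Delta> (?\<gamma> t) q))) has_vector_derivative
      frechet_derivative (coord_rep c (chart_at M q) id) (at (chart_fun c (\<Delta> (?\<gamma> 0) q)))
      (frechet_derivative (coord_rep (prod_chart k c) c (\<lambda>(g, q). \<Delta> g q)) (at (chart_fun k \<one>, chart_fun c q)) (\<xi>, 0))) (at 0)"
    by (rule curve_coord_derivative[OF M smooth_map_id[OF M, unfolded smooth_map_def] c(1)
        smooth_manifold_chart_at(1)[OF M q] continuous_map_orbit_curve[OF exp_curve(1) q] _ _ _ 1])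
      (use exp_curve(2) action_one[OF q] q c(2) smooth_manifold_chart_at(2)[OF M q] in auto)
  moreover have "((\<lambda>t. chart_fun (chart_at M q) (\<Delta> (?\<gamma> t) q)) has_vector_derivative generator \<xi> q) (at 0)"
    using generator_velocity_exp[OF q, of \<xi>] exp_curve(2) action_one[OF q]
    by (simp add: has_velocity0_def comp_def)
  ultimately show "generator \<xi> q = frechet_derivative (coord_rep c (chart_at M q) id) (at (chart_fun c q))
      (frechet_derivative (coord_rep (prod_chart k c) c (\<lambda>(g, q). \<Delta> g q)) (at (chart_fun k \<one>, chart_fun c q)) (\<xi>, 0))"
    using vector_derivative_unique_at exp_curve(2) action_one[OF q] by fastforce
qed

end

section \<open>One-forms in coordinates\<close>

lemma form_coord_eq:
  assumes M: "smooth_manifold M" and c: "c \<in> atlas M" "q \<in> chart_dom c"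
  shows "form_coord M f c (chart_fun c q) v
    = f q (frechet_derivative (coord_rep c (chart_at M q) id) (at (chart_fun c q)) v)"
  using chart_inv_chart_fun[OF smooth_manifold_chart[OF M c(1)] c(2)] by (simp add: form_coord_def Let_def)

lemma linear_form_coord:
  assumes M: "smooth_manifold M" and f: "smooth_one_form M f" and c: "c \<in> atlas M" "q \<in> chart_dom c"
  shows "linear (form_coord M f c (chart_fun c q))"
proof -
  have q: "q \<in> pts M" using chart_dom_subset_pts[OF M c(1)] c(2) by blast
  have "linear (frechet_derivative (coord_rep c (chart_at M q) id) (at (chart_fun c q)))"
    using coord_rep_has_derivative[OF smooth_map_id[OF M, unfolded smooth_map_def] c(1)
        smooth_manifold_chart_at(1)[OF M q] c(2) q] smooth_manifold_chart_at(2)[OF M q]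
    by (simp add: has_derivative_linear)
  moreover have "linear (f q)" using f q by (simp add: smooth_one_form_def)
  ultimately have "linear (f q \<circ> frechet_derivative (coord_rep c (chart_at M q) id) (at (chart_fun c q)))"
    by (rule linear_compose)
  moreover have "form_coord M f c (chart_fun c q)
      = f q \<circ> frechet_derivative (coord_rep c (chart_at M q) id) (at (chart_fun c q))"
    by (rule ext) (simp only: form_coord_eq[OF M c] comp_apply)
  ultimately show ?thesis by simp
qed

lemma form_coord_differentiable:
  assumes f: "smooth_one_form M f" and c: "c \<in> atlas M" "q \<in> chart_dom c"
  shows "(\<lambda>y. form_coord M f c y v) differentiable (at (chart_fun c q))"
proof -
  have "Ck_on (Suc 0) (chart_fun c ` chart_dom c) (\<lambda>y. form_coord M f c y v)"
    using f c(1) unfolding smooth_one_form_def smooth_on_def by blast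
  then show ?thesis using c(2) by simp
qed

section \<open>Invariant one-forms evaluated on a generator\<close>

text \<open>
  Every set of the form {p. P (h p)} is open, hence the level sets are open and closed.
\<close>

lemma locally_constant_on_connected:
  assumes X: "connected_space X"
    and loc: "\<And>p. p \<in> topspace X \<Longrightarrow> \<exists>V. openin X V \<and> p \<in> V \<and> (\<forall>q\<in>V. h q = h p)"
  shows "\<exists>\<mu>. \<forall>p\<in>topspace X. h p = \<mu>"
proof (cases "topspace X = {}")
  case False
  then obtain p0 where p0: "p0 \<in> topspace X" by blast
  have op: "openin X {p \<in> topspace X. P (h p)}" for P
  proof (subst openin_subopen, intro ballI)
    fix p assume "p \<in> {p \<in> topspace X. P (h p)}"
    then have p: "p \<in> topspace X" "P (h p)" by auto
    from loc[OF p(1)] obtain V where V: "openin X V" "p \<in> V" "\<forall>q\<in>V. h q = h p" by blast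
    have "V \<subseteq> {p \<in> topspace X. P (h p)}" using V(3) p(2) openin_subset[OF V(1)] by auto
    with V(1,2) show "\<exists>T. openin X T \<and> p \<in> T \<and> T \<subseteq> {p \<in> topspace X. P (h p)}" by blast
  qed
  have "topspace X - {p \<in> topspace X. h p = h p0} = {p \<in> topspace X. h p \<noteq> h p0}" by auto
  then have "closedin X {p \<in> topspace X. h p = h p0}"
    unfolding closedin_def using op[of "\<lambda>x. x \<noteq> h p0"] by auto
  then have "{p \<in> topspace X. h p = h p0} = {} \<or> {p \<in> topspace X. h p = h p0} = topspace X"
    using X op[of "\<lambda>x. x = h p0"] unfolding connected_space_clopen_in by blast
  then show ?thesis using p0 by blast
qed simp

locale invariant_one_form = smooth_lie_action G MG M \<Delta>
  for G :: "'g monoid" (structure) and MG :: "('g, 'h::banach) manifold"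
    and M :: "('m, 'e::banach) manifold" and \<Delta> +
  fixes f :: "'m \<Rightarrow> 'e \<Rightarrow> real"
  assumes f: "smooth_one_form M f"
    and equivariant: "\<And>g p. g \<in> carrier G \<Longrightarrow> p \<in> pts M \<Longrightarrow> f (\<Delta> g p) = cotangent_lift G M \<Delta> g p (f p)"
begin

text \<open>
  The cotangent lift contains the tangent map of the inverse translation, which cancels the tangent map
  of the translation.
\<close>

lemma form_translation:
  assumes "g \<in> carrier G" "q \<in> pts M"
  shows "f (\<Delta> g q) (mderiv M M (\<Delta> g) q v) = f q v"
  using equivariant[OF assms] mderiv_translation_inv[OF assms] by (simp add: cotangent_lift_def)

text \<open>
  Invariance of f read in a single chart c that contains both q and its translate.  The preferred
  charts at these two points, in which f is given, enter only through changes of charts, which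
  the chain rule absorbs.
\<close>

lemma form_coord_translation:
  assumes a: "a \<in> carrier G" and c: "c \<in> atlas M" and q: "q \<in> chart_dom c" and aq: "\<Delta> a q \<in> chart_dom c"
  shows "form_coord M f c (chart_fun c (\<Delta> a q))
      (frechet_derivative (coord_rep c c (\<Delta> a)) (at (chart_fun c q)) v)
    = form_coord M f c (chart_fun c q) v"
proof -
  let ?q' = "\<Delta> a q"
  have qM: "q \<in> pts M" "?q' \<in> pts M" using chart_dom_subset_pts[OF M c] q aq by auto
  note cq = smooth_manifold_chart_at[OF M qM(1)] and cq' = smooth_manifold_chart_at[OF M qM(2)]
  note sid = smooth_map_id[OF M, unfolded smooth_map_def]
    and sa = smooth_translation[OF a, unfolded smooth_map_def]
  define u where "u = frechet_derivative (coord_rep c (chart_at M q) id) (at (chart_fun c q)) v"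
  have "frechet_derivative (coord_rep c (chart_at M ?q') id) (at (chart_fun c ?q'))
      (frechet_derivative (coord_rep c c (\<Delta> a)) (at (chart_fun c q)) v)
    = frechet_derivative (coord_rep c (chart_at M ?q') (id \<circ> \<Delta> a)) (at (chart_fun c q)) v"
    using coord_derivative_compose[OF M M sa sid c c cq'(1) qM(1) q qM(2) aq] cq'(2)
    by (simp add: fun_eq_iff)
  also have "\<dots> = frechet_derivative (coord_rep c (chart_at M ?q') (\<Delta> a \<circ> id)) (at (chart_fun c q)) v"
    by (simp only: id_comp comp_id)
  also have "\<dots> = mderiv M M (\<Delta> a) q u"
    unfolding mderiv_def u_def
    using coord_derivative_compose[OF M M sid sa c cq(1) cq'(1) qM(1) q, of] qM cq(2) cq'(2)
    by (simp add: fun_eq_iff del: comp_id id_comp)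
  finally have "form_coord M f c (chart_fun c ?q')
      (frechet_derivative (coord_rep c c (\<Delta> a)) (at (chart_fun c q)) v) = f ?q' (mderiv M M (\<Delta> a) q u)"
    by (simp only: form_coord_eq[OF M c aq])
  also have "\<dots> = f q u" by (rule form_translation[OF a qM(1)])
  also have "\<dots> = form_coord M f c (chart_fun c q) v"
    by (simp only: u_def form_coord_eq[OF M c q])
  finally show ?thesis .
qed

text \<open>
  This is d(f(\<xi>_M)) = L_\<xi> f - df(\<xi>_M, _) = 0 in the preferred chart c at p.  Write \<Psi>(x, y) for the action
  in coordinates, \<alpha>(y) for the coordinate expression of f and Y(y) for that of the
  generator, so that Y(y) = D \<Psi>(z, y) (\<xi>, 0), where z are the coordinates of the identity.
  Differentiating the invariance
    \<alpha>(\<Psi>(x, y0)) (D \<Psi>(x, y0) (0, v)) = \<alpha>(y0) v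
  with respect to x in the direction \<xi> at x = z gives
    (D_Y \<alpha>)(v) + \<alpha>(y0) (D_\<xi> D_v \<Psi>) = 0,
  while the derivative of \<alpha>(y)(Y(y)) in the direction v is
    (D_v \<alpha>)(Y) + \<alpha>(y0) (D_v D_\<xi> \<Psi>).
  The second-order terms agree, and (D_Y \<alpha>)(v) - (D_v \<alpha>)(Y) = df(Y, v) vanishes.
\<close>

lemma form_generator_derivative:
  assumes p: "p \<in> pts M"
    and hor: "\<And>v. ext_deriv M f p (generator \<xi> p) v = 0"
  shows "((\<lambda>q. f q (generator \<xi> q)) \<circ> chart_inv (chart_at M p) has_derivative (\<lambda>_. 0))
    (at (chart_fun (chart_at M p) p))"
proof -
  define k where "k = chart_at MG \<one>"
  define c where "c = chart_at M p"
  define z where "z = chart_fun k \<one>"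
  define y0 where "y0 = chart_fun c p"
  have one: "\<one> \<in> pts MG" using carrier one_closed by simp
  have k: "k \<in> atlas MG" "\<one> \<in> chart_dom k"
    unfolding k_def using smooth_manifold_chart_at[OF MG one] by auto
  have c: "c \<in> atlas M" "p \<in> chart_dom c"
    unfolding c_def using smooth_manifold_chart_at[OF M p] by auto
  note kk = smooth_manifold_chart[OF MG k(1)] and cc = smooth_manifold_chart[OF M c(1)]
  have domM: "q \<in> pts M" if "q \<in> chart_dom c" for q using chart_dom_subset_pts[OF M c(1)] that by blast
  have domG: "a \<in> carrier G" if "a \<in> chart_dom k" for a
    using chart_dom_subset_pts[OF MG k(1)] that carrier by blast
  define \<Theta> where "\<Theta> = (\<lambda>(g, q). \<Delta> g q)"
  define \<Psi> where "\<Psi> = coord_rep (prod_chart k c) c \<Theta>"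
  define D where "D x = frechet_derivative \<Psi> (at x)" for x
  define W where "W = chart_fun (prod_chart k c) ` {x \<in> chart_dom (prod_chart k c) \<inter> pts (MG \<times>\<^sub>M M). \<Theta> x \<in> chart_dom c}"
  have act: "smooth_map_on (pts (MG \<times>\<^sub>M M)) (MG \<times>\<^sub>M M) M \<Theta>"
    using action_map by (simp add: smooth_map_def \<Theta>_def)
  have openW: "open W"
    unfolding W_def
    by (rule open_coord_domain[OF smooth_manifold_prod[OF MG M] M act prod_chart_in_atlas[OF k(1) c(1)] c(1)])
  have Ck: "Ck_on n W \<Psi>" for n
    unfolding W_def \<Psi>_def by (rule coord_rep_Ck[OF act prod_chart_in_atlas[OF k(1) c(1)] c(1)])
  have WI: "(chart_fun k a, chart_fun c q) \<in> W"
    if "a \<in> chart_dom k" "q \<in> chart_dom c" "\<Delta> a q \<in> chart_dom c" for a q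
    unfolding W_def using that domM domG carrier
    by (intro image_eqI[of _ _ "(a, q)"]) (auto simp: \<Theta>_def)
  have \<Psi>eq: "\<Psi> (chart_fun k a, chart_fun c q) = chart_fun c (\<Delta> a q)"
    if "a \<in> chart_dom k" "q \<in> chart_dom c" for a q
    unfolding \<Psi>_def using chart_inv_prod[OF kk cc that] by (simp add: \<Theta>_def)
  have \<Psi>diff: "\<Psi> differentiable (at x)" if "x \<in> W" for x
    using Ck[of 1] that by simp
  have \<Psi>der: "(\<Psi> has_derivative D x) (at x)" if "x \<in> W" for x
    using \<Psi>diff[OF that] unfolding D_def frechet_derivative_works .
  have D2diff: "((\<lambda>x. D x w) has_derivative frechet_derivative (\<lambda>x. D x w) (at x)) (at x)" if "x \<in> W" for x w
    using Ck[of "Suc (Suc 0)"] that unfolding D_def frechet_derivative_works[symmetric] by (cases w) simp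
  have base: "(z, chart_fun c q) \<in> W" if "q \<in> chart_dom c" for q
    using WI[OF k(2) that] action_one[OF domM[OF that]] that by (simp add: z_def)
  have base0: "(z, y0) \<in> W" using base[OF c(2)] by (simp add: y0_def)
  define \<alpha> where "\<alpha> = form_coord M f c"
  have \<alpha>lin: "linear (\<alpha> (chart_fun c q))" if "q \<in> chart_dom c" for q
    unfolding \<alpha>_def by (rule linear_form_coord[OF M f c(1) that])
  have \<alpha>diff: "((\<lambda>y. \<alpha> y v) has_derivative frechet_derivative (\<lambda>y. \<alpha> y v) (at y0)) (at y0)" for v
    using form_coord_differentiable[OF f c] unfolding \<alpha>_def y0_def frechet_derivative_works .
  obtain B :: "'e set" where B: "finite B" "span B = UNIV"
    using M unfolding smooth_manifold_def by blast
  define Y where "Y y = D (z, y) (\<xi>, 0)" for y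
  have gen: "f q (generator \<xi> q) = \<alpha> (chart_fun c q) (Y (chart_fun c q))" if "q \<in> chart_dom c" for q
    unfolding generator_coord[OF c(1) that] \<alpha>_def form_coord_eq[OF M c(1) that]
    by (simp only: Y_def D_def \<Psi>_def \<Theta>_def z_def k_def)
  have Yp: "generator \<xi> p = Y y0"
    unfolding generator_coord[OF c]
    using coord_derivative_id[OF M c] by (simp only: Y_def D_def \<Psi>_def \<Theta>_def z_def k_def c_def y0_def)

  have dom_ev: "\<forall>\<^sub>F y in nhds y0. \<exists>q\<in>chart_dom c. y = chart_fun c q"
    unfolding y0_def
    using eventually_chart_inv[OF cc openin_topspace c(2)] p
    by (auto elim!: eventually_mono) metis

  \<comment> \<open>The invariance identity at the coordinates of a group element a near the identity.\<close>
  have invariance: "\<alpha> (\<Psi> (chart_fun k a, y0)) (D (chart_fun k a, y0) (0, v)) = \<alpha> y0 v"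
    if a: "a \<in> chart_dom k" "\<Delta> a p \<in> chart_dom c" for a v
  proof -
    have w: "(chart_fun k a, chart_fun c p) \<in> W" by (rule WI[OF a(1) c(2) a(2)])
    have "((\<lambda>y. \<Psi> (chart_fun k a, y)) has_derivative (\<lambda>v. D (chart_fun k a, y0) (0, v))) (at y0)"
      unfolding y0_def
      by (rule has_derivative_compose[OF has_derivative_Pair[OF has_derivative_const has_derivative_ident] \<Psi>der[OF w]])
    moreover have "\<forall>\<^sub>F y in nhds y0. \<Psi> (chart_fun k a, y) = coord_rep c c (\<Delta> a) y"
      using dom_ev by eventually_elim (use \<Psi>eq[OF a(1)] chart_inv_chart_fun[OF cc] in auto)
    ultimately have "(coord_rep c c (\<Delta> a) has_derivative (\<lambda>v. D (chart_fun k a, y0) (0, v))) (at y0)"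
      by (rule has_derivative_eventually_eq)
    from fun_cong[OF frechet_derivative_at[OF this], of v] show ?thesis
      using form_coord_translation[OF domG[OF a(1)] c a(2), of v] \<Psi>eq[OF a(1) c(2)]
      by (simp only: \<alpha>_def y0_def)
  qed

  \<comment> \<open>Any curve in G with velocity \<xi> at the identity serves to differentiate the invariance
    identity; a straight line in the chart is the simplest one.\<close>
  define \<sigma> where "\<sigma> t = (z + t *\<^sub>R \<xi>, y0)" for t :: real
  have \<sigma>: "(\<sigma> has_derivative (\<lambda>h. (h *\<^sub>R \<xi>, 0))) (at 0)"
    unfolding \<sigma>_def by (auto intro!: derivative_eq_intros)
  have \<sigma>0: "\<sigma> 0 = (z, y0)" by (simp add: \<sigma>_def)
  have "isCont \<sigma> 0" using has_derivative_continuous[OF \<sigma>] .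
  then have "(\<sigma> \<longlongrightarrow> (z, y0)) (nhds 0)" using isCont_tendsto_nhds[of 0 \<sigma>] \<sigma>0 by simp
  then have "\<forall>\<^sub>F t in nhds 0. \<sigma> t \<in> W" by (rule topological_tendstoD[OF _ openW base0])
  then have \<sigma>W: "\<forall>\<^sub>F t in nhds 0. \<exists>a. a \<in> chart_dom k \<and> \<Delta> a p \<in> chart_dom c \<and> \<sigma> t = (chart_fun k a, y0)"
  proof eventually_elim
    case (elim t)
    then obtain a q where aq: "\<sigma> t = (chart_fun k a, chart_fun c q)" "a \<in> chart_dom k" "q \<in> chart_dom c" "\<Delta> a q \<in> chart_dom c"
      unfolding W_def \<Theta>_def by auto
    have "chart_fun c q = chart_fun c p" using aq(1) by (simp add: \<sigma>_def y0_def)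
    then have "q = p" using inj_onD[OF is_chart_inj_on[OF cc]] aq(3) c(2) by blast
    then show ?case using aq by (auto simp: y0_def)
  qed

  have \<Psi>base: "\<Psi> (z, y0) = y0"
    using \<Psi>eq[OF k(2) c(2)] action_one[OF p] by (simp add: z_def y0_def)
  have Dbase: "D (z, y0) (0, v) = v" for v
  proof -
    have "((\<lambda>y. \<Psi> (z, y)) has_derivative (\<lambda>v. D (z, y0) (0, v))) (at y0)"
      by (rule has_derivative_compose[OF has_derivative_Pair[OF has_derivative_const has_derivative_ident] \<Psi>der[OF base0]])
    moreover have "\<forall>\<^sub>F y in nhds y0. \<Psi> (z, y) = y"
      using dom_ev by eventually_elim (use \<Psi>eq[OF k(2)] action_one domM in \<open>auto simp: z_def\<close>)
    ultimately have "((\<lambda>y. y) has_derivative (\<lambda>v. D (z, y0) (0, v))) (at y0)"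
      by (rule has_derivative_eventually_eq)
    from fun_cong[OF has_derivative_unique[OF this has_derivative_ident], of v] show ?thesis .
  qed

  have along: "frechet_derivative (\<lambda>y. \<alpha> y v) (at y0) (Y y0)
      + \<alpha> y0 (frechet_derivative (\<lambda>x. D x (0, v)) (at (z, y0)) (\<xi>, 0)) = 0" for v
  proof -
    let ?D2 = "frechet_derivative (\<lambda>x. D x (0, v)) (at (z, y0))"
    have \<Psi>\<sigma>: "((\<lambda>t. \<Psi> (\<sigma> t)) has_derivative (\<lambda>h. D (z, y0) (h *\<^sub>R \<xi>, 0))) (at 0)"
      by (rule has_derivative_compose[OF \<sigma>]) (simp only: \<sigma>0 \<Psi>der[OF base0])
    have \<alpha>\<Psi>: "((\<lambda>t. \<alpha> (\<Psi> (\<sigma> t)) u) has_derivative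
        (\<lambda>h. frechet_derivative (\<lambda>y. \<alpha> y u) (at y0) (D (z, y0) (h *\<^sub>R \<xi>, 0)))) (at 0)" for u
      by (rule has_derivative_compose[OF \<Psi>\<sigma>]) (simp only: \<sigma>0 \<Psi>base \<alpha>diff)
    have w: "((\<lambda>t. D (\<sigma> t) (0, v)) has_derivative (\<lambda>h. ?D2 (h *\<^sub>R \<xi>, 0))) (at 0)"
      by (rule has_derivative_compose[OF \<sigma>]) (simp only: \<sigma>0 D2diff[OF base0])
    have "((\<lambda>t. \<alpha> (\<Psi> (\<sigma> t)) (D (\<sigma> t) (0, v))) has_derivative
        (\<lambda>h. frechet_derivative (\<lambda>t. \<alpha> (\<Psi> (\<sigma> t)) (D (\<sigma> 0) (0, v))) (at 0) h
           + \<alpha> (\<Psi> (\<sigma> 0)) (?D2 (h *\<^sub>R \<xi>, 0)))) (at 0)"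
    proof (rule has_derivative_family_apply[OF B _ _ w])
      show "\<forall>\<^sub>F t in nhds 0. linear (\<alpha> (\<Psi> (\<sigma> t)))"
        using \<sigma>W by eventually_elim (use \<alpha>lin \<Psi>eq c(2) in \<open>auto simp: y0_def\<close>)
      show "(\<lambda>t. \<alpha> (\<Psi> (\<sigma> t)) u) differentiable (at 0)" for u
        using \<alpha>\<Psi> by (rule differentiableI)
    qed
    moreover have "\<forall>\<^sub>F t in nhds 0. \<alpha> (\<Psi> (\<sigma> t)) (D (\<sigma> t) (0, v)) = \<alpha> y0 v"
      using \<sigma>W by eventually_elim (use invariance in auto)
    ultimately have "((\<lambda>t. \<alpha> y0 v) has_derivative
        (\<lambda>h. frechet_derivative (\<lambda>t. \<alpha> (\<Psi> (\<sigma> t)) (D (\<sigma> 0) (0, v))) (at 0) h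
           + \<alpha> (\<Psi> (\<sigma> 0)) (?D2 (h *\<^sub>R \<xi>, 0)))) (at (0::real))"
      by (rule has_derivative_eventually_eq)
    from fun_cong[OF has_derivative_unique[OF this has_derivative_const], of 1]
    show ?thesis
      by (simp add: \<sigma>0 Dbase \<Psi>base frechet_derivative_at[OF \<alpha>\<Psi>, symmetric] Y_def)
  qed

  have across: "((\<lambda>y. \<alpha> y (Y y)) has_derivative
      (\<lambda>v. frechet_derivative (\<lambda>y. \<alpha> y (Y y0)) (at y0) v
         + \<alpha> y0 (frechet_derivative (\<lambda>x. D x (\<xi>, 0)) (at (z, y0)) (0, v)))) (at y0)"
  proof (rule has_derivative_family_apply[OF B])
    show "\<forall>\<^sub>F y in nhds y0. linear (\<alpha> y)" using dom_ev by eventually_elim (use \<alpha>lin in auto)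
    show "(\<lambda>y. \<alpha> y v) differentiable (at y0)" for v using \<alpha>diff by (rule differentiableI)
    show "(Y has_derivative (\<lambda>v. frechet_derivative (\<lambda>x. D x (\<xi>, 0)) (at (z, y0)) (0, v))) (at y0)"
      unfolding Y_def[abs_def]
      by (rule has_derivative_compose[OF has_derivative_Pair[OF has_derivative_const has_derivative_ident] D2diff[OF base0]])
  qed

  \<comment> \<open>Composing with the covector \<alpha>(y0) reduces the exchange of derivatives to a real function.\<close>
  have mixed: "\<alpha> y0 (frechet_derivative (\<lambda>x. D x (\<xi>, 0)) (at (z, y0)) (0, v))
      = \<alpha> y0 (frechet_derivative (\<lambda>x. D x (0, v)) (at (z, y0)) (\<xi>, 0))" for v
  proof -
    have bl: "bounded_linear (\<alpha> y0)"
      using finite_dim_linear_bounded[OF B \<alpha>lin[OF c(2)]] by (simp add: y0_def)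
    have der: "((\<lambda>x. \<alpha> y0 (\<Psi> x)) has_derivative (\<lambda>u. \<alpha> y0 (D x u))) (at x)" if "x \<in> W" for x
      by (rule bounded_linear.has_derivative[OF bl \<Psi>der[OF that]])
    have second: "((\<lambda>x. frechet_derivative (\<lambda>x. \<alpha> y0 (\<Psi> x)) (at x) w) has_derivative
        (\<lambda>u. \<alpha> y0 (frechet_derivative (\<lambda>x. D x w) (at (z, y0)) u))) (at (z, y0))" for w
    proof (rule has_derivative_eventually_eq)
      show "((\<lambda>x. \<alpha> y0 (D x w)) has_derivative
          (\<lambda>u. \<alpha> y0 (frechet_derivative (\<lambda>x. D x w) (at (z, y0)) u))) (at (z, y0))"
        by (rule bounded_linear.has_derivative[OF bl D2diff[OF base0]])
      show "\<forall>\<^sub>F x in nhds (z, y0). \<alpha> y0 (D x w) = frechet_derivative (\<lambda>x. \<alpha> y0 (\<Psi> x)) (at x) w"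
        using eventually_nhds_in_open[OF openW base0]
        by eventually_elim (rule fun_cong[OF frechet_derivative_at[OF der]])
    qed
    show ?thesis
      by (rule mixed_derivatives_commute[OF openW base0 differentiableI[OF der] second second])
  qed

  have "frechet_derivative (\<lambda>y. \<alpha> y v) (at y0) (Y y0) = frechet_derivative (\<lambda>y. \<alpha> y (Y y0)) (at y0) v" for v
    using hor[of v] unfolding ext_deriv_def Let_def Yp
    by (simp add: \<alpha>_def c_def[symmetric] y0_def[symmetric])
  then have "((\<lambda>y. \<alpha> y (Y y)) has_derivative (\<lambda>_. 0)) (at y0)"
    using across along by (simp add: mixed)
  moreover have "\<forall>\<^sub>F y in nhds y0. \<alpha> y (Y y) = ((\<lambda>q. f q (generator \<xi> q)) \<circ> chart_inv c) y"
    using dom_ev by eventually_elim (use gen chart_inv_chart_fun[OF cc] in auto)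
  ultimately have "((\<lambda>q. f q (generator \<xi> q)) \<circ> chart_inv c has_derivative (\<lambda>_. 0)) (at y0)"
    by (rule has_derivative_eventually_eq)
  then show ?thesis by (simp only: c_def y0_def)
qed

text \<open>
  The derivative at each point is known in the preferred chart at that point.  A change of charts
  transports the statement to one chart around p, where a vanishing derivative on a ball
  makes the function constant there.
\<close>

lemma form_generator_constant:
  assumes conn: "connected_space (mtop M)"
    and hor: "\<And>p v. p \<in> pts M \<Longrightarrow> ext_deriv M f p (generator \<xi> p) v = 0"
  shows "\<exists>\<mu>. \<forall>p\<in>pts M. f p (generator \<xi> p) = \<mu>"
proof (rule locally_constant_on_connected[OF conn])
  fix p assume p: "p \<in> pts M"
  let ?h = "\<lambda>q. f q (generator \<xi> q)"
  define c where "c = chart_at M p"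
  have c: "c \<in> atlas M" "p \<in> chart_dom c"
    unfolding c_def using smooth_manifold_chart_at[OF M p] by auto
  note cc = smooth_manifold_chart[OF M c(1)]
  have der: "(?h \<circ> chart_inv c has_derivative (\<lambda>_. 0)) (at (chart_fun c q))" if q: "q \<in> chart_dom c" for q
  proof -
    have qM: "q \<in> pts M" using chart_dom_subset_pts[OF M c(1)] q by blast
    let ?d = "chart_at M q"
    note d = smooth_manifold_chart_at[OF M qM]
    note dd = smooth_manifold_chart[OF M d(1)]
    have inv: "chart_inv c (chart_fun c q) = q" by (rule chart_inv_chart_fun[OF cc q])
    have "(coord_rep c ?d id has_derivative frechet_derivative (coord_rep c ?d id) (at (chart_fun c q))) (at (chart_fun c q))"
      by (rule coord_rep_has_derivative[OF smooth_map_id[OF M, unfolded smooth_map_def] c(1) d(1) q qM])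
        (simp add: d(2))
    moreover have "(?h \<circ> chart_inv ?d has_derivative (\<lambda>_. 0)) (at (coord_rep c ?d id (chart_fun c q)))"
      using form_generator_derivative[OF qM hor[OF qM]] by (simp add: inv)
    ultimately have "((\<lambda>x. (?h \<circ> chart_inv ?d) (coord_rep c ?d id x)) has_derivative (\<lambda>_. 0)) (at (chart_fun c q))"
      by (rule has_derivative_compose)
    moreover have "\<forall>\<^sub>F x in nhds (chart_fun c q). (?h \<circ> chart_inv ?d) (coord_rep c ?d id x) = (?h \<circ> chart_inv c) x"
    proof -
      have "openin (mtop M) (chart_dom ?d)" using dd by (simp add: is_chart_def)
      from eventually_chart_inv[OF cc this q d(2)] show ?thesis
        by eventually_elim (simp add: chart_inv_chart_fun[OF dd])
    qed
    ultimately show ?thesis by (rule has_derivative_eventually_eq)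
  qed
  have "open (chart_fun c ` chart_dom c)" using cc by (simp add: is_chart_def)
  then obtain r where r: "r > 0" "ball (chart_fun c p) r \<subseteq> chart_fun c ` chart_dom c"
    using c(2) open_contains_ball by blast
  let ?V = "{q \<in> chart_dom c. chart_fun c q \<in> ball (chart_fun c p) r}"
  have const: "(?h \<circ> chart_inv c) x = (?h \<circ> chart_inv c) (chart_fun c p)" if x: "x \<in> ball (chart_fun c p) r" for x
  proof (rule has_derivative_zero_unique[OF convex_ball _ x])
    show "(?h \<circ> chart_inv c has_derivative (\<lambda>_. 0)) (at y within ball (chart_fun c p) r)"
      if y: "y \<in> ball (chart_fun c p) r" for y
    proof -
      from y r(2) obtain q where "q \<in> chart_dom c" "y = chart_fun c q" by blast
      then show ?thesis using der[of q] by (auto intro: has_derivative_at_withinI)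
    qed
  qed (use r(1) in simp)
  have "?h q = ?h p" if "q \<in> ?V" for q
    using const[of "chart_fun c q"] that chart_inv_chart_fun[OF cc] c(2) by simp
  moreover have "openin (mtop M) ?V" by (rule openin_chart_preimage[OF cc open_ball])
  moreover have "p \<in> ?V" using c(2) r(1) by simp
  ultimately show "\<exists>V. openin (mtop M) V \<and> p \<in> V \<and> (\<forall>q\<in>V. ?h q = ?h p)" by blast
qed

end

section \<open>The diagonal action\<close>

lemma group_action_diag:
  assumes "group_action G E \<Phi>"
  shows "group_action G (E \<times> E) (diag_action E \<Phi>)"
proof -
  interpret group_action G E \<Phi> by fact
  interpret G: group G using group_hom group_hom.axioms(1) by blast
  have closed: "\<Phi> g q \<in> E" if "g \<in> carrier G" "q \<in> E" for g q
    using element_image that by blast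
  have inverse: "\<Phi> (inv\<^bsub>G\<^esub> g) (\<Phi> g q) = q" if "g \<in> carrier G" "q \<in> E" for g q
    using orbit_sym_aux that by blast
  have bij: "diag_action E \<Phi> g \<in> Bij (E \<times> E)" if g: "g \<in> carrier G" for g
  proof -
    have "bij_betw (diag_action E \<Phi> g) (E \<times> E) (E \<times> E)"
    proof (rule bij_betw_byWitness[where f' = "diag_action E \<Phi> (inv\<^bsub>G\<^esub> g)"])
      show "\<forall>x\<in>E \<times> E. diag_action E \<Phi> (inv\<^bsub>G\<^esub> g) (diag_action E \<Phi> g x) = x"
        using g closed inverse by (auto simp: diag_action_def)
      show "\<forall>x\<in>E \<times> E. diag_action E \<Phi> g (diag_action E \<Phi> (inv\<^bsub>G\<^esub> g) x) = x"
        using G.inv_closed[OF g] closed[OF G.inv_closed[OF g]] inverse[OF G.inv_closed[OF g]] g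
        by (auto simp: diag_action_def)
    qed (use g closed in \<open>auto simp: diag_action_def\<close>)
    then show ?thesis by (simp add: Bij_def diag_action_def)
  qed
  show ?thesis
  proof (intro group_action.intro group_hom.intro group_hom_axioms.intro homI)
    show "group G" by (rule G.is_group)
    show "group (BijGroup (E \<times> E))" by (rule group_BijGroup)
    show "diag_action E \<Phi> g \<in> carrier (BijGroup (E \<times> E))" if "g \<in> carrier G" for g
      using bij[OF that] by (simp add: BijGroup_def)
    show "diag_action E \<Phi> (g \<otimes>\<^bsub>G\<^esub> h) = diag_action E \<Phi> g \<otimes>\<^bsub>BijGroup (E \<times> E)\<^esub> diag_action E \<Phi> h"
      if g: "g \<in> carrier G" and h: "h \<in> carrier G" for g h
      using bij[OF g] bij[OF h] closed[OF h] composition_rule[OF _ g h]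
      by (auto simp: BijGroup_def diag_action_def compose_def fun_eq_iff restrict_def)
  qed
qed

text \<open>
  Each component of the diagonal action is the given action after a projection of G \<times> Q \<times> Q onto
  G \<times> Q, which is linear in product charts.
\<close>

lemma smooth_action_diag:
  fixes MG :: "('g, 'h::banach) manifold" and Q :: "('q, 'e::banach) manifold"
  assumes lie: "lie_group G MG" and Q: "smooth_manifold Q" and act: "smooth_action G MG Q \<Phi>"
  shows "smooth_action G MG (Q \<times>\<^sub>M Q) (diag_action (pts Q) \<Phi>)"
proof -
  have MG: "smooth_manifold MG" using lie by (simp add: lie_group_def)
  note QQ = smooth_manifold_prod[OF Q Q]
  have \<Theta>: "smooth_map (MG \<times>\<^sub>M Q) Q (\<lambda>(g, q). \<Phi> g q)" using act by (simp add: smooth_action_def)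
  have aff: "\<exists>c'\<in>atlas (MG \<times>\<^sub>M Q). \<exists>A A'. (\<forall>x. (A has_derivative A') (at x))
      \<and> (\<forall>p\<in>chart_dom c. (fst p, \<rho> (snd p)) \<in> chart_dom c' \<and> chart_fun c' (fst p, \<rho> (snd p)) = A (chart_fun c p))"
    if c: "c \<in> atlas (MG \<times>\<^sub>M Q \<times>\<^sub>M Q)" and \<rho>: "\<rho> = fst \<or> \<rho> = snd" for c and \<rho> :: "'q \<times> 'q \<Rightarrow> 'q"
  proof -
    from c obtain k d where d: "c = prod_chart k d" "k \<in> atlas MG" "d \<in> atlas (Q \<times>\<^sub>M Q)" by (rule atlas_prodE)
    from d(3) obtain d0 d1 where d01: "d = prod_chart d0 d1" "d0 \<in> atlas Q" "d1 \<in> atlas Q" by (rule atlas_prodE)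
    from \<rho> show ?thesis
    proof
      assume "\<rho> = fst"
      moreover have "((\<lambda>x. (fst x, fst (snd x))) has_derivative (\<lambda>x. (fst x, fst (snd x)))) (at x)" for x :: "'h \<times> 'e \<times> 'e"
        by (auto intro!: derivative_eq_intros)
      ultimately show ?thesis using d d01 prod_chart_in_atlas[OF d(2) d01(2)]
        by (intro bexI[of _ "prod_chart k d0"] exI[of _ "\<lambda>x. (fst x, fst (snd x))"]) auto
    next
      assume "\<rho> = snd"
      moreover have "((\<lambda>x. (fst x, snd (snd x))) has_derivative (\<lambda>x. (fst x, snd (snd x)))) (at x)" for x :: "'h \<times> 'e \<times> 'e"
        by (auto intro!: derivative_eq_intros)
      ultimately show ?thesis using d d01 prod_chart_in_atlas[OF d(2) d01(3)]
        by (intro bexI[of _ "prod_chart k d1"] exI[of _ "\<lambda>x. (fst x, snd (snd x))"]) auto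
    qed
  qed
  have component: "smooth_map (MG \<times>\<^sub>M Q \<times>\<^sub>M Q) Q (\<lambda>p. (\<lambda>(g, q). \<Phi> g q) (fst p, \<rho> (snd p)))"
    if \<rho>: "\<rho> = fst \<or> \<rho> = snd" for \<rho>
  proof (rule smooth_map_affine_precompose[OF smooth_manifold_prod[OF MG QQ] smooth_manifold_prod[OF MG Q] Q \<Theta> _ aff[OF _ \<rho>]])
    show "continuous_map (mtop (MG \<times>\<^sub>M Q \<times>\<^sub>M Q)) (mtop (MG \<times>\<^sub>M Q)) (\<lambda>p. (fst p, \<rho> (snd p)))"
      using \<rho> continuous_map_compose[OF continuous_map_snd continuous_map_fst, of "mtop MG" "mtop Q" "mtop Q"]
        continuous_map_compose[OF continuous_map_snd continuous_map_snd, of "mtop MG" "mtop Q" "mtop Q"]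
      by (auto simp: continuous_map_paired continuous_map_fst comp_def)
  qed
  have "smooth_map (MG \<times>\<^sub>M Q \<times>\<^sub>M Q) (Q \<times>\<^sub>M Q) (\<lambda>(g, p). diag_action (pts Q) \<Phi> g p)"
  proof (rule smooth_map_cong[OF smooth_manifold_prod[OF MG QQ] QQ])
    show "smooth_map (MG \<times>\<^sub>M Q \<times>\<^sub>M Q) (Q \<times>\<^sub>M Q)
        (\<lambda>p. ((\<lambda>(g, q). \<Phi> g q) (fst p, fst (snd p)), (\<lambda>(g, q). \<Phi> g q) (fst p, snd (snd p))))"
      by (rule smooth_map_Pair[OF smooth_manifold_prod[OF MG QQ] Q Q component component]) simp_all
  qed (auto simp: diag_action_def)
  moreover have "group_action G (pts (Q \<times>\<^sub>M Q)) (diag_action (pts Q) \<Phi>)"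
    using group_action_diag[of G "pts Q" \<Phi>] act by (simp add: smooth_action_def)
  ultimately show ?thesis by (simp add: smooth_action_def)
qed

section \<open>Evolution of the forced discrete momentum maps\<close>

theorem proposition4p4:
  fixes Q :: "('q, 'e::banach) manifold"
    and L :: "'q \<times> 'q \<Rightarrow> real"
    and f :: "'q \<times> 'q \<Rightarrow> 'e \<times> 'e \<Rightarrow> real"
    and G :: "'g monoid"
    and MG :: "('g, 'h::banach) manifold"
    and \<Phi> :: "'g \<Rightarrow> 'q \<Rightarrow> 'q"
    and B :: "('q set, 'b::banach) manifold"
    and R :: "(('q \<times> 'q) set, 'r::banach) manifold"
    and \<xi> :: 'h
  assumes "fdms Q L f"
    and "symmetry_group G MG Q \<Phi> B L f"
    and "connected_space (mtop Q)"
    \<comment> \<open>R is the orbit space of the diagonal action with its quotient smooth structure\<close>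
    and "principal_bundle G MG (Q \<times>\<^sub>M Q) (diag_action (pts Q) \<Phi>) R"
    and "horizontal_two_form (Q \<times>\<^sub>M Q) R (orbit G (diag_action (pts Q) \<Phi>))
           (ext_deriv (Q \<times>\<^sub>M Q) f)"
  shows "\<exists>\<mu>::real. \<forall>q0 q1 q2. trajectory Q L f q0 q1 q2 \<longrightarrow>
           J_plus G MG Q \<Phi> L f \<xi> q1 q2 = J_plus G MG Q \<Phi> L f \<xi> q0 q1 + \<mu> \<and>
           J_minus G MG Q \<Phi> L f \<xi> q1 q2 = J_minus G MG Q \<Phi> L f \<xi> q0 q1 + \<mu>"
proof -
  let ?M = "Q \<times>\<^sub>M Q" and ?\<Delta> = "diag_action (pts Q) \<Phi>" and ?X = "inf_generator G MG Q \<Phi> \<xi>"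
  have Q: "smooth_manifold Q" and L: "smooth_map ?M real_line L" and f: "smooth_one_form ?M f"
    using assms(1) by (simp_all add: fdms_def)
  have lie: "lie_group G MG" and act: "smooth_action G MG Q \<Phi>"
    and invL: "\<And>g p. g \<in> carrier G \<Longrightarrow> p \<in> pts ?M \<Longrightarrow> L (?\<Delta> g p) = L p"
    and invf: "\<And>g p. g \<in> carrier G \<Longrightarrow> p \<in> pts ?M \<Longrightarrow> f (?\<Delta> g p) = cotangent_lift G ?M ?\<Delta> g p (f p)"
    using assms(2) unfolding symmetry_group_def Let_def by blast+
  have R: "smooth_manifold R" and orb: "smooth_map ?M R (orbit G ?\<Delta>)"
    using assms(4) by (simp_all add: principal_bundle_def)
  note M = smooth_manifold_prod[OF Q Q]
  interpret A: smooth_lie_action G MG Q \<Phi>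
    by unfold_locales (rule lie Q act)+
  interpret I: invariant_one_form G MG ?M ?\<Delta> f
    by unfold_locales (rule lie M smooth_action_diag[OF lie Q act] f invf; assumption?)+
  have gen: "I.generator \<xi> (q0, q1) = (?X q0, ?X q1)" if "q0 \<in> pts Q" "q1 \<in> pts Q" for q0 q1
  proof -
    have "has_velocity0 ?M (\<lambda>t. (\<Phi> (lie_exp G MG (t *\<^sub>R \<xi>)) q0, \<Phi> (lie_exp G MG (t *\<^sub>R \<xi>)) q1)) (?X q0, ?X q1)"
      using A.generator_velocity_exp that by (intro has_velocity0_Pair) (simp_all add: A.inf_generator_eq)
    moreover have "has_velocity0 ?M (\<lambda>t. ?\<Delta> (lie_exp G MG (t *\<^sub>R \<xi>)) (q0, q1)) (I.generator \<xi> (q0, q1))"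
      using that by (intro I.generator_velocity_exp) simp
    then have "has_velocity0 ?M (\<lambda>t. (\<Phi> (lie_exp G MG (t *\<^sub>R \<xi>)) q0, \<Phi> (lie_exp G MG (t *\<^sub>R \<xi>)) q1)) (I.generator \<xi> (q0, q1))"
      using that by (simp add: diag_action_def)
    ultimately show ?thesis using has_velocity0_unique by blast
  qed
  have hor: "ext_deriv ?M f p (I.generator \<xi> p) v = 0" if p: "p \<in> pts ?M" for p v
  proof -
    have "mderiv ?M R (orbit G ?\<Delta>) p (I.generator \<xi> p) = 0"
      by (rule I.generator_vertical[OF R orb p I.orbit_action[OF _ p]])
    then show ?thesis using assms(5) p unfolding horizontal_two_form_def by blast
  qed
  have "connected_space (mtop ?M)" using assms(3) by (simp add: connected_space_prod_topology)
  then obtain \<mu> where \<mu>: "\<And>p. p \<in> pts ?M \<Longrightarrow> f p (I.generator \<xi> p) = \<mu>"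
    using I.form_generator_constant[OF _ hor] by blast
  have dL: "D1 Q L q0 q1 (?X q0) + D2 Q L q0 q1 (?X q1) = 0" if q: "q0 \<in> pts Q" "q1 \<in> pts Q" for q0 q1
  proof -
    have p: "(q0, q1) \<in> pts ?M" using q by simp
    have "mderiv ?M real_line L (q0, q1) (I.generator \<xi> (q0, q1)) = 0"
      by (rule I.generator_vertical[OF smooth_manifold_real_line L p invL[OF _ p]])
    then show ?thesis
      unfolding gen[OF q] D1_def D2_def using mderiv_partial[OF Q Q smooth_manifold_real_line L q] by simp
  qed
  have df: "force_minus f q0 q1 (?X q0) + force_plus f q0 q1 (?X q1) = \<mu>"
    if q: "q0 \<in> pts Q" "q1 \<in> pts Q" for q0 q1
  proof -
    have p: "(q0, q1) \<in> pts ?M" using q by simp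
    then have "linear (f (q0, q1))" using f unfolding smooth_one_form_def by blast
    from linear_add[OF this, of "(?X q0, 0)" "(0, ?X q1)"] \<mu>[OF p] show ?thesis
      by (simp add: gen[OF q] force_minus_def force_plus_def)
  qed
  \<comment> \<open>Invariance of L leaves only the force in J^+ - J^-.\<close>
  have diff: "J_plus G MG Q \<Phi> L f \<xi> q0 q1 = J_minus G MG Q \<Phi> L f \<xi> q0 q1 + \<mu>"
    if "q0 \<in> pts Q" "q1 \<in> pts Q" for q0 q1
    using dL[OF that] df[OF that] by (simp add: J_plus_def J_minus_def Let_def)
  \<comment> \<open>The discrete Euler-Lagrange equation paired with the generator at the middle point.\<close>
  have match: "J_minus G MG Q \<Phi> L f \<xi> q1 q2 = J_plus G MG Q \<Phi> L f \<xi> q0 q1"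
    if "trajectory Q L f q0 q1 q2" for q0 q1 q2
  proof -
    have "D2 Q L q0 q1 (?X q1) + D1 Q L q1 q2 (?X q1) + force_plus f q0 q1 (?X q1)
        + force_minus f q1 q2 (?X q1) = 0"
      using that by (simp add: trajectory_def)
    then show ?thesis by (simp add: J_plus_def J_minus_def Let_def)
  qed
  show ?thesis
  proof (intro exI[of _ \<mu>] allI impI)
    fix q0 q1 q2 assume t: "trajectory Q L f q0 q1 q2"
    then have "q0 \<in> pts Q" "q1 \<in> pts Q" "q2 \<in> pts Q" by (simp_all add: trajectory_def)
    then show "J_plus G MG Q \<Phi> L f \<xi> q1 q2 = J_plus G MG Q \<Phi> L f \<xi> q0 q1 + \<mu> \<and>
        J_minus G MG Q \<Phi> L f \<xi> q1 q2 = J_minus G MG Q \<Phi> L f \<xi> q0 q1 + \<mu>"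
      using match[OF t] diff[of q0 q1] diff[of q1 q2] by simp
  qed
qed

end
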